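(* Let $(X,T)$ be a minimal subshift with $X$ a Cantor set, such that $\operatorname{Inf}\mathcal{G}_T=0$ and $$\liminf_{n\to\infty}\frac{P_X(n)}{n}<\infty .$$ Then the mapping class group $\mathcal{M}(T)$ is virtually abelian.
   Context: A subshift $(X,T)$ is a closed shift-invariant subset $X$ of $\mathcal{A}^{\mathbb{Z}}$, $\mathcal{A}$ a finite alphabet, with $T$ the shift map. $P_X(n)$ is the number of words of length $n$ that occur in elements of $X$. Coinvariants. $\mathcal{G}_T=C(X,\mathbb{Z})/\{\gamma-\gamma\circ T^{-1}:\gamma\in C(X,\mathbb{Z})\}$. The subgroup of infinitesimals is $\operatorname{Inf}\mathcal{G}_T=\{[\gamma]\in\mathcal{G}_T : \int_X\gamma\,d\mu=0 \text{ for every } T\text{-invariant Borel probability measure } \mu\}$. Mapping class group. The suspension is $\Sigma_T X = X\times\mathbb{R}/\sim$, where $(x,t)\sim(T^n x,t-n)$ for $n\in\mathbb{Z}$, with $\mathbb{R}$-action $[(x,t)]+s=[(x,t+s)]$. The orbits of this flow are called leaves. $\operatorname{Homeo}^+\Sigma_TX$ is the topological group (uniform topology) of homeomorphisms of $\Sigma_TX$ that map each leaf onto a leaf preserving the orientation given by the flow. Two elements are isotopic if they are joined by a path in $\operatorname{Homeo}^+\Sigma_TX$; $\operatorname{Homeo}^+_0\Sigma_TX$ is the normal subgroup of elements isotopic to the identity, and $\mathcal{M}(T)=\operatorname{Homeo}^+\Sigma_TX/\operatorname{Homeo}^+_0\Sigma_TX$. *)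

theory Defs
  imports
    "HOL-Probability.Probability"
    "HOL-Algebra.Coset"
    "HOL-Algebra.Bij"
begin

section \<open>Subshifts\<close>

text \<open>The alphabet is a finite type, and the full shift carries the product of the
  discrete topologies.\<close>

definition full_shift :: "(int \<Rightarrow> 'a::finite) topology" where
  "full_shift = product_topology (\<lambda>_. discrete_topology UNIV) UNIV"

definition shift_by :: "int \<Rightarrow> (int \<Rightarrow> 'a) \<Rightarrow> (int \<Rightarrow> 'a)" where
  "shift_by n x = (\<lambda>i. x (i + n))"

abbreviation shift :: "(int \<Rightarrow> 'a) \<Rightarrow> (int \<Rightarrow> 'a)" where
  "shift \<equiv> shift_by 1"

lemma shift_by_iterate: "shift_by (int n) = shift ^^ n"
proof (induction n)
  case (Suc n)
  then show ?case by (simp add: shift_by_def fun_eq_iff ac_simps)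
qed (simp add: shift_by_def fun_eq_iff)

lemma shift_by_shift_by: "shift_by m (shift_by n x) = shift_by (m + n) x"
  by (simp add: shift_by_def add.assoc)

definition subshift :: "(int \<Rightarrow> 'a::finite) set \<Rightarrow> bool" where
  "subshift X \<longleftrightarrow> closedin full_shift X \<and> shift ` X = X"

definition shift_space :: "(int \<Rightarrow> 'a::finite) set \<Rightarrow> (int \<Rightarrow> 'a) topology" where
  "shift_space X = subtopology full_shift X"

definition minimal_subshift :: "(int \<Rightarrow> 'a::finite) set \<Rightarrow> bool" where
  "minimal_subshift X \<longleftrightarrow>
     subshift X \<and> X \<noteq> {} \<and> (\<forall>Y\<subseteq>X. subshift Y \<and> Y \<noteq> {} \<longrightarrow> Y = X)"

definition cantor_space :: "'b topology \<Rightarrow> bool" where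
  "cantor_space S \<longleftrightarrow>
     S homeomorphic_space product_topology (\<lambda>_::nat. discrete_topology (UNIV :: bool set)) UNIV"

definition words :: "(int \<Rightarrow> 'a) set \<Rightarrow> nat \<Rightarrow> 'a list set" where
  "words X n = {map (\<lambda>j. x (i + int j)) [0..<n] |x i. x \<in> X}"

definition complexity :: "(int \<Rightarrow> 'a) set \<Rightarrow> nat \<Rightarrow> nat" where
  "complexity X n = card (words X n)"


section \<open>Coinvariants and infinitesimals\<close>

text \<open>The additive group C(X,Z), with functions taken to be extensional on X. It is
  a HOL-Algebra monoid, so the group operation is written multiplicatively.\<close>

definition cont_int_group :: "(int \<Rightarrow> 'a::finite) set \<Rightarrow> ((int \<Rightarrow> 'a) \<Rightarrow> int) monoid" where
  "cont_int_group X =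
     \<lparr>carrier = {\<gamma> \<in> extensional X. continuous_map (shift_space X) (discrete_topology UNIV) \<gamma>},
      mult = (\<lambda>\<gamma> \<delta>. \<lambda>x\<in>X. \<gamma> x + \<delta> x),
      one = (\<lambda>x\<in>X. 0)\<rparr>"

definition coboundaries :: "(int \<Rightarrow> 'a::finite) set \<Rightarrow> ((int \<Rightarrow> 'a) \<Rightarrow> int) set" where
  "coboundaries X =
     (\<lambda>\<gamma>. \<lambda>x\<in>X. \<gamma> x - \<gamma> (shift_by (-1) x)) ` carrier (cont_int_group X)"

definition coinvariants :: "(int \<Rightarrow> 'a::finite) set \<Rightarrow> ((int \<Rightarrow> 'a) \<Rightarrow> int) set monoid" where
  "coinvariants X = cont_int_group X Mod coboundaries X"

definition invariant_borel_prob :: "(int \<Rightarrow> 'a::finite) set \<Rightarrow> (int \<Rightarrow> 'a) measure \<Rightarrow> bool" where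
  "invariant_borel_prob X \<mu> \<longleftrightarrow>
     prob_space \<mu> \<and> space \<mu> = X \<and> sets \<mu> = sigma_sets X {U. openin (shift_space X) U} \<and>
     (\<forall>B\<in>sets \<mu>. emeasure \<mu> (shift -` B \<inter> X) = emeasure \<mu> B)"

definition infinitesimals :: "(int \<Rightarrow> 'a::finite) set \<Rightarrow> ((int \<Rightarrow> 'a) \<Rightarrow> int) set set" where
  "infinitesimals X =
     {coboundaries X #>\<^bsub>cont_int_group X\<^esub> \<gamma> |\<gamma>. \<gamma> \<in> carrier (cont_int_group X) \<and>
        (\<forall>\<mu>. invariant_borel_prob X \<mu> \<longrightarrow> (\<integral>x. real_of_int (\<gamma> x) \<partial>\<mu>) = 0)}"


section \<open>The suspension and its flow\<close>

definition susp_rel :: "(int \<Rightarrow> 'a) set \<Rightarrow> (((int \<Rightarrow> 'a) \<times> real) \<times> ((int \<Rightarrow> 'a) \<times> real)) set" where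
  "susp_rel X =
     {((x, t), (y, s)). x \<in> X \<and> y \<in> X \<and> (\<exists>n. y = shift_by n x \<and> s = t - real_of_int n)}"

definition suspension :: "(int \<Rightarrow> 'a) set \<Rightarrow> ((int \<Rightarrow> 'a) \<times> real) set set" where
  "suspension X = (X \<times> UNIV) // susp_rel X"

text \<open>The quotient topology of the product topology on X \<open>\<times>\<close> R.\<close>

definition susp_space :: "(int \<Rightarrow> 'a::finite) set \<Rightarrow> ((int \<Rightarrow> 'a) \<times> real) set topology" where
  "susp_space X = topology (\<lambda>U. U \<subseteq> suspension X \<and>
     openin (prod_topology (shift_space X) euclideanreal) {p \<in> X \<times> UNIV. susp_rel X `` {p} \<in> U})"

text \<open>The set of translates of the members of a class is again a class; see
  \<open>flow_class\<close> below.\<close>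

definition flow :: "real \<Rightarrow> ((int \<Rightarrow> 'a) \<times> real) set \<Rightarrow> ((int \<Rightarrow> 'a) \<times> real) set" where
  "flow s c = (\<lambda>(x, t). (x, t + s)) ` c"

definition leaves :: "(int \<Rightarrow> 'a) set \<Rightarrow> ((int \<Rightarrow> 'a) \<times> real) set set set" where
  "leaves X = (\<lambda>c. range (\<lambda>s. flow s c)) ` suspension X"

lemma topspace_full_shift [simp]: "topspace full_shift = UNIV"
  by (simp add: full_shift_def)

lemma topspace_shift_space [simp]: "topspace (shift_space X) = X"
  by (simp add: shift_space_def)

lemma equiv_susp_rel: "equiv (X \<times> UNIV) (susp_rel X)"
proof (rule equivI)
  show "susp_rel X \<subseteq> (X \<times> UNIV) \<times> (X \<times> UNIV)"
    by (auto simp: susp_rel_def)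
  show "refl_on (X \<times> UNIV) (susp_rel X)"
    by (auto simp: refl_on_def susp_rel_def shift_by_def intro: exI[of _ 0])
  show "sym (susp_rel X)"
  proof (rule symI)
    fix p q assume "(p, q) \<in> susp_rel X"
    then obtain x t n where "p = (x, t)" "q = (shift_by n x, t - real_of_int n)"
      "x \<in> X" "shift_by n x \<in> X"
      by (auto simp: susp_rel_def)
    then show "(q, p) \<in> susp_rel X"
      by (auto simp: susp_rel_def shift_by_shift_by intro!: exI[of _ "- n"])
        (simp add: shift_by_def)
  qed
  show "trans (susp_rel X)"
  proof (rule transI)
    fix p q r assume "(p, q) \<in> susp_rel X" "(q, r) \<in> susp_rel X"
    then obtain x t m n where "p = (x, t)" "x \<in> X" "shift_by n (shift_by m x) \<in> X"
        "r = (shift_by n (shift_by m x), t - real_of_int m - real_of_int n)"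
      by (auto simp: susp_rel_def)
    then show "(p, r) \<in> susp_rel X"
      by (auto simp: susp_rel_def shift_by_shift_by intro!: exI[of _ "n + m"])
  qed
qed

lemma flow_class:
  "flow s (susp_rel X `` {(x, t)}) = susp_rel X `` {(x, t + s)}"
proof (rule Set.set_eqI)
  fix p :: "(int \<Rightarrow> 'a) \<times> real"
  obtain y r where p: "p = (y, r)" by (cases p)
  have "p \<in> flow s (susp_rel X `` {(x, t)}) \<longleftrightarrow> ((x, t), (y, r - s)) \<in> susp_rel X"
    by (force simp: p flow_def)
  also have "\<dots> \<longleftrightarrow> p \<in> susp_rel X `` {(x, t + s)}"
    by (simp add: p susp_rel_def algebra_simps)
  finally show "p \<in> flow s (susp_rel X `` {(x, t)}) \<longleftrightarrow> p \<in> susp_rel X `` {(x, t + s)}" .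
qed

lemma istopology_susp_space:
  "istopology (\<lambda>U. U \<subseteq> suspension X \<and>
     openin (prod_topology (shift_space X) euclideanreal) {p \<in> X \<times> UNIV. susp_rel X `` {p} \<in> U})"
    (is "istopology ?O")
  unfolding istopology_def
proof (intro conjI allI impI)
  let ?P = "prod_topology (shift_space X) euclideanreal"
  let ?pre = "\<lambda>U. {p \<in> X \<times> UNIV. susp_rel X `` {p} \<in> U}"
  fix S T assume "?O S" "?O T"
  moreover have "?pre (S \<inter> T) = ?pre S \<inter> ?pre T" by blast
  ultimately show "S \<inter> T \<subseteq> suspension X" "openin ?P (?pre (S \<inter> T))"
    by (auto simp: openin_Int)
next
  let ?P = "prod_topology (shift_space X) euclideanreal"
  let ?pre = "\<lambda>U. {p \<in> X \<times> UNIV. susp_rel X `` {p} \<in> U}"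
  fix \<K> assume K: "\<forall>U\<in>\<K>. ?O U"
  then show "\<Union>\<K> \<subseteq> suspension X" by blast
  have "?pre (\<Union>\<K>) = (\<Union>U\<in>\<K>. ?pre U)" by blast
  then show "openin ?P (?pre (\<Union>\<K>))" using K by auto
qed

lemma openin_susp_space:
  "openin (susp_space X) U \<longleftrightarrow> U \<subseteq> suspension X \<and>
     openin (prod_topology (shift_space X) euclideanreal) {p \<in> X \<times> UNIV. susp_rel X `` {p} \<in> U}"
  using istopology_susp_space[of X] by (simp add: susp_space_def)

lemma topspace_susp_space [simp]: "topspace (susp_space X) = suspension X"
proof -
  have "{p \<in> X \<times> UNIV. susp_rel X `` {p} \<in> suspension X} =
      topspace (prod_topology (shift_space X) euclideanreal)"
    by (auto simp: suspension_def intro: quotientI)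
  then have "openin (susp_space X) (suspension X)"
    unfolding openin_susp_space by (simp only: openin_topspace subset_refl simp_thms)
  then show ?thesis
    using openin_subset openin_susp_space[of X "topspace (susp_space X)"] by auto
qed

lemma quotient_map_susp_space:
  "quotient_map (prod_topology (shift_space X) euclideanreal) (susp_space X)
     (\<lambda>p. susp_rel X `` {p})"
  unfolding quotient_map_def
proof (intro conjI allI impI)
  show "(\<lambda>p. susp_rel X `` {p}) ` topspace (prod_topology (shift_space X) euclideanreal) =
      topspace (susp_space X)"
    by (simp add: suspension_def quotient_def UNION_singleton_eq_range)
  fix U assume "U \<subseteq> topspace (susp_space X)"
  then show "openin (prod_topology (shift_space X) euclideanreal)
      {p \<in> topspace (prod_topology (shift_space X) euclideanreal). susp_rel X `` {p} \<in> U} =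
      openin (susp_space X) U"
    by (simp add: openin_susp_space)
qed


section \<open>The mapping class group\<close>

text \<open>A homeomorphism preserves the orientation of a leaf if, in the parametrisations of
  the leaf and of its image by the flow, it is given by an increasing homeomorphism
  of the real line. For a periodic leaf this is a lift to the universal cover.\<close>

definition homeo_plus ::
    "(int \<Rightarrow> 'a::finite) set \<Rightarrow> (((int \<Rightarrow> 'a) \<times> real) set \<Rightarrow> ((int \<Rightarrow> 'a) \<times> real) set) set" where
  "homeo_plus X =
     {f \<in> extensional (suspension X). homeomorphic_map (susp_space X) (susp_space X) f \<and>
        (\<forall>L\<in>leaves X. f ` L \<in> leaves X \<and>
           (\<forall>c\<in>L. \<exists>h. strict_mono h \<and> continuous_on UNIV h \<and> range h = UNIV \<and>
              (\<forall>s. f (flow s c) = flow (h s) (f c))))}"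

definition homeo_plus_group ::
    "(int \<Rightarrow> 'a::finite) set \<Rightarrow> (((int \<Rightarrow> 'a) \<times> real) set \<Rightarrow> ((int \<Rightarrow> 'a) \<times> real) set) monoid" where
  "homeo_plus_group X = BijGroup (suspension X)\<lparr>carrier := homeo_plus X\<rparr>"

text \<open>The uniform topology. The suspension of a subshift is compact metrizable, so its
  unique compatible uniformity consists of all neighbourhoods of the diagonal, and no
  metric needs to be chosen; \<open>openin_homeo_plus_space_metric\<close> below is the
  description by an arbitrary compatible metric.\<close>

definition homeo_plus_space ::
    "(int \<Rightarrow> 'a::finite) set \<Rightarrow> (((int \<Rightarrow> 'a) \<times> real) set \<Rightarrow> ((int \<Rightarrow> 'a) \<times> real) set) topology" where
  "homeo_plus_space X = topology (\<lambda>W. W \<subseteq> homeo_plus X \<and>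
     (\<forall>f\<in>W. \<exists>V. openin (prod_topology (susp_space X) (susp_space X)) V \<and>
        (\<forall>c\<in>suspension X. (c, c) \<in> V) \<and>
        {g \<in> homeo_plus X. \<forall>c\<in>suspension X. (f c, g c) \<in> V} \<subseteq> W))"

text \<open>Isotopy is the relation \<^const>\<open>path_component_of\<close> of this space.\<close>

definition homeo_plus_0 ::
    "(int \<Rightarrow> 'a::finite) set \<Rightarrow> (((int \<Rightarrow> 'a) \<times> real) set \<Rightarrow> ((int \<Rightarrow> 'a) \<times> real) set) set" where
  "homeo_plus_0 X = path_component_of_set (homeo_plus_space X) \<one>\<^bsub>homeo_plus_group X\<^esub>"

definition mapping_class_group ::
    "(int \<Rightarrow> 'a::finite) set \<Rightarrow> (((int \<Rightarrow> 'a) \<times> real) set \<Rightarrow> ((int \<Rightarrow> 'a) \<times> real) set) set monoid" where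
  "mapping_class_group X = homeo_plus_group X Mod homeo_plus_0 X"

definition virtually_abelian :: "('g, 'h) monoid_scheme \<Rightarrow> bool" where
  "virtually_abelian G \<longleftrightarrow> group G \<and>
     (\<exists>H. subgroup H G \<and> finite (rcosets\<^bsub>G\<^esub> H) \<and> comm_group (G\<lparr>carrier := H\<rparr>))"

lemma istopology_homeo_plus_space:
  "istopology (\<lambda>W. W \<subseteq> homeo_plus X \<and>
     (\<forall>f\<in>W. \<exists>V. openin (prod_topology (susp_space X) (susp_space X)) V \<and>
        (\<forall>c\<in>suspension X. (c, c) \<in> V) \<and>
        {g \<in> homeo_plus X. \<forall>c\<in>suspension X. (f c, g c) \<in> V} \<subseteq> W))"
    (is "istopology ?O")
  unfolding istopology_def
proof (rule conjI; intro allI impI)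
  let ?P = "prod_topology (susp_space X) (susp_space X)"
  let ?nb = "\<lambda>f V. {g \<in> homeo_plus X. \<forall>c\<in>suspension X. (f c, g c) \<in> V}"
  fix S T assume S: "?O S" and T: "?O T"
  show "?O (S \<inter> T)"
  proof (intro conjI ballI)
    show "S \<inter> T \<subseteq> homeo_plus X" using S by blast
    fix f assume f: "f \<in> S \<inter> T"
    obtain V where V: "openin ?P V" "\<forall>c\<in>suspension X. (c, c) \<in> V" "?nb f V \<subseteq> S"
      using S f by (elim conjE) (drule (1) bspec[OF _ IntD1], blast)
    obtain V' where V': "openin ?P V'" "\<forall>c\<in>suspension X. (c, c) \<in> V'" "?nb f V' \<subseteq> T"
      using T f by (elim conjE) (drule (1) bspec[OF _ IntD2], blast)
    have "openin ?P (V \<inter> V')" using V V' by blast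
    moreover have "\<forall>c\<in>suspension X. (c, c) \<in> V \<inter> V'" using V V' by blast
    moreover have "?nb f (V \<inter> V') \<subseteq> S \<inter> T" using V(3) V'(3) by blast
    ultimately show "\<exists>V. openin ?P V \<and> (\<forall>c\<in>suspension X. (c, c) \<in> V) \<and> ?nb f V \<subseteq> S \<inter> T"
      by blast
  qed
next
  fix \<K> assume K: "\<forall>W\<in>\<K>. ?O W"
  show "?O (\<Union>\<K>)"
  proof (intro conjI ballI)
    show "\<Union>\<K> \<subseteq> homeo_plus X" using K by blast
    fix f assume "f \<in> \<Union>\<K>"
    then obtain W where "W \<in> \<K>" "f \<in> W" by blast
    with K show "\<exists>V. openin (prod_topology (susp_space X) (susp_space X)) V \<and>
        (\<forall>c\<in>suspension X. (c, c) \<in> V) \<and>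
        {g \<in> homeo_plus X. \<forall>c\<in>suspension X. (f c, g c) \<in> V} \<subseteq> \<Union>\<K>"
      by (meson Union_upper order_trans)
  qed
qed

lemma openin_homeo_plus_space:
  "openin (homeo_plus_space X) W \<longleftrightarrow> W \<subseteq> homeo_plus X \<and>
     (\<forall>f\<in>W. \<exists>V. openin (prod_topology (susp_space X) (susp_space X)) V \<and>
        (\<forall>c\<in>suspension X. (c, c) \<in> V) \<and>
        {g \<in> homeo_plus X. \<forall>c\<in>suspension X. (f c, g c) \<in> V} \<subseteq> W)"
  using istopology_homeo_plus_space[of X] by (simp add: homeo_plus_space_def)

lemma topspace_homeo_plus_space [simp]: "topspace (homeo_plus_space X) = homeo_plus X"
proof -
  have "openin (homeo_plus_space X) (homeo_plus X)"
    unfolding openin_homeo_plus_space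
    by (auto intro!: exI[of _ "topspace (prod_topology (susp_space X) (susp_space X))"])
  then show ?thesis
    using openin_subset openin_homeo_plus_space[of X "topspace (homeo_plus_space X)"] by auto
qed

lemma (in Metric_space) openin_entourage:
  "openin (prod_topology mtopology mtopology) {(x, y). x \<in> M \<and> y \<in> M \<and> d x y < e}"
  unfolding openin_prod_topology_alt
proof (intro allI impI)
  fix x y assume "(x, y) \<in> {(x, y). x \<in> M \<and> y \<in> M \<and> d x y < e}"
  then have xy: "x \<in> M" "y \<in> M" "d x y < e" by auto
  define r where "r = (e - d x y) / 2"
  have "r > 0" using xy by (simp add: r_def)
  have "d u v < e" if "u \<in> mball x r" "v \<in> mball y r" for u v
  proof -
    have uv: "u \<in> M" "v \<in> M" "d x u < r" "d y v < r" using that by auto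
    have "d u v \<le> d u x + d x v" by (rule triangle) (use uv xy in auto)
    also have "d x v \<le> d x y + d y v" by (rule triangle) (use uv xy in auto)
    also have "d u x = d x u" by (rule commute)
    finally show ?thesis using uv by (simp add: r_def)
  qed
  then have "mball x r \<times> mball y r \<subseteq> {(x, y). x \<in> M \<and> y \<in> M \<and> d x y < e}" by auto
  then show "\<exists>U V. openin mtopology U \<and> openin mtopology V \<and> x \<in> U \<and> y \<in> V \<and>
      U \<times> V \<subseteq> {(x, y). x \<in> M \<and> y \<in> M \<and> d x y < e}"
    using \<open>r > 0\<close> xy by (meson centre_in_mball_iff openin_mball)
qed

lemma (in Metric_space) compact_entourage:
  assumes "compact_space mtopology" "openin (prod_topology mtopology mtopology) V"
    and diag: "\<And>x. x \<in> M \<Longrightarrow> (x, x) \<in> V"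
  obtains e where "e > 0" "\<And>x y. x \<in> M \<Longrightarrow> y \<in> M \<Longrightarrow> d x y < e \<Longrightarrow> (x, y) \<in> V"
proof -
  define \<C> where "\<C> = {U. openin mtopology U \<and> U \<times> U \<subseteq> V}"
  have "M \<subseteq> \<Union>\<C>"
  proof
    fix x assume "x \<in> M"
    then have "(x, x) \<in> V" by (rule diag)
    then obtain A B where "openin mtopology A" "openin mtopology B" "x \<in> A" "x \<in> B" "A \<times> B \<subseteq> V"
      using assms(2) unfolding openin_prod_topology_alt by meson
    then have "A \<inter> B \<in> \<C>" "x \<in> A \<inter> B" by (auto simp: \<C>_def)
    then show "x \<in> \<Union>\<C>" by blast
  qed
  moreover have "compactin mtopology M" using assms(1) by (simp add: compact_space_def)
  ultimately obtain e where e: "e > 0" "\<forall>x\<in>M. \<exists>U\<in>\<C>. mball x e \<subseteq> U"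
    using lebesgue_number[of M \<C>] unfolding \<C>_def by blast
  show ?thesis
  proof
    fix x y assume xy: "x \<in> M" "y \<in> M" "d x y < e"
    then obtain U where U: "U \<in> \<C>" "mball x e \<subseteq> U" using e by blast
    have "x \<in> mball x e" "y \<in> mball x e" using xy e(1) by auto
    then have "(x, y) \<in> U \<times> U" using U(2) by blast
    then show "(x, y) \<in> V" using U(1) by (auto simp: \<C>_def)
  qed (fact e(1))
qed

lemma openin_homeo_plus_space_metric:
  assumes m: "mtopology_of m = susp_space X" and "compact_space (susp_space X)"
  shows "openin (homeo_plus_space X) W \<longleftrightarrow> W \<subseteq> homeo_plus X \<and>
    (\<forall>f\<in>W. \<exists>e>0. {g \<in> homeo_plus X. \<forall>c\<in>suspension X. mdist m (f c) (g c) < e} \<subseteq> W)"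
    (is "_ \<longleftrightarrow> ?R")
proof -
  interpret Metric_space "mspace m" "mdist m" by simp
  have top: "mtopology = susp_space X" using m by (simp add: mtopology_of_def)
  have M: "mspace m = suspension X" using top by (metis topspace_mtopology topspace_susp_space)
  have maps: "f c \<in> suspension X" if "f \<in> homeo_plus X" "c \<in> suspension X" for f c
    using that homeomorphic_imp_surjective_map[of "susp_space X" "susp_space X" f]
    by (auto simp: homeo_plus_def)
  show ?thesis
  proof
    assume W: "openin (homeo_plus_space X) W"
    then have sub: "W \<subseteq> homeo_plus X" by (simp add: openin_homeo_plus_space)
    have "\<exists>e>0. {g \<in> homeo_plus X. \<forall>c\<in>suspension X. mdist m (f c) (g c) < e} \<subseteq> W"
      if fW: "f \<in> W" for f
    proof -
      obtain V where V: "openin (prod_topology (susp_space X) (susp_space X)) V"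
          "\<forall>c\<in>suspension X. (c, c) \<in> V"
          "{g \<in> homeo_plus X. \<forall>c\<in>suspension X. (f c, g c) \<in> V} \<subseteq> W"
        using bspec[OF conjunct2[OF W[unfolded openin_homeo_plus_space]] fW] by blast
      obtain e where e: "e > 0"
          "\<And>x y. x \<in> suspension X \<Longrightarrow> y \<in> suspension X \<Longrightarrow> mdist m x y < e \<Longrightarrow> (x, y) \<in> V"
      proof (rule compact_entourage[of V, unfolded top])
        show "(x, x) \<in> V" if "x \<in> mspace m" for x using that V(2) M by blast
      qed (use assms(2) V(1) M in auto)
      have "{g \<in> homeo_plus X. \<forall>c\<in>suspension X. mdist m (f c) (g c) < e}
          \<subseteq> {g \<in> homeo_plus X. \<forall>c\<in>suspension X. (f c, g c) \<in> V}"
      proof clarify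
        fix g c assume "g \<in> homeo_plus X" "\<forall>c\<in>suspension X. mdist m (f c) (g c) < e"
          "c \<in> suspension X"
        then show "(f c, g c) \<in> V" using e(2) maps sub fW by (meson subsetD)
      qed
      then show ?thesis using e(1) V(3) by blast
    qed
    then show ?R by (intro conjI ballI sub)
  next
    assume R: ?R
    have "\<exists>V. openin (prod_topology (susp_space X) (susp_space X)) V \<and>
        (\<forall>c\<in>suspension X. (c, c) \<in> V) \<and>
        {g \<in> homeo_plus X. \<forall>c\<in>suspension X. (f c, g c) \<in> V} \<subseteq> W" if fW: "f \<in> W" for f
    proof -
      obtain e where e: "e > 0"
          "{g \<in> homeo_plus X. \<forall>c\<in>suspension X. mdist m (f c) (g c) < e} \<subseteq> W"
        using bspec[OF conjunct2[OF R] fW] by blast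
      let ?V = "{(x, y). x \<in> suspension X \<and> y \<in> suspension X \<and> mdist m x y < e}"
      have "openin (prod_topology (susp_space X) (susp_space X)) ?V"
        using openin_entourage[of e, unfolded top] by (simp add: M)
      moreover have "\<forall>c\<in>suspension X. (c, c) \<in> ?V" using e(1) M by auto
      moreover have "{g \<in> homeo_plus X. \<forall>c\<in>suspension X. (f c, g c) \<in> ?V} \<subseteq> W"
        using e(2) by auto
      ultimately show ?thesis by blast
    qed
    then show "openin (homeo_plus_space X) W"
      unfolding openin_homeo_plus_space by (intro conjI ballI conjunct1[OF R])
  qed
qed

end

theory Submission
  imports Defs
begin

text \<open>
  Every element of \<open>Homeo\<^sup>+\<close> lifts to a map \<open>(x, t) \<mapsto> (y x, \<tau> x t)\<close> of X \<open>\<times>\<close> R, increasing in t, with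
  \<open>y (T x) = T\<^bsup>k x\<^esup> (y x)\<close> for a continuous integer function k. Pulling integer functions back along
  such orbit maps gives an action on the cone of invariant contents (finitely additive invariant
  measures on clopen sets). By the Riesz-Kantorovich formula this cone has meets. If
  P(n+1) - P(n) \<open>\<le>\<close> C, a content is determined at level n by its values on the at most C |A|
  one-letter extensions of right special words; such n exist beyond any bound, so the number of
  pairwise disjoint contents is bounded. Hence the cone is generated by finitely many atoms, whose
  rays are permuted by \<open>Homeo\<^sup>+\<close>.

  Right special words of length n also bound the number of classes of left asymptotic leaves (leaves
  that agree, up to a shift, far to the left) containing more than one leaf; by compactness such a
  class exists, and these finitely many classes are permuted as well.

  A commutator of two elements that fix all these rays and classes fixes every invariant content. As
  there are no infinitesimals, k - 1 is then a coboundary, and the lift can be chosen with y commuting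
  with T. As a class of asymptotic leaves is fixed, y agrees with a power of T far to the left on a
  point, and by minimality everywhere. The homeomorphism therefore moves each point along its leaf,
  and interpolating linearly along the leaves joins it to the identity.
\<close>

section \<open>Cylinders and compactness\<close>

text \<open>Elements of the finite index subgroup may stretch the rays that they fix, so they need
  not fix the contents themselves. This is why only commutators are shown to be isotopic to the
  identity: the stretching factors of two elements multiply in either order and cancel in a
  commutator. Once all contents are fixed, what remains of the homeomorphism is a continuous
  self-map of X commuting with T. Such a map may fail to be a power of T; the asymptotic classes are
  there to exclude this. The hypothesis on liminf gives few right special words only at infinitely
  many lengths, which cannot be prescribed. Both finiteness proofs therefore start from an arbitrary
  finite family, find the length from which words tell its members apart, and only then pick a good
  length. For asymptotic classes this is a plain injection into right special words. Disjoint
  contents are separated only up to an error, so there a linear dependence is contradicted by an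
  almost diagonal matrix.\<close>

definition agree :: "nat \<Rightarrow> (int \<Rightarrow> 'a) \<Rightarrow> (int \<Rightarrow> 'a) \<Rightarrow> bool" where
  "agree n x y \<longleftrightarrow> (\<forall>i. \<bar>i\<bar> \<le> int n \<longrightarrow> x i = y i)"

lemma agreeD: "agree n x y \<Longrightarrow> \<bar>i\<bar> \<le> int n \<Longrightarrow> x i = y i"
  by (simp add: agree_def)

lemma agree_refl [simp]: "agree n x x"
  by (simp add: agree_def)

lemma agree_sym: "agree n x y \<Longrightarrow> agree n y x"
  by (simp add: agree_def)

lemma agree_trans: "agree n x y \<Longrightarrow> agree n y z \<Longrightarrow> agree n x z"
  by (simp add: agree_def)

lemma agree_mono: "agree n x y \<Longrightarrow> m \<le> n \<Longrightarrow> agree m x y"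
  by (simp add: agree_def)

lemma shift_by_0 [simp]: "shift_by 0 x = x"
  by (simp add: shift_by_def)

lemma shift_by_apply: "shift_by n x i = x (i + n)"
  by (simp add: shift_by_def)

lemma agree_shift: "agree (n + nat \<bar>k\<bar>) x y \<Longrightarrow> agree n (shift_by k x) (shift_by k y)"
  by (auto simp: agree_def shift_by_apply)

lemma openin_full_shift_iff:
  "openin full_shift U \<longleftrightarrow> (\<forall>x\<in>U. \<exists>n. \<forall>y. agree n x y \<longrightarrow> y \<in> U)"
proof
  assume *: "openin full_shift U"
  show "\<forall>x\<in>U. \<exists>n. \<forall>y. agree n x y \<longrightarrow> y \<in> U"
  proof
    fix x assume "x \<in> U"
    then obtain V where V: "finite {i. V i \<noteq> UNIV}" "x \<in> Pi\<^sub>E UNIV V" "Pi\<^sub>E UNIV V \<subseteq> U"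
      using * unfolding full_shift_def openin_product_topology_alt by auto
    \<comment> \<open>The window reaches the farthest constrained coordinate. The inserted 0 keeps
      \<open>Max\<close> meaningful if no coordinate is constrained.\<close>
    define n where "n = nat (Max (insert 0 (abs ` {i. V i \<noteq> UNIV})))"
    have n: "\<bar>i\<bar> \<le> int n" if "V i \<noteq> UNIV" for i
    proof -
      have "\<bar>i\<bar> \<le> Max (insert 0 (abs ` {i. V i \<noteq> UNIV}))"
        using V(1) that by (intro Max_ge) auto
      then show ?thesis unfolding n_def by linarith
    qed
    have "y \<in> U" if "agree n x y" for y
    proof -
      have "y i \<in> V i" for i
        using V(2) n[of i] agreeD[OF that, of i] by (cases "V i = UNIV") (auto simp: PiE_iff, metis)
      then show ?thesis using V(3) by (auto simp: PiE_iff)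
    qed
    then show "\<exists>n. \<forall>y. agree n x y \<longrightarrow> y \<in> U" by blast
  qed
next
  assume *: "\<forall>x\<in>U. \<exists>n. \<forall>y. agree n x y \<longrightarrow> y \<in> U"
  show "openin full_shift U"
    unfolding full_shift_def openin_product_topology_alt
  proof
    fix x assume "x \<in> U"
    with * obtain n where n: "\<And>y. agree n x y \<Longrightarrow> y \<in> U" by blast
    let ?V = "\<lambda>i. if \<bar>i\<bar> \<le> int n then {x i} else UNIV"
    have "{i. ?V i \<noteq> UNIV} \<subseteq> {- int n..int n}" by auto
    then have "finite {i. ?V i \<noteq> UNIV}" by (rule finite_subset) simp
    moreover have "Pi\<^sub>E UNIV ?V \<subseteq> U"
    proof
      fix y assume "y \<in> Pi\<^sub>E UNIV ?V"
      then have "y i \<in> ?V i" for i by (auto simp: PiE_iff)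
      then have "agree n x y" unfolding agree_def by (metis singletonD)
      then show "y \<in> U" by (rule n)
    qed
    ultimately show "\<exists>V. finite {i \<in> UNIV. V i \<noteq> topspace (discrete_topology UNIV)} \<and>
        (\<forall>i\<in>UNIV. openin (discrete_topology UNIV) (V i)) \<and> x \<in> Pi\<^sub>E UNIV V \<and> Pi\<^sub>E UNIV V \<subseteq> U"
      by (intro exI[of _ ?V]) auto
  qed
qed

lemma openin_shift_space_iff:
  "openin (shift_space X) U \<longleftrightarrow> U \<subseteq> X \<and> (\<forall>x\<in>U. \<exists>n. \<forall>y\<in>X. agree n x y \<longrightarrow> y \<in> U)"
proof
  assume "openin (shift_space X) U"
  then show "U \<subseteq> X \<and> (\<forall>x\<in>U. \<exists>n. \<forall>y\<in>X. agree n x y \<longrightarrow> y \<in> U)"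
    unfolding shift_space_def openin_subtopology openin_full_shift_iff by blast
next
  assume *: "U \<subseteq> X \<and> (\<forall>x\<in>U. \<exists>n. \<forall>y\<in>X. agree n x y \<longrightarrow> y \<in> U)"
  let ?V = "{y. \<exists>n. \<exists>x\<in>U. agree n x y \<and> (\<forall>y\<in>X. agree n x y \<longrightarrow> y \<in> U)}"
  have "openin full_shift ?V"
    unfolding openin_full_shift_iff using agree_trans by blast
  moreover have "U = ?V \<inter> X" using * agree_refl by blast
  ultimately show "openin (shift_space X) U"
    unfolding shift_space_def openin_subtopology by blast
qed

lemma openin_prod_shift_space_iff:
  "openin (prod_topology (shift_space X) euclideanreal) W \<longleftrightarrow> W \<subseteq> X \<times> UNIV \<and>
     (\<forall>x t. (x, t) \<in> W \<longrightarrow> (\<exists>n e. e > 0 \<and> (\<forall>y\<in>X. \<forall>s. agree n x y \<and> \<bar>s - t\<bar> < e \<longrightarrow> (y, s) \<in> W)))"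
proof
  assume *: "openin (prod_topology (shift_space X) euclideanreal) W"
  have "\<exists>n e. e > 0 \<and> (\<forall>y\<in>X. \<forall>s. agree n x y \<and> \<bar>s - t\<bar> < e \<longrightarrow> (y, s) \<in> W)"
    if W: "(x, t) \<in> W" for x t
  proof -
    obtain U V where UV: "openin (shift_space X) U" "open V" "x \<in> U" "t \<in> V" "U \<times> V \<subseteq> W"
      using *[unfolded openin_prod_topology_alt, rule_format, OF W] by auto
    obtain n where n: "\<And>y. y \<in> X \<Longrightarrow> agree n x y \<Longrightarrow> y \<in> U"
      using UV(1,3) unfolding openin_shift_space_iff by blast
    obtain e where "e > 0" "\<And>s. \<bar>s - t\<bar> < e \<Longrightarrow> s \<in> V"
      using UV(2,4) unfolding open_dist dist_real_def by blast
    then show ?thesis using n UV(5) by blast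
  qed
  then show "W \<subseteq> X \<times> UNIV \<and>
     (\<forall>x t. (x, t) \<in> W \<longrightarrow> (\<exists>n e. e > 0 \<and> (\<forall>y\<in>X. \<forall>s. agree n x y \<and> \<bar>s - t\<bar> < e \<longrightarrow> (y, s) \<in> W)))"
    using openin_subset[OF *] by simp
next
  assume *: "W \<subseteq> X \<times> UNIV \<and>
     (\<forall>x t. (x, t) \<in> W \<longrightarrow> (\<exists>n e. e > 0 \<and> (\<forall>y\<in>X. \<forall>s. agree n x y \<and> \<bar>s - t\<bar> < e \<longrightarrow> (y, s) \<in> W)))"
  show "openin (prod_topology (shift_space X) euclideanreal) W"
    unfolding openin_prod_topology_alt
  proof (intro allI impI)
    fix x t assume W: "(x, t) \<in> W"
    then obtain n e where ne: "e > 0" "\<And>y s. y \<in> X \<Longrightarrow> agree n x y \<Longrightarrow> \<bar>s - t\<bar> < e \<Longrightarrow> (y, s) \<in> W"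
      using * by meson
    have "openin (shift_space X) {y \<in> X. agree n x y}"
      unfolding openin_shift_space_iff using agree_trans by blast
    moreover have "openin euclideanreal (ball t e)" by simp
    moreover have "x \<in> {y \<in> X. agree n x y}" using W * by auto
    moreover have "{y \<in> X. agree n x y} \<times> ball t e \<subseteq> W"
      using ne(2) by (auto simp: dist_real_def)
    ultimately show "\<exists>U V. openin (shift_space X) U \<and> openin euclideanreal V \<and> x \<in> U \<and> t \<in> V \<and> U \<times> V \<subseteq> W"
      using ne(1) by (metis centre_in_ball)
  qed
qed

section \<open>Locally constant functions\<close>

definition locally_const :: "(int \<Rightarrow> 'a) set \<Rightarrow> ((int \<Rightarrow> 'a) \<Rightarrow> 'b) \<Rightarrow> bool" where
  "locally_const X g \<longleftrightarrow> (\<forall>x\<in>X. \<exists>n. \<forall>y\<in>X. agree n x y \<longrightarrow> g y = g x)"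

lemma locally_const_const [simp]: "locally_const X (\<lambda>_. c)"
  by (simp add: locally_const_def)

lemma locally_const_comp: "locally_const X f \<Longrightarrow> locally_const X (\<lambda>x. F (f x))"
  unfolding locally_const_def by metis

lemma locally_const_comp2:
  assumes "locally_const X f" "locally_const X g"
  shows "locally_const X (\<lambda>x. F (f x) (g x))"
  unfolding locally_const_def
proof
  fix x assume x: "x \<in> X"
  obtain m n where "\<And>y. y \<in> X \<Longrightarrow> agree m x y \<Longrightarrow> f y = f x" "\<And>y. y \<in> X \<Longrightarrow> agree n x y \<Longrightarrow> g y = g x"
    using assms x unfolding locally_const_def by meson
  then have "\<forall>y\<in>X. agree (max m n) x y \<longrightarrow> F (f y) (g y) = F (f x) (g x)"
    by (metis agree_mono max.cobounded1 max.cobounded2)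
  then show "\<exists>n. \<forall>y\<in>X. agree n x y \<longrightarrow> F (f y) (g y) = F (f x) (g x)" by blast
qed

lemma locally_const_sum:
  assumes "finite I" "\<And>i. i \<in> I \<Longrightarrow> locally_const X (f i)"
  shows "locally_const X (\<lambda>x. \<Sum>i\<in>I. f i x)"
  using assms by (induction I rule: finite_induct) (auto intro: locally_const_comp2[where F = "(+)"])

lemma locally_const_prod:
  assumes "finite I" "\<And>i. i \<in> I \<Longrightarrow> locally_const X (f i)"
  shows "locally_const X (\<lambda>x. \<Prod>i\<in>I. f i x)"
  using assms by (induction I rule: finite_induct) (auto intro: locally_const_comp2[where F = "(*)"])

lemma locally_const_cong:
  assumes "\<And>x. x \<in> X \<Longrightarrow> f x = g x"
  shows "locally_const X f \<longleftrightarrow> locally_const X g"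
  using assms unfolding locally_const_def by metis

lemma locally_const_window:
  assumes "\<And>x y. x \<in> X \<Longrightarrow> y \<in> X \<Longrightarrow> agree n x y \<Longrightarrow> g x = g y"
  shows "locally_const X g"
  using assms unfolding locally_const_def by metis

lemma continuous_map_discrete_iff:
  "continuous_map (shift_space X) (discrete_topology UNIV) g \<longleftrightarrow> locally_const X g"
proof
  assume *: "continuous_map (shift_space X) (discrete_topology UNIV) g"
  show "locally_const X g"
    unfolding locally_const_def
  proof
    fix x assume x: "x \<in> X"
    have "openin (shift_space X) {y \<in> X. g y \<in> {g x}}"
      using * openin_continuous_map_preimage[of "shift_space X" "discrete_topology UNIV" g "{g x}"] by simp
    then show "\<exists>n. \<forall>y\<in>X. agree n x y \<longrightarrow> g y = g x"
      using x unfolding openin_shift_space_iff by fastforce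
  qed
next
  assume *: "locally_const X g"
  show "continuous_map (shift_space X) (discrete_topology UNIV) g"
    unfolding continuous_map_def
  proof (intro conjI allI impI)
    fix U
    show "openin (shift_space X) {x \<in> topspace (shift_space X). g x \<in> U}"
      unfolding openin_shift_space_iff
    proof (intro conjI ballI)
      fix x assume "x \<in> {x \<in> topspace (shift_space X). g x \<in> U}"
      then have x: "x \<in> X" "g x \<in> U" by auto
      then obtain n where n: "\<And>y. y \<in> X \<Longrightarrow> agree n x y \<Longrightarrow> g y = g x"
        using * unfolding locally_const_def by blast
      have "y \<in> {x \<in> topspace (shift_space X). g x \<in> U}" if "y \<in> X" "agree n x y" for y
        using x(2) that(1) n[OF that] by simp
      then show "\<exists>n. \<forall>y\<in>X. agree n x y \<longrightarrow> y \<in> {x \<in> topspace (shift_space X). g x \<in> U}" by blast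
    qed auto
  qed simp
qed

section \<open>Compactness, recurrence and aperiodicity\<close>

locale minimal_infinite_subshift =
  fixes X :: "(int \<Rightarrow> 'a::finite) set"
  assumes minimal: "minimal_subshift X" and infinite_X: "infinite X"
begin

lemma shift_mem: "x \<in> X \<Longrightarrow> shift_by n x \<in> X"
proof (induction n rule: int_induct[where k = 0])
  case (step1 i)
  then have "shift (shift_by i x) \<in> X"
    using minimal unfolding minimal_subshift_def subshift_def by blast
  then show ?case by (simp add: shift_by_shift_by add.commute)
next
  case (step2 i)
  then obtain y where y: "y \<in> X" "shift_by i x = shift y"
    using minimal unfolding minimal_subshift_def subshift_def by blast
  have "shift_by (i - 1) x = shift_by (-1) (shift_by i x)"
    by (simp add: shift_by_shift_by)
  also have "\<dots> = y" by (simp add: y(2) shift_by_shift_by)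
  finally show ?case using y(1) by simp
qed simp

lemma shift_mem_iff [simp]: "shift_by n x \<in> X \<longleftrightarrow> x \<in> X"
  using shift_mem[of "shift_by n x" "-n"] shift_mem by (auto simp: shift_by_shift_by)

lemma compact_space_shift_space: "compact_space (shift_space X)"
proof -
  have "compact_space (full_shift :: (int \<Rightarrow> 'a) topology)"
    unfolding full_shift_def by (simp add: compact_space_product_topology compact_space_discrete_topology)
  then show ?thesis
    using minimal unfolding minimal_subshift_def subshift_def shift_space_def
    by (intro compact_space_subtopology closedin_compact_space) auto
qed

text \<open>Finitely many of the open sets on which \<open>Q m\<close> holds locally cover X, and
  \<open>mono\<close> replaces their indices by the largest one. Window sizes, bounds and return
  times that are uniform on X are all obtained in this way.\<close>

lemma compact_uniform:
  assumes ex: "\<And>x. x \<in> X \<Longrightarrow> \<exists>m n. \<forall>y\<in>X. agree n x y \<longrightarrow> Q m y"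
    and mono: "\<And>m m' x. x \<in> X \<Longrightarrow> m \<le> m' \<Longrightarrow> Q m x \<Longrightarrow> Q m' x"
  obtains m :: nat where "\<And>x. x \<in> X \<Longrightarrow> Q m x"
proof -
  define U where "U m = {x \<in> X. \<exists>n. \<forall>y\<in>X. agree n x y \<longrightarrow> Q m y}" for m
  have "openin (shift_space X) (U m)" for m
    unfolding openin_shift_space_iff U_def using agree_trans by blast
  moreover have "X \<subseteq> \<Union>(range U)" using ex unfolding U_def by blast
  moreover have "compactin (shift_space X) X"
    using compact_space_shift_space by (simp add: compact_space_def)
  ultimately obtain \<F> where F: "finite \<F>" "\<F> \<subseteq> range U" "X \<subseteq> \<Union>\<F>"
    using compactinD[of "shift_space X" X "range U"] by blast
  then obtain M where M: "finite M" "\<F> = U ` M" by (meson finite_subset_image)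
  have "Q (Max (insert 0 M)) x" if x: "x \<in> X" for x
  proof -
    obtain m where m: "m \<in> M" "x \<in> U m" using F(3) M(2) x by blast
    then have "Q m x" unfolding U_def by auto
    moreover have "m \<le> Max (insert 0 M)" using m(1) M(1) by simp
    ultimately show ?thesis using mono x by blast
  qed
  then show ?thesis by (rule that)
qed

lemma locally_const_uniform:
  assumes "locally_const X g"
  obtains n where "\<And>x y. x \<in> X \<Longrightarrow> y \<in> X \<Longrightarrow> agree n x y \<Longrightarrow> g x = g y"
proof -
  obtain n where n: "\<And>x. x \<in> X \<Longrightarrow> \<forall>y\<in>X. agree n x y \<longrightarrow> g y = g x"
  proof (rule compact_uniform[where Q = "\<lambda>n x. \<forall>y\<in>X. agree n x y \<longrightarrow> g y = g x"])
    fix x assume "x \<in> X"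
    then obtain n where n: "\<And>y. y \<in> X \<Longrightarrow> agree n x y \<Longrightarrow> g y = g x"
      using assms unfolding locally_const_def by blast
    then have "\<forall>y\<in>X. agree n x y \<longrightarrow> (\<forall>z\<in>X. agree n y z \<longrightarrow> g z = g y)"
      by (metis agree_trans)
    then show "\<exists>m n. \<forall>y\<in>X. agree n x y \<longrightarrow> (\<forall>z\<in>X. agree m y z \<longrightarrow> g z = g y)" by blast
  qed (use agree_mono in blast)+
  show ?thesis by (rule that[of n]) (use n in metis)
qed

lemma locally_const_bounded:
  fixes g :: "_ \<Rightarrow> int"
  assumes "locally_const X g"
  obtains M :: nat where "\<And>x. x \<in> X \<Longrightarrow> \<bar>g x\<bar> \<le> int M"
proof (rule compact_uniform[where Q = "\<lambda>m x. \<bar>g x\<bar> \<le> int m"])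
  fix x assume "x \<in> X"
  then obtain n where "\<forall>y\<in>X. agree n x y \<longrightarrow> g y = g x"
    using assms unfolding locally_const_def by blast
  then have "\<forall>y\<in>X. agree n x y \<longrightarrow> \<bar>g y\<bar> \<le> int (nat \<bar>g x\<bar>)" by force
  then show "\<exists>m n. \<forall>y\<in>X. agree n x y \<longrightarrow> \<bar>g y\<bar> \<le> int m" by blast
qed (use that in auto)

lemma locally_const_shift:
  assumes "locally_const X g"
  shows "locally_const X (\<lambda>x. g (shift_by k x))"
proof -
  obtain n where n: "\<And>x y. x \<in> X \<Longrightarrow> y \<in> X \<Longrightarrow> agree n x y \<Longrightarrow> g x = g y"
    using locally_const_uniform[OF assms] by blast
  show ?thesis
    by (rule locally_const_window[where n = "n + nat \<bar>k\<bar>"]) (intro n agree_shift; simp)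
qed

text \<open>The points whose orbit never meets the cylinder of z form a subshift. If it were
  nonempty, minimality would make it all of X and it would contain z, which lies in its own
  cylinder. Compactness then bounds the waiting time.\<close>

lemma recurrent:
  assumes "z \<in> X"
  obtains K where "\<And>x. x \<in> X \<Longrightarrow> \<exists>i. \<bar>i\<bar> \<le> int K \<and> agree n z (shift_by i x)"
proof -
  have rec: "\<exists>i. agree n z (shift_by i x)" if x: "x \<in> X" for x
  proof (rule ccontr)
    assume *: "\<nexists>i. agree n z (shift_by i x)"
    define Y where "Y = {y \<in> X. \<forall>i. \<not> agree n z (shift_by i y)}"
    have Xc: "closedin full_shift X"
      using minimal by (simp add: minimal_subshift_def subshift_def)
    have "closedin full_shift Y"
      unfolding closedin_def
    proof
      have "openin full_shift ((UNIV - X) \<union> (\<Union>i. {y. agree n z (shift_by i y)}))"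
      proof (intro openin_Un openin_Union)
        show "openin full_shift (UNIV - X)" using Xc by (simp add: closedin_def)
        fix S assume "S \<in> range (\<lambda>i. {y. agree n z (shift_by i y)})"
        then obtain i where S: "S = {y. agree n z (shift_by i y)}" by blast
        show "openin full_shift S"
          unfolding openin_full_shift_iff S using agree_trans agree_shift by blast
      qed
      moreover have "topspace full_shift - Y = (UNIV - X) \<union> (\<Union>i. {y. agree n z (shift_by i y)})"
        unfolding Y_def by auto
      ultimately show "openin full_shift (topspace full_shift - Y)" by simp
    qed simp
    moreover have inv: "shift_by k y \<in> Y" if "y \<in> Y" for y k
      using that unfolding Y_def by (auto simp: shift_by_shift_by)
    have "shift ` Y = Y"
    proof
      show "shift ` Y \<subseteq> Y" using inv by blast
      show "Y \<subseteq> shift ` Y"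
      proof
        fix y assume "y \<in> Y"
        then have "shift_by (-1) y \<in> Y" "y = shift (shift_by (-1) y)"
          using inv by (auto simp: shift_by_shift_by)
        then show "y \<in> shift ` Y" by blast
      qed
    qed
    ultimately have "subshift Y" by (simp add: subshift_def)
    moreover have "x \<in> Y" using x * by (simp add: Y_def)
    moreover have "Y \<subseteq> X" by (auto simp: Y_def)
    ultimately have "Y = X" using minimal unfolding minimal_subshift_def by blast
    then have "z \<in> Y" using assms by simp
    then show False unfolding Y_def using agree_refl shift_by_0 by (metis (mono_tags, lifting) mem_Collect_eq)
  qed
  show ?thesis
  proof (rule compact_uniform[where Q = "\<lambda>K x. \<exists>i. \<bar>i\<bar> \<le> int K \<and> agree n z (shift_by i x)"])
    fix x assume "x \<in> X"
    then obtain i where i: "agree n z (shift_by i x)" using rec by blast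
    have "\<forall>y\<in>X. agree (n + nat \<bar>i\<bar>) x y \<longrightarrow> \<bar>i\<bar> \<le> int (nat \<bar>i\<bar>) \<and> agree n z (shift_by i y)"
      using agree_trans[OF i agree_shift] by simp
    then show "\<exists>m n'. \<forall>y\<in>X. agree n' x y \<longrightarrow> (\<exists>i. \<bar>i\<bar> \<le> int m \<and> agree n z (shift_by i y))" by blast
  next
    fix m m' :: nat and x assume "m \<le> m'" "\<exists>i. \<bar>i\<bar> \<le> int m \<and> agree n z (shift_by i x)"
    then show "\<exists>i. \<bar>i\<bar> \<le> int m' \<and> agree n z (shift_by i x)" by (meson of_nat_mono order_trans)
  qed (use that in blast)
qed

lemma recurrent_left:
  assumes "z \<in> X" "x \<in> X"
  obtains j where "j \<le> j0" "agree n z (shift_by j x)"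
proof -
  obtain K where K: "\<And>x. x \<in> X \<Longrightarrow> \<exists>i. \<bar>i\<bar> \<le> int K \<and> agree n z (shift_by i x)"
    using recurrent[OF assms(1)] by blast
  \<comment> \<open>The search is centred K places to the left of \<open>j0\<close>, so that the
    visit it finds is not beyond \<open>j0\<close>.\<close>
  obtain i where i: "\<bar>i\<bar> \<le> int K" "agree n z (shift_by i (shift_by (j0 - int K) x))"
    using K[of "shift_by (j0 - int K) x"] assms(2) by auto
  then show ?thesis by (intro that[of "i + (j0 - int K)"]) (auto simp: shift_by_shift_by)
qed

lemma recurrent_right:
  assumes "z \<in> X" "x \<in> X"
  obtains j where "j \<ge> j0" "agree n z (shift_by j x)"
proof -
  obtain K where K: "\<And>x. x \<in> X \<Longrightarrow> \<exists>i. \<bar>i\<bar> \<le> int K \<and> agree n z (shift_by i x)"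
    using recurrent[OF assms(1)] by blast
  obtain i where i: "\<bar>i\<bar> \<le> int K" "agree n z (shift_by i (shift_by (j0 + int K) x))"
    using K[of "shift_by (j0 + int K) x"] assms(2) by auto
  then show ?thesis by (intro that[of "i + (j0 + int K)"]) (auto simp: shift_by_shift_by)
qed

text \<open>A sequence of period p is determined by p consecutive letters, so there are finitely
  many of them.\<close>

lemma not_all_periodic:
  assumes "p > 0" "\<And>z i. z \<in> X \<Longrightarrow> z (i + p) = z i"
  shows False
proof -
  have per: "z (i + int m * p) = z i" if "z \<in> X" for z i m
    using assms(2)[OF that, of "i + int m * p" for m]
    by (induction m) (auto simp: algebra_simps)
  have red: "z i = z (i mod p)" if "z \<in> X" for z i
  proof (cases "i div p \<ge> 0")
    case True
    then show ?thesis using per[OF that, of "i mod p" "nat (i div p)"] by (simp add: mult.commute)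
  next
    case False
    then show ?thesis using per[OF that, of i "nat (- (i div p))"]
      by (simp add: minus_mult_div_eq_mod [symmetric] mult.commute)
  qed
  have "inj_on (\<lambda>z. restrict z {0..<p}) X"
  proof
    fix y z assume yz: "y \<in> X" "z \<in> X" "restrict y {0..<p} = restrict z {0..<p}"
    have "y i = z i" for i
    proof -
      have "i mod p \<in> {0..<p}" using assms(1) by simp
      then have "y (i mod p) = z (i mod p)" using yz(3) by (metis restrict_apply)
      then show ?thesis using red yz by metis
    qed
    then show "y = z" by blast
  qed
  moreover have "(\<lambda>z. restrict z {0..<p}) ` X \<subseteq> {0..<p} \<rightarrow>\<^sub>E UNIV" by auto
  moreover have "finite ({0..<p} \<rightarrow>\<^sub>E (UNIV :: 'a set))" by (intro finite_PiE) auto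
  ultimately show False using infinite_X by (meson finite_imageD finite_subset)
qed

text \<open>Every word of X occurs arbitrarily far to the right in x, hence an eventual period of x
  is a period of every point of X.\<close>

lemma not_right_periodic:
  assumes "x \<in> X" "p > 0" "\<And>i. i \<ge> i0 \<Longrightarrow> x (i + p) = x i"
  shows False
proof (rule not_all_periodic[OF assms(2)])
  fix z i assume "z \<in> X"
  then obtain j where j: "j \<ge> i0 + \<bar>i\<bar> + p" "agree (nat \<bar>i\<bar> + nat p) z (shift_by j x)"
    using recurrent_right assms(1) by blast
  have "z (i + p) = x (i + j + p)" using agreeD[OF j(2), of "i + p"] assms(2)
    by (simp add: shift_by_apply ac_simps)
  also have "\<dots> = x (i + j)" using assms(2,3) j(1) by simp
  also have "\<dots> = z i" using agreeD[OF j(2), of i] by (simp add: shift_by_apply)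
  finally show "z (i + p) = z i" .
qed

lemma not_left_periodic:
  assumes "x \<in> X" "p > 0" "\<And>i. i \<le> i0 \<Longrightarrow> x (i + p) = x i"
  shows False
proof (rule not_all_periodic[OF assms(2)])
  fix z i assume "z \<in> X"
  then obtain j where j: "j \<le> i0 - \<bar>i\<bar> - p" "agree (nat \<bar>i\<bar> + nat p) z (shift_by j x)"
    using recurrent_left assms(1) by blast
  have "z (i + p) = x (i + j + p)" using agreeD[OF j(2), of "i + p"] assms(2)
    by (simp add: shift_by_apply ac_simps)
  also have "\<dots> = x (i + j)" using assms(2,3) j(1) by simp
  also have "\<dots> = z i" using agreeD[OF j(2), of i] by (simp add: shift_by_apply)
  finally show "z (i + p) = z i" .
qed

text \<open>The shift acts freely, so the integer relating two representatives of a point of the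
  suspension is unique. This is what determines the integers attached to lifts below.\<close>

lemma aperiodic:
  assumes "x \<in> X" "shift_by n x = shift_by m x"
  shows "n = m"
proof (rule ccontr)
  assume "n \<noteq> m"
  have eq: "x (i + n) = x (i + m)" for i using assms(2) by (metis shift_by_apply)
  have "x (i + \<bar>n - m\<bar>) = x i" for i
    using eq[of "i - m"] eq[of "i - n"] by (cases "n \<ge> m") (simp_all add: algebra_simps)
  then show False using not_left_periodic[OF assms(1), of "\<bar>n - m\<bar>"] \<open>n \<noteq> m\<close> by auto
qed

section \<open>Points of the suspension\<close>

abbreviation cls :: "(int \<Rightarrow> 'a) \<Rightarrow> real \<Rightarrow> ((int \<Rightarrow> 'a) \<times> real) set" where
  "cls x t \<equiv> susp_rel X `` {(x, t)}"

lemma cls_mem [simp]: "x \<in> X \<Longrightarrow> cls x t \<in> suspension X"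
  by (auto simp: suspension_def intro: quotientI)

lemma suspensionE:
  assumes "c \<in> suspension X"
  obtains x t where "x \<in> X" "c = cls x t"
  using assms by (auto simp: suspension_def elim!: quotientE)

lemma cls_eq_iff:
  assumes "x \<in> X" "y \<in> X"
  shows "cls x t = cls y s \<longleftrightarrow> (\<exists>n. y = shift_by n x \<and> s = t - real_of_int n)"
proof -
  have "cls x t = cls y s \<longleftrightarrow> ((x, t), (y, s)) \<in> susp_rel X"
    using eq_equiv_class_iff[OF equiv_susp_rel[of X], of "(x,t)" "(y,s)"] assms by simp
  then show ?thesis using assms by (auto simp: susp_rel_def)
qed

lemma cls_shift: "x \<in> X \<Longrightarrow> cls (shift_by n x) t = cls x (t + real_of_int n)"
  by (subst eq_commute) (auto simp: cls_eq_iff)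

lemma openin_susp_iff:
  "openin (susp_space X) U \<longleftrightarrow> U \<subseteq> suspension X \<and> (\<forall>x\<in>X. \<forall>t. cls x t \<in> U \<longrightarrow>
     (\<exists>n e. e > 0 \<and> (\<forall>y\<in>X. \<forall>s. agree n x y \<and> \<bar>s - t\<bar> < e \<longrightarrow> cls y s \<in> U)))"
proof -
  let ?W = "{p \<in> X \<times> UNIV. susp_rel X `` {p} \<in> U}"
  have mem: "(x, t) \<in> ?W \<longleftrightarrow> x \<in> X \<and> cls x t \<in> U" for x t by simp
  have "?W \<subseteq> X \<times> UNIV" by blast
  then show ?thesis
    unfolding openin_susp_space openin_prod_shift_space_iff mem by simp metis
qed

end

section \<open>The group of leaf-preserving homeomorphisms\<close>

lemma strict_mono_surj_continuous:
  fixes h :: "real \<Rightarrow> real"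
  assumes "strict_mono h" "range h = UNIV"
  shows "continuous_on UNIV h"
  using assms by (intro continuous_onI_mono) (auto simp: strict_mono_less_eq)

context minimal_infinite_subshift
begin

lemma flow_cls: "flow s (cls x t) = cls x (t + s)"
  by (rule flow_class)

lemma flow_mem [simp]: "c \<in> suspension X \<Longrightarrow> flow s c \<in> suspension X"
  by (auto elim!: suspensionE simp: flow_cls)

lemma flow_0 [simp]: "c \<in> suspension X \<Longrightarrow> flow 0 c = c"
  by (auto elim!: suspensionE simp: flow_cls)

text \<open>From a surjective h on the line through c one reads off that the leaf of c goes onto the
  leaf of \<open>f c\<close>; its continuity comes from \<open>strict_mono_surj_continuous\<close>.
  Membership thus becomes a condition on points instead of leaves.\<close>

lemma homeo_plus_iff:
  "f \<in> homeo_plus X \<longleftrightarrow> f \<in> extensional (suspension X) \<and> homeomorphic_map (susp_space X) (susp_space X) f \<and>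
     (\<forall>c\<in>suspension X. \<exists>h. strict_mono h \<and> range h = UNIV \<and> (\<forall>s. f (flow s c) = flow (h s) (f c)))"
  (is "_ \<longleftrightarrow> ?e \<and> ?h \<and> ?flow")
proof
  assume f: "f \<in> homeo_plus X"
  have ?flow
  proof
    fix c assume c: "c \<in> suspension X"
    then have "range (\<lambda>s. flow s c) \<in> leaves X" by (simp add: leaves_def)
    moreover have "c \<in> range (\<lambda>s. flow s c)" using flow_0[OF c] by (metis rangeI)
    ultimately show "\<exists>h. strict_mono h \<and> range h = UNIV \<and> (\<forall>s. f (flow s c) = flow (h s) (f c))"
      using f unfolding homeo_plus_def mem_Collect_eq by meson
  qed
  then show "?e \<and> ?h \<and> ?flow" using f unfolding homeo_plus_def by blast
next
  assume f: "?e \<and> ?h \<and> ?flow"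
  have maps: "f c \<in> suspension X" if "c \<in> suspension X" for c
    using f that homeomorphic_imp_surjective_map[of "susp_space X" "susp_space X" f] by auto
  have "f ` L \<in> leaves X \<and> (\<forall>c\<in>L. \<exists>h. strict_mono h \<and> continuous_on UNIV h \<and> range h = UNIV \<and>
      (\<forall>s. f (flow s c) = flow (h s) (f c)))" if L: "L \<in> leaves X" for L
  proof
    obtain c where c: "c \<in> suspension X" "L = range (\<lambda>s. flow s c)"
      using L by (auto simp: leaves_def)
    then obtain h where h: "range h = UNIV" "\<And>s. f (flow s c) = flow (h s) (f c)"
      using f by blast
    have "f ` L = (\<lambda>s. flow s (f c)) ` range h"
      unfolding c(2) image_image h(2) ..
    then show "f ` L \<in> leaves X"
      using maps[OF c(1)] h(1) by (auto simp: leaves_def)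
    have "d \<in> suspension X" if "d \<in> L" for d using that c by auto
    then show "\<forall>c\<in>L. \<exists>h. strict_mono h \<and> continuous_on UNIV h \<and> range h = UNIV \<and>
      (\<forall>s. f (flow s c) = flow (h s) (f c))"
      using f strict_mono_surj_continuous by metis
  qed
  then show "f \<in> homeo_plus X" using f unfolding homeo_plus_def by blast
qed

lemma homeo_plus_flowE:
  assumes "f \<in> homeo_plus X" "c \<in> suspension X"
  obtains h where "strict_mono h" "range h = UNIV" "\<And>s. f (flow s c) = flow (h s) (f c)"
proof -
  have "\<exists>h. strict_mono h \<and> range h = UNIV \<and> (\<forall>s. f (flow s c) = flow (h s) (f c))"
    using assms by (simp add: homeo_plus_iff)
  then show ?thesis using that by blast
qed

lemma homeo_plus_continuous: "f \<in> homeo_plus X \<Longrightarrow> continuous_map (susp_space X) (susp_space X) f"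
  by (simp add: homeo_plus_iff homeomorphic_imp_continuous_map)

lemma homeo_plus_Bij: "f \<in> homeo_plus X \<Longrightarrow> f \<in> Bij (suspension X)"
  using homeomorphic_imp_surjective_map[of "susp_space X" "susp_space X" f]
    homeomorphic_imp_injective_map[of "susp_space X" "susp_space X" f]
  by (auto simp: homeo_plus_iff Bij_def bij_betw_def)

lemma homeo_plus_maps: "f \<in> homeo_plus X \<Longrightarrow> c \<in> suspension X \<Longrightarrow> f c \<in> suspension X"
  using homeo_plus_Bij Bij_imp_funcset by blast

lemma homeo_plus_inj: "f \<in> homeo_plus X \<Longrightarrow> c \<in> suspension X \<Longrightarrow> d \<in> suspension X \<Longrightarrow> f c = f d \<Longrightarrow> c = d"
  using homeo_plus_Bij[of f] by (auto simp: Bij_def bij_betw_def dest: inj_onD)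

lemma homeo_plus_id: "(\<lambda>c\<in>suspension X. c) \<in> homeo_plus X"
  unfolding homeo_plus_iff
proof (intro conjI ballI)
  show "homeomorphic_map (susp_space X) (susp_space X) (\<lambda>c\<in>suspension X. c)"
    by (rule homeomorphic_map_eq[where f = id]) auto
  fix c assume "c \<in> suspension X"
  then show "\<exists>h. strict_mono h \<and> range h = UNIV \<and>
      (\<forall>s. (\<lambda>c\<in>suspension X. c) (flow s c) = flow (h s) ((\<lambda>c\<in>suspension X. c) c))"
    by (intro exI[of _ "\<lambda>s. s"]) (auto simp: strict_mono_def)
qed auto

lemma homeo_plus_compose:
  assumes f: "f \<in> homeo_plus X" and g: "g \<in> homeo_plus X"
  shows "compose (suspension X) f g \<in> homeo_plus X"
  unfolding homeo_plus_iff
proof (intro conjI ballI)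
  show "homeomorphic_map (susp_space X) (susp_space X) (compose (suspension X) f g)"
    by (rule homeomorphic_map_eq[OF homeomorphic_map_compose[of _ _ g _ f]])
      (use f g in \<open>auto simp: homeo_plus_iff compose_def\<close>)
  fix c assume c: "c \<in> suspension X"
  obtain h where h: "strict_mono h" "range h = UNIV" "\<And>s. g (flow s c) = flow (h s) (g c)"
    using homeo_plus_flowE[OF g c] by blast
  obtain k where k: "strict_mono k" "range k = UNIV" "\<And>s. f (flow s (g c)) = flow (k s) (f (g c))"
    using homeo_plus_flowE[OF f homeo_plus_maps[OF g c]] by blast
  have "strict_mono (\<lambda>s. k (h s))" using h(1) k(1) by (simp add: strict_mono_def)
  moreover have "range (\<lambda>s. k (h s)) = UNIV" using h(2) k(2) by (metis image_image)
  ultimately show "\<exists>h. strict_mono h \<and> range h = UNIV \<and>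
      (\<forall>s. compose (suspension X) f g (flow s c) = flow (h s) (compose (suspension X) f g c))"
    using c h(3) k(3) by (intro exI[of _ "\<lambda>s. k (h s)"]) (simp add: compose_eq)
qed auto

lemma homeo_plus_inverse:
  assumes f: "f \<in> homeo_plus X"
  shows "restrict (inv_into (suspension X) f) (suspension X) \<in> homeo_plus X"
  unfolding homeo_plus_iff
proof (intro conjI ballI)
  let ?g = "restrict (inv_into (suspension X) f) (suspension X)"
  have bij: "bij_betw f (suspension X) (suspension X)"
    using homeo_plus_Bij[OF f] by (simp add: Bij_def)
  have left: "?g (f c) = c" if "c \<in> suspension X" for c
    using that homeo_plus_maps[OF f that] bij by (simp add: bij_betw_inv_into_left)
  have right: "f (?g c) = c" "?g c \<in> suspension X" if "c \<in> suspension X" for c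
    using that bij bij_betwE[OF bij_betw_inv_into[OF bij]] by (simp_all add: bij_betw_inv_into_right)
  obtain g where g: "homeomorphic_maps (susp_space X) (susp_space X) f g"
    using f by (auto simp: homeo_plus_iff homeomorphic_map_maps)
  then have "g c = ?g c" if "c \<in> suspension X" for c
    using right[OF that] that unfolding homeomorphic_maps_def by (metis topspace_susp_space)
  moreover have "homeomorphic_map (susp_space X) (susp_space X) g"
    using homeomorphic_maps_sym[THEN iffD1, OF g] unfolding homeomorphic_map_maps by blast
  ultimately show "homeomorphic_map (susp_space X) (susp_space X) ?g"
    using homeomorphic_map_eq[of "susp_space X" "susp_space X" g ?g] by simp
  fix d assume d: "d \<in> suspension X"
  define c where "c = ?g d"
  have c: "c \<in> suspension X" "d = f c" using right[OF d] by (simp_all add: c_def)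
  obtain h where h: "strict_mono h" "range h = UNIV" "\<And>s. f (flow s c) = flow (h s) (f c)"
    using homeo_plus_flowE[OF f c(1)] by blast
  have inj: "inj h" using h(1) by (simp add: strict_mono_imp_inj_on)
  have hi: "h (inv_into UNIV h s) = s" for s using h(2) by (simp add: f_inv_into_f)
  have "?g (flow s d) = flow (inv_into UNIV h s) (?g d)" for s
  proof -
    have "f (flow (inv_into UNIV h s) c) = flow s d" using h(3) hi c(2) by simp
    then show ?thesis using left[of "flow (inv_into UNIV h s) c"] c(1) by (simp add: c_def)
  qed
  moreover have "strict_mono (inv_into UNIV h)"
    unfolding strict_mono_def by (metis h(1) hi strict_mono_less)
  moreover have "range (inv_into UNIV h) = UNIV" using inj by (rule inj_imp_surj_inv)
  ultimately show "\<exists>h. strict_mono h \<and> range h = UNIV \<and> (\<forall>s. ?g (flow s d) = flow (h s) (?g d))" by blast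
qed auto

lemma carrier_homeo_plus_group [simp]: "carrier (homeo_plus_group X) = homeo_plus X"
  by (simp add: homeo_plus_group_def)

lemma mult_homeo_plus_group:
  "f \<in> homeo_plus X \<Longrightarrow> g \<in> homeo_plus X \<Longrightarrow> f \<otimes>\<^bsub>homeo_plus_group X\<^esub> g = compose (suspension X) f g"
  by (simp add: homeo_plus_group_def BijGroup_def homeo_plus_Bij)

lemma one_homeo_plus_group: "\<one>\<^bsub>homeo_plus_group X\<^esub> = (\<lambda>c\<in>suspension X. c)"
  by (simp add: homeo_plus_group_def BijGroup_def)

lemma subgroup_homeo_plus: "subgroup (homeo_plus X) (BijGroup (suspension X))"
proof (rule group.subgroupI[OF group_BijGroup])
  show "homeo_plus X \<subseteq> carrier (BijGroup (suspension X))"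
    using homeo_plus_Bij by (auto simp: BijGroup_def)
  show "homeo_plus X \<noteq> {}" using homeo_plus_id by blast
  show "inv\<^bsub>BijGroup (suspension X)\<^esub> f \<in> homeo_plus X" if "f \<in> homeo_plus X" for f
    using homeo_plus_inverse[OF that] inv_BijGroup[OF homeo_plus_Bij[OF that]] by simp
  show "f \<otimes>\<^bsub>BijGroup (suspension X)\<^esub> g \<in> homeo_plus X" if "f \<in> homeo_plus X" "g \<in> homeo_plus X" for f g
    using homeo_plus_compose[OF that] that by (simp add: BijGroup_def homeo_plus_Bij)
qed

lemma group_homeo_plus_group: "group (homeo_plus_group X)"
  unfolding homeo_plus_group_def
  by (rule group.subgroup_imp_group[OF group_BijGroup subgroup_homeo_plus])

section \<open>The uniform topology and its identity component\<close>

lemma openin_homeo_plus_spaceE: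
  assumes "openin (homeo_plus_space X) W" "f \<in> W"
  obtains V where "openin (prod_topology (susp_space X) (susp_space X)) V"
    "\<And>c. c \<in> suspension X \<Longrightarrow> (c, c) \<in> V"
    "\<And>g. g \<in> homeo_plus X \<Longrightarrow> (\<And>c. c \<in> suspension X \<Longrightarrow> (f c, g c) \<in> V) \<Longrightarrow> g \<in> W"
proof -
  obtain V where V: "openin (prod_topology (susp_space X) (susp_space X)) V"
      "\<forall>c\<in>suspension X. (c, c) \<in> V" "{g \<in> homeo_plus X. \<forall>c\<in>suspension X. (f c, g c) \<in> V} \<subseteq> W"
    using bspec[OF conjunct2[OF assms(1)[unfolded openin_homeo_plus_space]] assms(2)] by (elim exE conjE)
  show ?thesis by (rule that[OF V(1)]) (use V(2,3) in auto)
qed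

text \<open>An entourage for the composites is pulled back along f in both coordinates.\<close>

lemma continuous_map_compose_left:
  assumes f: "f \<in> homeo_plus X"
  shows "continuous_map (homeo_plus_space X) (homeo_plus_space X) (\<lambda>g. compose (suspension X) f g)"
  unfolding continuous_map_def
proof (intro conjI allI impI)
  show "(\<lambda>g. compose (suspension X) f g) \<in> topspace (homeo_plus_space X) \<rightarrow> topspace (homeo_plus_space X)"
    using homeo_plus_compose[OF f] by simp
  fix W assume W: "openin (homeo_plus_space X) W"
  show "openin (homeo_plus_space X) {g \<in> topspace (homeo_plus_space X). compose (suspension X) f g \<in> W}"
    unfolding openin_homeo_plus_space topspace_homeo_plus_space
  proof (intro conjI ballI)
    fix g assume "g \<in> {g \<in> homeo_plus X. compose (suspension X) f g \<in> W}"
    then have g: "g \<in> homeo_plus X" "compose (suspension X) f g \<in> W" by auto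
    obtain V where V: "openin (prod_topology (susp_space X) (susp_space X)) V"
        "\<And>c. c \<in> suspension X \<Longrightarrow> (c, c) \<in> V"
        "\<And>k. k \<in> homeo_plus X \<Longrightarrow> (\<And>c. c \<in> suspension X \<Longrightarrow> (compose (suspension X) f g c, k c) \<in> V) \<Longrightarrow> k \<in> W"
      using openin_homeo_plus_spaceE[OF W g(2)] by blast
    let ?V = "{p \<in> topspace (prod_topology (susp_space X) (susp_space X)). (\<lambda>(c, d). (f c, f d)) p \<in> V}"
    have "continuous_map (prod_topology (susp_space X) (susp_space X))
        (prod_topology (susp_space X) (susp_space X)) (\<lambda>(c, d). (f c, f d))"
      using homeo_plus_continuous[OF f] by (simp add: continuous_map_prod_top)
    then have "openin (prod_topology (susp_space X) (susp_space X)) ?V"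
      using V(1) by (rule openin_continuous_map_preimage)
    moreover have "\<forall>c\<in>suspension X. (c, c) \<in> ?V" using V(2) homeo_plus_maps[OF f] by auto
    moreover have "{k \<in> homeo_plus X. \<forall>c\<in>suspension X. (g c, k c) \<in> ?V}
        \<subseteq> {g \<in> homeo_plus X. compose (suspension X) f g \<in> W}"
    proof
      fix k assume k: "k \<in> {k \<in> homeo_plus X. \<forall>c\<in>suspension X. (g c, k c) \<in> ?V}"
      then have "compose (suspension X) f k \<in> W"
        using homeo_plus_compose[OF f] by (intro V(3)) (auto simp: compose_eq)
      then show "k \<in> {g \<in> homeo_plus X. compose (suspension X) f g \<in> W}" using k by simp
    qed
    ultimately show "\<exists>V. openin (prod_topology (susp_space X) (susp_space X)) V \<and>
        (\<forall>c\<in>suspension X. (c, c) \<in> V) \<and>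
        {k \<in> homeo_plus X. \<forall>c\<in>suspension X. (g c, k c) \<in> V}
          \<subseteq> {g \<in> homeo_plus X. compose (suspension X) f g \<in> W}"
      by blast
  qed blast
qed

text \<open>Precomposition only renames the points at which two maps are compared, so the same
  entourage serves on both sides.\<close>

lemma continuous_map_compose_right:
  assumes f: "f \<in> homeo_plus X"
  shows "continuous_map (homeo_plus_space X) (homeo_plus_space X) (\<lambda>g. compose (suspension X) g f)"
  unfolding continuous_map_def
proof (intro conjI allI impI)
  show "(\<lambda>g. compose (suspension X) g f) \<in> topspace (homeo_plus_space X) \<rightarrow> topspace (homeo_plus_space X)"
    using homeo_plus_compose[OF _ f] by simp
  fix W assume W: "openin (homeo_plus_space X) W"
  show "openin (homeo_plus_space X) {g \<in> topspace (homeo_plus_space X). compose (suspension X) g f \<in> W}"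
    unfolding openin_homeo_plus_space topspace_homeo_plus_space
  proof (intro conjI ballI)
    fix g assume "g \<in> {g \<in> homeo_plus X. compose (suspension X) g f \<in> W}"
    then have g: "g \<in> homeo_plus X" "compose (suspension X) g f \<in> W" by auto
    obtain V where V: "openin (prod_topology (susp_space X) (susp_space X)) V"
        "\<And>c. c \<in> suspension X \<Longrightarrow> (c, c) \<in> V"
        "\<And>k. k \<in> homeo_plus X \<Longrightarrow> (\<And>c. c \<in> suspension X \<Longrightarrow> (compose (suspension X) g f c, k c) \<in> V) \<Longrightarrow> k \<in> W"
      using openin_homeo_plus_spaceE[OF W g(2)] by blast
    have "{k \<in> homeo_plus X. \<forall>c\<in>suspension X. (g c, k c) \<in> V}
        \<subseteq> {g \<in> homeo_plus X. compose (suspension X) g f \<in> W}"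
    proof
      fix k assume k: "k \<in> {k \<in> homeo_plus X. \<forall>c\<in>suspension X. (g c, k c) \<in> V}"
      then have "compose (suspension X) k f \<in> W"
        using homeo_plus_compose[OF _ f] homeo_plus_maps[OF f] by (intro V(3)) (auto simp: compose_eq)
      then show "k \<in> {g \<in> homeo_plus X. compose (suspension X) g f \<in> W}" using k by simp
    qed
    then show "\<exists>V. openin (prod_topology (susp_space X) (susp_space X)) V \<and>
        (\<forall>c\<in>suspension X. (c, c) \<in> V) \<and>
        {k \<in> homeo_plus X. \<forall>c\<in>suspension X. (g c, k c) \<in> V}
          \<subseteq> {g \<in> homeo_plus X. compose (suspension X) g f \<in> W}"
      using V(1,2) by blast
  qed blast
qed

text \<open>Continuity of left and right translations suffices: translating a path from the identity
  to f by the inverse of f joins that inverse to the identity, and conjugation is a composite of two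
  translations.\<close>

lemma normal_homeo_plus_0: "homeo_plus_0 X \<lhd> homeo_plus_group X"
proof -
  interpret G: group "homeo_plus_group X" by (rule group_homeo_plus_group)
  let ?P = "path_component_of (homeo_plus_space X)"
  let ?one = "\<one>\<^bsub>homeo_plus_group X\<^esub>"
  have in0: "f \<in> homeo_plus_0 X \<longleftrightarrow> ?P ?one f" for f by (simp add: homeo_plus_0_def)
  have sub: "f \<in> homeo_plus X" if "f \<in> homeo_plus_0 X" for f
    using that path_component_in_topspace unfolding in0 by fastforce
  have left: "?P (f \<otimes>\<^bsub>homeo_plus_group X\<^esub> g) (f \<otimes>\<^bsub>homeo_plus_group X\<^esub> k)"
    if "f \<in> homeo_plus X" "?P g k" for f g k
    using path_component_of_continuous_image[OF continuous_map_compose_left[OF that(1)] that(2)]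
      path_component_in_topspace[OF that(2)] that(1) by (simp add: mult_homeo_plus_group)
  have right: "?P (g \<otimes>\<^bsub>homeo_plus_group X\<^esub> f) (k \<otimes>\<^bsub>homeo_plus_group X\<^esub> f)"
    if "f \<in> homeo_plus X" "?P g k" for f g k
    using path_component_of_continuous_image[OF continuous_map_compose_right[OF that(1)] that(2)]
      path_component_in_topspace[OF that(2)] that(1) by (simp add: mult_homeo_plus_group)
  have one: "?one \<in> homeo_plus_0 X"
    unfolding in0 path_component_of_refl using G.one_closed by simp
  show ?thesis
    unfolding G.normal_inv_iff
  proof (intro conjI ballI G.subgroupI)
    show "homeo_plus_0 X \<noteq> {}" using one by blast
    show "homeo_plus_0 X \<subseteq> carrier (homeo_plus_group X)" using sub by auto
  next
    fix f assume f: "f \<in> homeo_plus_0 X"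
    have "?P (inv\<^bsub>homeo_plus_group X\<^esub> f \<otimes>\<^bsub>homeo_plus_group X\<^esub> ?one)
        (inv\<^bsub>homeo_plus_group X\<^esub> f \<otimes>\<^bsub>homeo_plus_group X\<^esub> f)"
      using left[of "inv\<^bsub>homeo_plus_group X\<^esub> f" ?one f] G.inv_closed[of f] f sub[OF f] unfolding in0 by simp
    from path_component_of_sym[OF this] show "inv\<^bsub>homeo_plus_group X\<^esub> f \<in> homeo_plus_0 X"
      unfolding in0 using sub[OF f] G.inv_closed[of f] by (simp del: G.inv_closed)
  next
    fix f g assume f: "f \<in> homeo_plus_0 X" and g: "g \<in> homeo_plus_0 X"
    have "?P (f \<otimes>\<^bsub>homeo_plus_group X\<^esub> ?one) (f \<otimes>\<^bsub>homeo_plus_group X\<^esub> g)"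
      using left[of f ?one g] g sub[OF f] unfolding in0 by simp
    then show "f \<otimes>\<^bsub>homeo_plus_group X\<^esub> g \<in> homeo_plus_0 X"
      using f sub[OF f] unfolding in0 by (auto intro: path_component_of_trans)
  next
    fix f g assume f: "f \<in> carrier (homeo_plus_group X)" and g: "g \<in> homeo_plus_0 X"
    then have *: "f \<in> homeo_plus X" "inv\<^bsub>homeo_plus_group X\<^esub> f \<in> homeo_plus X"
      using G.inv_closed[of f] by auto
    have "?P (f \<otimes>\<^bsub>homeo_plus_group X\<^esub> ?one) (f \<otimes>\<^bsub>homeo_plus_group X\<^esub> g)"
      using left[of f ?one g] g * unfolding in0 by simp
    from right[OF *(2) this]
    show "f \<otimes>\<^bsub>homeo_plus_group X\<^esub> g \<otimes>\<^bsub>homeo_plus_group X\<^esub> inv\<^bsub>homeo_plus_group X\<^esub> f \<in> homeo_plus_0 X"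
      unfolding in0 using f by simp
  qed
qed

section \<open>Isotopies along the flow\<close>

definition jointly_continuous :: "((int \<Rightarrow> 'a) \<Rightarrow> real \<Rightarrow> real) \<Rightarrow> bool" where
  "jointly_continuous \<sigma> \<longleftrightarrow> (\<forall>x\<in>X. \<forall>t. \<forall>e>0. \<exists>n. \<exists>d>0. \<forall>y\<in>X. \<forall>s.
     agree n x y \<and> \<bar>s - t\<bar> < d \<longrightarrow> \<bar>\<sigma> y s - \<sigma> x t\<bar> < e)"

lemma jointly_continuousD:
  assumes "jointly_continuous \<sigma>" "x \<in> X" "e > 0"
  shows "\<exists>n d. d > 0 \<and> (\<forall>y\<in>X. \<forall>s. agree n x y \<and> \<bar>s - t\<bar> < d \<longrightarrow> \<bar>\<sigma> y s - \<sigma> x t\<bar> < e)"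
  using assms unfolding jointly_continuous_def by blast

text \<open>The last clause says that (x, t) \<mapsto> (x, \<sigma> x t) is compatible with the
  identification of (x, t) and (T x, t - 1), so that it descends to a map of the suspension that
  moves each point along its own leaf.\<close>

definition time_change :: "((int \<Rightarrow> 'a) \<Rightarrow> real \<Rightarrow> real) \<Rightarrow> bool" where
  "time_change \<sigma> \<longleftrightarrow> jointly_continuous \<sigma> \<and> (\<forall>x\<in>X. strict_mono (\<sigma> x) \<and> range (\<sigma> x) = UNIV) \<and>
     (\<forall>x\<in>X. \<forall>t. \<sigma> (shift x) (t - 1) = \<sigma> x t - 1)"

text \<open>The representative is chosen arbitrarily; \<open>time_change_equivariant\<close> makes
  the result independent of it.\<close>

definition time_change_map :: "((int \<Rightarrow> 'a) \<Rightarrow> real \<Rightarrow> real) \<Rightarrow>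
    ((int \<Rightarrow> 'a) \<times> real) set \<Rightarrow> ((int \<Rightarrow> 'a) \<times> real) set" where
  "time_change_map \<sigma> = (\<lambda>c\<in>suspension X.
     let p = SOME p. fst p \<in> X \<and> c = cls (fst p) (snd p) in cls (fst p) (\<sigma> (fst p) (snd p)))"

lemma time_change_equivariant:
  assumes "time_change \<sigma>" "x \<in> X"
  shows "\<sigma> (shift_by n x) (t - real_of_int n) = \<sigma> x t - real_of_int n"
proof -
  have eq: "\<sigma> (shift_by (i + 1) x) (t - real_of_int (i + 1)) = \<sigma> (shift_by i x) (t - real_of_int i) - 1" for i
  proof -
    have "\<sigma> (shift (shift_by i x)) (t - real_of_int i - 1) = \<sigma> (shift_by i x) (t - real_of_int i) - 1"
      using assms unfolding time_change_def by simp
    moreover have "shift (shift_by i x) = shift_by (i + 1) x" by (simp add: shift_by_shift_by add.commute)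
    moreover have "t - real_of_int i - 1 = t - real_of_int (i + 1)" by simp
    ultimately show ?thesis by metis
  qed
  show ?thesis
  proof (induction n rule: int_induct[where k = 0])
    case (step1 i)
    then show ?case using eq[of i] by simp
  next
    case (step2 i)
    then show ?case using eq[of "i - 1"] by simp
  qed simp
qed

lemma time_change_map_cls:
  assumes "time_change \<sigma>" "x \<in> X"
  shows "time_change_map \<sigma> (cls x t) = cls x (\<sigma> x t)"
proof -
  define p where "p = (SOME p. fst p \<in> X \<and> cls x t = cls (fst p) (snd p))"
  have p: "fst p \<in> X" "cls x t = cls (fst p) (snd p)"
    using someI[of "\<lambda>p. fst p \<in> X \<and> cls x t = cls (fst p) (snd p)" "(x, t)"] assms(2)
    by (simp_all add: p_def)
  then obtain n where n: "fst p = shift_by n x" "snd p = t - real_of_int n"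
    using cls_eq_iff[OF assms(2) p(1)] by blast
  have "time_change_map \<sigma> (cls x t) = cls (fst p) (\<sigma> (fst p) (snd p))"
    using assms(2) by (simp add: time_change_map_def p_def Let_def)
  also have "\<dots> = cls x (\<sigma> x t)"
    unfolding n time_change_equivariant[OF assms] using assms(2) by (simp add: cls_shift)
  finally show ?thesis .
qed

lemma continuous_map_suspI:
  assumes y: "\<And>x. x \<in> X \<Longrightarrow> y x \<in> X"
    and yc: "\<And>x m. x \<in> X \<Longrightarrow> \<exists>n. \<forall>x'\<in>X. agree n x x' \<longrightarrow> agree m (y x) (y x')"
    and \<sigma>: "jointly_continuous \<sigma>"
    and f: "\<And>x t. x \<in> X \<Longrightarrow> f (cls x t) = cls (y x) (\<sigma> x t)"
  shows "continuous_map (susp_space X) (susp_space X) f"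
  unfolding continuous_map_def
proof (intro conjI allI impI)
  show "f \<in> topspace (susp_space X) \<rightarrow> topspace (susp_space X)"
    using f y by (auto elim!: suspensionE)
  fix U assume U: "openin (susp_space X) U"
  show "openin (susp_space X) {c \<in> topspace (susp_space X). f c \<in> U}"
    unfolding openin_susp_iff
  proof (intro conjI ballI allI impI)
    fix x t assume x: "x \<in> X" and "cls x t \<in> {c \<in> topspace (susp_space X). f c \<in> U}"
    then have "cls (y x) (\<sigma> x t) \<in> U" using f by simp
    then obtain m e where me: "e > 0"
        "\<And>z r. z \<in> X \<Longrightarrow> agree m (y x) z \<Longrightarrow> \<bar>r - \<sigma> x t\<bar> < e \<Longrightarrow> cls z r \<in> U"
      using U y[OF x] unfolding openin_susp_iff by meson
    obtain n1 where n1: "\<And>x'. x' \<in> X \<Longrightarrow> agree n1 x x' \<Longrightarrow> agree m (y x) (y x')"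
      using yc[OF x] by blast
    obtain n2 d where *: "d > 0"
        "\<forall>x'\<in>X. \<forall>s. agree n2 x x' \<and> \<bar>s - t\<bar> < d \<longrightarrow> \<bar>\<sigma> x' s - \<sigma> x t\<bar> < e"
      using jointly_continuousD[OF \<sigma> x me(1), of t] by blast
    note d = *(1) *(2)[rule_format, OF _ conjI]
    have "cls x' s \<in> {c \<in> topspace (susp_space X). f c \<in> U}"
      if "x' \<in> X" "agree (max n1 n2) x x'" "\<bar>s - t\<bar> < d" for x' s
    proof -
      have "cls (y x') (\<sigma> x' s) \<in> U"
        using that agree_mono[OF that(2)] by (intro me(2) n1 d(2) y) auto
      then show ?thesis using that(1) f by simp
    qed
    then show "\<exists>n e. e > 0 \<and> (\<forall>x'\<in>X. \<forall>s. agree n x x' \<and> \<bar>s - t\<bar> < e \<longrightarrow>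
        cls x' s \<in> {c \<in> topspace (susp_space X). f c \<in> U})"
      using d(1) by blast
  qed auto
qed

text \<open>Joint continuity of the inverse comes from monotonicity: to trap \<tau> y s strictly
  between a and b it is enough that \<sigma> y a < s < \<sigma> y b, and these two inequalities
  persist near (x, t) because \<sigma> is continuous at (x, a) and (x, b).\<close>

lemma time_change_inverse:
  assumes \<sigma>: "time_change \<sigma>"
  obtains \<tau> where "time_change \<tau>" "\<And>x t. x \<in> X \<Longrightarrow> \<tau> x (\<sigma> x t) = t" "\<And>x t. x \<in> X \<Longrightarrow> \<sigma> x (\<tau> x t) = t"
proof -
  define \<tau> where "\<tau> x = inv_into UNIV (\<sigma> x)" for x
  have mono: "strict_mono (\<sigma> x)" and surj: "range (\<sigma> x) = UNIV" if "x \<in> X" for x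
    using \<sigma> that unfolding time_change_def by auto
  have inj: "inj (\<sigma> x)" if "x \<in> X" for x using mono[OF that] by (simp add: strict_mono_imp_inj_on)
  have l: "\<tau> x (\<sigma> x t) = t" if "x \<in> X" for x t using inj[OF that] by (simp add: \<tau>_def)
  have r: "\<sigma> x (\<tau> x t) = t" if "x \<in> X" for x t using surj[OF that] by (simp add: \<tau>_def f_inv_into_f)
  have less: "\<tau> x s < t \<longleftrightarrow> s < \<sigma> x t" "t < \<tau> x s \<longleftrightarrow> \<sigma> x t < s" if "x \<in> X" for x s t
    using mono[OF that] r[OF that] by (metis strict_mono_less)+
  have "time_change \<tau>"
    unfolding time_change_def
  proof (intro conjI ballI allI)
    show "strict_mono (\<tau> x)" "range (\<tau> x) = UNIV" if "x \<in> X" for x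
    proof -
      show "strict_mono (\<tau> x)" unfolding strict_mono_def using less r that by metis
      show "range (\<tau> x) = UNIV" using l[OF that] by (metis surj_def)
    qed
    show "\<tau> (shift x) (t - 1) = \<tau> x t - 1" if x: "x \<in> X" for x t
    proof -
      have "\<sigma> (shift x) (\<tau> x t - 1) = t - 1"
        using \<sigma> r[OF x] x unfolding time_change_def by simp
      then show ?thesis using l[of "shift x" "\<tau> x t - 1"] x by simp
    qed
    show "jointly_continuous \<tau>"
      unfolding jointly_continuous_def
    proof (intro ballI allI impI)
      fix x t and e :: real assume x: "x \<in> X" and e: "e > 0"
      define a b where "a = \<tau> x t - e / 2" and "b = \<tau> x t + e / 2"
      have ab: "\<sigma> x a < t" "t < \<sigma> x b"
        using less(2)[OF x, of a t] less(1)[OF x, of t b] e by (simp_all add: a_def b_def)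
      have jc: "jointly_continuous \<sigma>" using \<sigma> by (simp add: time_change_def)
      have pos: "(t - \<sigma> x a) / 2 > 0" "(\<sigma> x b - t) / 2 > 0" using ab by auto
      obtain n1 d1 where *: "d1 > 0"
          "\<forall>y\<in>X. \<forall>s. agree n1 x y \<and> \<bar>s - a\<bar> < d1 \<longrightarrow> \<bar>\<sigma> y s - \<sigma> x a\<bar> < (t - \<sigma> x a) / 2"
        using jointly_continuousD[OF jc x pos(1), of a] by blast
      note 1 = *(1) *(2)[rule_format, OF _ conjI]
      obtain n2 d2 where *: "d2 > 0"
          "\<forall>y\<in>X. \<forall>s. agree n2 x y \<and> \<bar>s - b\<bar> < d2 \<longrightarrow> \<bar>\<sigma> y s - \<sigma> x b\<bar> < (\<sigma> x b - t) / 2"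
        using jointly_continuousD[OF jc x pos(2), of b] by blast
      note 2 = *(1) *(2)[rule_format, OF _ conjI]
      define d where "d = min ((t - \<sigma> x a) / 2) ((\<sigma> x b - t) / 2)"
      have "\<bar>\<tau> y s - \<tau> x t\<bar> < e" if y: "y \<in> X" "agree (max n1 n2) x y" "\<bar>s - t\<bar> < d" for y s
      proof -
        have "\<bar>\<sigma> y a - \<sigma> x a\<bar> < (t - \<sigma> x a) / 2"
          using 1 y(1) agree_mono[OF y(2)] by (intro 1(2)) auto
        then have "\<sigma> y a - \<sigma> x a < (t - \<sigma> x a) / 2" by linarith
        moreover have "\<bar>\<sigma> y b - \<sigma> x b\<bar> < (\<sigma> x b - t) / 2"
          using 2 y(1) agree_mono[OF y(2)] by (intro 2(2)) auto
        then have "- ((\<sigma> x b - t) / 2) < \<sigma> y b - \<sigma> x b" by linarith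
        moreover have "\<bar>s - t\<bar> < (t - \<sigma> x a) / 2" "\<bar>s - t\<bar> < (\<sigma> x b - t) / 2"
          using y(3) unfolding d_def min_less_iff_conj by simp_all
        then have "- ((t - \<sigma> x a) / 2) < s - t" "s - t < (\<sigma> x b - t) / 2"
          unfolding abs_less_iff by linarith+
        ultimately have "\<sigma> y a < s" "s < \<sigma> y b" by (simp_all add: field_simps)
        then have "a < \<tau> y s" "\<tau> y s < b" using less y(1) by auto
        then show ?thesis using e unfolding a_def b_def by linarith
      qed
      moreover have "d > 0" using ab by (simp add: d_def)
      ultimately show "\<exists>n. \<exists>d>0. \<forall>y\<in>X. \<forall>s. agree n x y \<and> \<bar>s - t\<bar> < d \<longrightarrow> \<bar>\<tau> y s - \<tau> x t\<bar> < e"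
        by blast
    qed
  qed
  then show ?thesis using l r that by blast
qed

lemma continuous_time_change_map:
  assumes "time_change \<sigma>"
  shows "continuous_map (susp_space X) (susp_space X) (time_change_map \<sigma>)"
  by (rule continuous_map_suspI[where y = "\<lambda>x. x" and \<sigma> = \<sigma>])
    (use assms in \<open>auto simp: time_change_map_cls time_change_def\<close>)

lemma time_change_map_homeo_plus:
  assumes \<sigma>: "time_change \<sigma>"
  shows "time_change_map \<sigma> \<in> homeo_plus X"
  unfolding homeo_plus_iff
proof (intro conjI ballI)
  show "time_change_map \<sigma> \<in> extensional (suspension X)" by (simp add: time_change_map_def)
  obtain \<tau> where \<tau>: "time_change \<tau>" "\<And>x t. x \<in> X \<Longrightarrow> \<tau> x (\<sigma> x t) = t" "\<And>x t. x \<in> X \<Longrightarrow> \<sigma> x (\<tau> x t) = t"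
    using time_change_inverse[OF \<sigma>] by blast
  have "homeomorphic_maps (susp_space X) (susp_space X) (time_change_map \<sigma>) (time_change_map \<tau>)"
    unfolding homeomorphic_maps_def
    using continuous_time_change_map[OF \<sigma>] continuous_time_change_map[OF \<tau>(1)] \<tau>
    by (auto elim!: suspensionE simp: time_change_map_cls \<sigma>)
  then show "homeomorphic_map (susp_space X) (susp_space X) (time_change_map \<sigma>)"
    unfolding homeomorphic_map_maps by blast
  fix c assume "c \<in> suspension X"
  then obtain x t where x: "x \<in> X" "c = cls x t" by (rule suspensionE)
  define h where "h s = \<sigma> x (t + s) - \<sigma> x t" for s
  have \<sigma>x: "strict_mono (\<sigma> x)" "range (\<sigma> x) = UNIV" using \<sigma> x(1) unfolding time_change_def by auto
  have "strict_mono h" using \<sigma>x(1) by (simp add: strict_mono_def h_def)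
  moreover have "range h = UNIV"
  proof -
    have "\<exists>s. r = h s" for r
    proof -
      obtain s where "\<sigma> x s = r + \<sigma> x t" using \<sigma>x(2) by (metis surj_def)
      then have "r = h (s - t)" by (simp add: h_def)
      then show ?thesis by blast
    qed
    then show ?thesis by (auto simp: surj_def)
  qed
  moreover have "time_change_map \<sigma> (flow s c) = flow (h s) (time_change_map \<sigma> c)" for s
    using x \<sigma> by (simp add: flow_cls time_change_map_cls h_def)
  ultimately show "\<exists>h. strict_mono h \<and> range h = UNIV \<and>
      (\<forall>s. time_change_map \<sigma> (flow s c) = flow (h s) (time_change_map \<sigma> c))" by blast
qed

text \<open>The version of \<open>compact_uniform\<close> for the suspension: X \<times> R is not
  compact, but every class has a representative with time in [0, 1].\<close>

lemma compact_uniform_strip: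
  fixes Q :: "nat \<Rightarrow> (int \<Rightarrow> 'a) \<Rightarrow> real \<Rightarrow> bool"
  assumes ex: "\<And>x t. x \<in> X \<Longrightarrow> \<exists>m n d. d > 0 \<and> (\<forall>y\<in>X. \<forall>s. agree n x y \<and> \<bar>s - t\<bar> < d \<longrightarrow> Q m y s)"
    and mono: "\<And>m m' x t. x \<in> X \<Longrightarrow> m \<le> m' \<Longrightarrow> Q m x t \<Longrightarrow> Q m' x t"
  obtains m :: nat where "\<And>x t. x \<in> X \<Longrightarrow> 0 \<le> t \<Longrightarrow> t \<le> 1 \<Longrightarrow> Q m x t"
proof -
  let ?T = "prod_topology (shift_space X) euclideanreal"
  define U :: "nat \<Rightarrow> ((int \<Rightarrow> 'a) \<times> real) set" where "U m = {p \<in> X \<times> UNIV. \<exists>n d. d > 0 \<and>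
    (\<forall>y\<in>X. \<forall>s. agree n (fst p) y \<and> \<bar>s - snd p\<bar> < d \<longrightarrow> Q m y s)}" for m
  have "openin ?T (U m)" for m
    unfolding openin_prod_shift_space_iff
  proof (intro conjI allI impI)
    fix x t assume "(x, t) \<in> U m"
    then obtain n d where nd: "d > 0" "\<And>y s. y \<in> X \<Longrightarrow> agree n x y \<Longrightarrow> \<bar>s - t\<bar> < d \<Longrightarrow> Q m y s"
      unfolding U_def by auto
    have "(y, s) \<in> U m" if "y \<in> X" "agree n x y" "\<bar>s - t\<bar> < d / 2" for y s
    proof -
      have "Q m z r" if z: "z \<in> X" "agree n y z" "\<bar>r - s\<bar> < d / 2" for z r
      proof (rule nd(2)[OF z(1)])
        show "agree n x z" using agree_trans \<open>agree n x y\<close> z(2) by blast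
        show "\<bar>r - t\<bar> < d" using z(3) \<open>\<bar>s - t\<bar> < d / 2\<close> by linarith
      qed
      moreover have "d / 2 > 0" using nd(1) by simp
      ultimately show ?thesis unfolding U_def using that(1) by fastforce
    qed
    moreover have "d / 2 > 0" using nd(1) by simp
    ultimately show "\<exists>n e. e > 0 \<and> (\<forall>y\<in>X. \<forall>s. agree n x y \<and> \<bar>s - t\<bar> < e \<longrightarrow> (y, s) \<in> U m)" by blast
  qed (auto simp: U_def)
  moreover have "X \<times> {0..1} \<subseteq> \<Union>(range U)"
    using ex unfolding U_def by fastforce
  moreover have "compactin ?T (X \<times> {0..1})"
    using compact_space_shift_space by (simp add: compactin_Times compact_space_def compact_Icc)
  ultimately obtain \<F> where F: "finite \<F>" "\<F> \<subseteq> range U" "X \<times> {0..1} \<subseteq> \<Union>\<F>"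
    using compactinD[of ?T "X \<times> {0..1}" "range U"] by blast
  then obtain M where M: "finite M" "\<F> = U ` M" by (meson finite_subset_image)
  have "Q (Max (insert 0 M)) x t" if x: "x \<in> X" "0 \<le> t" "t \<le> 1" for x t
  proof -
    have "(x, t) \<in> X \<times> {0..1}" using x by simp
    then have "(x, t) \<in> \<Union>\<F>" using F(3) by (rule rev_subsetD)
    then obtain m where m: "m \<in> M" "(x, t) \<in> U m" using M(2) by blast
    then have "Q m x t" unfolding U_def using x(1) by force
    moreover have "m \<le> Max (insert 0 M)" using m(1) M(1) by simp
    ultimately show ?thesis using mono x by blast
  qed
  then show ?thesis by (rule that)
qed

text \<open>All conditions on a time change are stable under convex combination with the identity;
  only surjectivity takes an argument, by intermediate values.\<close>

lemma time_change_interpolate: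
  assumes \<sigma>: "time_change \<sigma>" and u: "0 \<le> u" "u \<le> 1"
  shows "time_change (\<lambda>x t. (1 - u) * \<sigma> x t + u * t)"
  unfolding time_change_def
proof (intro conjI ballI allI)
  show "jointly_continuous (\<lambda>x t. (1 - u) * \<sigma> x t + u * t)"
    unfolding jointly_continuous_def
  proof (intro ballI allI impI)
    fix x t and e :: real assume x: "x \<in> X" and e: "e > 0"
    have jc: "jointly_continuous \<sigma>" using \<sigma> by (simp add: time_change_def)
    have e2: "e / 2 > 0" using e by simp
    obtain n d where *: "d > 0"
        "\<forall>y\<in>X. \<forall>s. agree n x y \<and> \<bar>s - t\<bar> < d \<longrightarrow> \<bar>\<sigma> y s - \<sigma> x t\<bar> < e / 2"
      using jointly_continuousD[OF jc x e2, of t] by blast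
    note nd = *(1) *(2)[rule_format, OF _ conjI]
    have "\<bar>((1 - u) * \<sigma> y s + u * s) - ((1 - u) * \<sigma> x t + u * t)\<bar> < e"
      if y: "y \<in> X" "agree n x y" "\<bar>s - t\<bar> < min d (e / 2)" for y s
    proof -
      have "((1 - u) * \<sigma> y s + u * s) - ((1 - u) * \<sigma> x t + u * t) = (1 - u) * (\<sigma> y s - \<sigma> x t) + u * (s - t)"
        by (simp add: algebra_simps)
      also have "\<bar>\<dots>\<bar> \<le> (1 - u) * \<bar>\<sigma> y s - \<sigma> x t\<bar> + u * \<bar>s - t\<bar>"
        using u by (intro order_trans[OF abs_triangle_ineq]) (simp add: abs_mult)
      also have "\<dots> \<le> (1 - u) * (e / 2) + u * (e / 2)"
        using nd(2)[of y s] y u by (intro add_mono mult_left_mono) auto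
      also have "\<dots> = e / 2" by (simp add: field_simps)
      also have "\<dots> < e" using e by simp
      finally show ?thesis .
    qed
    moreover have "min d (e / 2) > 0" using nd(1) e by simp
    ultimately show "\<exists>n. \<exists>d>0. \<forall>y\<in>X. \<forall>s. agree n x y \<and> \<bar>s - t\<bar> < d \<longrightarrow>
        \<bar>((1 - u) * \<sigma> y s + u * s) - ((1 - u) * \<sigma> x t + u * t)\<bar> < e"
      by blast
  qed
next
  fix x assume x: "x \<in> X"
  let ?s = "\<lambda>t. (1 - u) * \<sigma> x t + u * t"
  have \<sigma>x: "strict_mono (\<sigma> x)" "range (\<sigma> x) = UNIV" using \<sigma> x unfolding time_change_def by auto
  show "strict_mono ?s"
  proof (rule strict_monoI)
    fix s t :: real assume st: "s < t"
    show "?s s < ?s t"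
    proof (cases "u = 1")
      case False
      have "(1 - u) * \<sigma> x s < (1 - u) * \<sigma> x t"
        using False u st \<sigma>x(1) by (intro mult_strict_left_mono) (auto simp: strict_mono_def)
      moreover have "u * s \<le> u * t" using st u by (intro mult_left_mono) auto
      ultimately show ?thesis by linarith
    qed (use st in simp)
  qed
  have cont: "continuous_on UNIV ?s"
    using strict_mono_surj_continuous[OF \<sigma>x] by (intro continuous_intros) auto
  have "r \<in> range ?s" for r
  proof -
    obtain a where a: "\<sigma> x a = r" using \<sigma>x(2) by (metis surj_def)
    \<comment> \<open>At \<open>min r a\<close> both \<sigma> x and the identity are at most r, at
      \<open>max r a\<close> both are at least r, and so are their convex combinations.\<close>
    have lo: "?s (min r a) \<le> r"
    proof -
      have "\<sigma> x (min r a) \<le> r" using a \<sigma>x(1) by (metis min.cobounded2 strict_mono_less_eq)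
      then have "(1 - u) * \<sigma> x (min r a) + u * min r a \<le> (1 - u) * r + u * r"
        using u by (intro add_mono mult_left_mono) auto
      then show ?thesis by (simp add: algebra_simps)
    qed
    have hi: "r \<le> ?s (max r a)"
    proof -
      have "r \<le> \<sigma> x (max r a)" using a \<sigma>x(1) by (metis max.cobounded2 strict_mono_less_eq)
      then have "(1 - u) * r + u * r \<le> (1 - u) * \<sigma> x (max r a) + u * max r a"
        using u by (intro add_mono mult_left_mono) auto
      then show ?thesis by (simp add: algebra_simps)
    qed
    have "min r a \<le> max r a" by simp
    from IVT'[OF lo hi this continuous_on_subset[OF cont subset_UNIV]] show ?thesis by blast
  qed
  then show "range ?s = UNIV" by blast
next
  fix x t assume "x \<in> X"
  then have eq: "\<sigma> (shift x) (t - 1) = \<sigma> x t - 1" using \<sigma> unfolding time_change_def by blast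
  show "(1 - u) * \<sigma> (shift x) (t - 1) + u * (t - 1) = (1 - u) * \<sigma> x t + u * t - 1"
    unfolding eq by (simp add: algebra_simps)
qed

lemma time_change_map_isotopic:
  assumes \<sigma>: "time_change \<sigma>"
  shows "time_change_map \<sigma> \<in> homeo_plus_0 X"
proof -
  define \<sigma>' where "\<sigma>' u x t = (1 - u) * \<sigma> x t + u * t" for u x t
  define F where "F u = time_change_map (\<sigma>' u)" for u
  have tc: "time_change (\<sigma>' u)" if "0 \<le> u" "u \<le> 1" for u
    unfolding \<sigma>'_def by (rule time_change_interpolate[OF \<sigma> that])
  have hp: "F u \<in> homeo_plus X" if "0 \<le> u" "u \<le> 1" for u
    unfolding F_def by (rule time_change_map_homeo_plus[OF tc[OF that]])
  have Fcls: "F u (cls x t) = cls x (\<sigma>' u x t)" if "0 \<le> u" "u \<le> 1" "x \<in> X" for u x t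
    unfolding F_def by (rule time_change_map_cls[OF tc[OF that(1,2)] that(3)])
  have "pathin (homeo_plus_space X) F"
    unfolding pathin_def continuous_map_def
  proof (intro conjI allI impI)
    show "F \<in> topspace (top_of_set {0..1}) \<rightarrow> topspace (homeo_plus_space X)" using hp by auto
    fix W assume W: "openin (homeo_plus_space X) W"
    have "\<exists>e>0. \<forall>u\<in>{0..1}. \<bar>u - v\<bar> < e \<longrightarrow> F u \<in> W" if v: "v \<in> {0..1}" "F v \<in> W" for v
    proof -
      obtain V where V: "openin (prod_topology (susp_space X) (susp_space X)) V"
          "\<And>c. c \<in> suspension X \<Longrightarrow> (c, c) \<in> V"
          "\<And>g. g \<in> homeo_plus X \<Longrightarrow> (\<And>c. c \<in> suspension X \<Longrightarrow> (F v c, g c) \<in> V) \<Longrightarrow> g \<in> W"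
        using openin_homeo_plus_spaceE[OF W v(2)] by blast
      \<comment> \<open>With this choice a single m valid on the strip says that all parameters
        within 1 / (m + 1) of v give maps close to \<open>F v\<close> uniformly on the
        suspension.\<close>
      define Q where "Q m x t \<longleftrightarrow> (\<forall>u\<in>{0..1}. \<bar>u - v\<bar> < 1 / real (Suc m) \<longrightarrow> (F v (cls x t), F u (cls x t)) \<in> V)" for m x t
      obtain m where m: "\<And>x t. x \<in> X \<Longrightarrow> 0 \<le> t \<Longrightarrow> t \<le> 1 \<Longrightarrow> Q m x t"
      proof (rule compact_uniform_strip[of Q])
        fix x and t :: real assume x: "x \<in> X"
        define r where "r = \<sigma>' v x t"
        have "(cls x r, cls x r) \<in> V" using V(2) x by simp
        then obtain A B where AB: "openin (susp_space X) A" "openin (susp_space X) B"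
            "cls x r \<in> A" "cls x r \<in> B" "A \<times> B \<subseteq> V"
          using V(1) unfolding openin_prod_topology_alt by meson
        have "openin (susp_space X) (A \<inter> B)" "cls x r \<in> A \<inter> B" using AB by auto
        then obtain n1 e where e: "e > 0"
            "\<And>y s. y \<in> X \<Longrightarrow> agree n1 x y \<Longrightarrow> \<bar>s - r\<bar> < e \<Longrightarrow> cls y s \<in> A \<inter> B"
          using x unfolding openin_susp_iff by meson
        have jc: "jointly_continuous (\<sigma>' v)" "jointly_continuous \<sigma>"
          using tc[of v] v(1) \<sigma> by (auto simp: time_change_def)
        have e2: "e / 2 > 0" using e(1) by simp
        obtain n2 d where *: "d > 0"
            "\<forall>y\<in>X. \<forall>s. agree n2 x y \<and> \<bar>s - t\<bar> < d \<longrightarrow> \<bar>\<sigma>' v y s - r\<bar> < e / 2"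
          unfolding r_def using jointly_continuousD[OF jc(1) x e2, of t] by blast
        note d = *(1) *(2)[rule_format, OF _ conjI]
        obtain n3 d' where *: "d' > 0"
            "\<forall>y\<in>X. \<forall>s. agree n3 x y \<and> \<bar>s - t\<bar> < d' \<longrightarrow> \<bar>\<sigma> y s - \<sigma> x t\<bar> < 1"
          using jointly_continuousD[OF jc(2) x zero_less_one, of t] by blast
        note d' = *(1) *(2)[rule_format, OF _ conjI]
        \<comment> \<open>A bound for the distance between s and \<sigma> y s near (x, t), where
          each of the two moves by less than 1. It is the rate at which the interpolated image of
          (y, s) moves with the parameter u.\<close>
        define K where "K = \<bar>\<sigma> x t\<bar> + \<bar>t\<bar> + 2"
        obtain m where m: "K / real (Suc m) < e / 2"
        proof -
          obtain m where "2 * K / e < real m" using reals_Archimedean2 by blast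
          then have "2 * K / e < real (Suc m)" by simp
          then have "K / real (Suc m) < e / 2" using e(1) by (simp add: field_simps)
          then show ?thesis by (rule that)
        qed
        define n where "n = max n1 (max n2 n3)"
        define \<delta> where "\<delta> = min 1 (min d d')"
        have "Q m y s" if y: "y \<in> X" "agree n x y" "\<bar>s - t\<bar> < \<delta>" for y s
          unfolding Q_def
        proof (intro ballI impI)
          fix u assume u: "u \<in> {0..1}" "\<bar>u - v\<bar> < 1 / real (Suc m)"
          have ag: "agree n1 x y" "agree n2 x y" "agree n3 x y"
            using agree_mono[OF y(2)] by (auto simp: n_def)
          have 1: "\<bar>\<sigma>' v y s - r\<bar> < e / 2" using d(2) y ag by (auto simp: \<delta>_def)
          have "\<bar>\<sigma> y s - \<sigma> x t\<bar> < 1" "\<bar>s - t\<bar> < 1" using d'(2) y ag by (auto simp: \<delta>_def)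
          then have K: "\<bar>s - \<sigma> y s\<bar> \<le> K" unfolding K_def by linarith
          have "\<sigma>' u y s - \<sigma>' v y s = (u - v) * (s - \<sigma> y s)" unfolding \<sigma>'_def by (simp add: algebra_simps)
          then have "\<bar>\<sigma>' u y s - \<sigma>' v y s\<bar> = \<bar>u - v\<bar> * \<bar>s - \<sigma> y s\<bar>" by (simp add: abs_mult)
          also have "\<dots> \<le> (1 / real (Suc m)) * K"
            using u(2) K by (intro mult_mono) auto
          also have "\<dots> < e / 2" using m by simp
          finally have 2: "\<bar>\<sigma>' u y s - r\<bar> < e" using 1 by linarith
          have "cls y (\<sigma>' v y s) \<in> A" "cls y (\<sigma>' u y s) \<in> B"
            using e(2)[OF y(1) ag(1)] 1 2 e(1) by auto
          then show "(F v (cls y s), F u (cls y s)) \<in> V"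
            using AB(5) Fcls u(1) v(1) y(1) by auto
        qed
        moreover have "\<delta> > 0" using d(1) d'(1) by (simp add: \<delta>_def)
        ultimately show "\<exists>m n d. d > 0 \<and> (\<forall>y\<in>X. \<forall>s. agree n x y \<and> \<bar>s - t\<bar> < d \<longrightarrow> Q m y s)" by blast
      next
        fix m m' :: nat and x t assume "m \<le> m'" "Q m x t"
        moreover have "1 / real (Suc m') \<le> 1 / real (Suc m)" using \<open>m \<le> m'\<close> by (simp add: frac_le)
        ultimately show "Q m' x t" unfolding Q_def by force
      qed blast
      have "F u \<in> W" if u: "u \<in> {0..1}" "\<bar>u - v\<bar> < 1 / real (Suc m)" for u
      proof -
        have "(F v c, F u c) \<in> V" if c: "c \<in> suspension X" for c
        proof -
          obtain x t where x: "x \<in> X" "c = cls x t" using c by (rule suspensionE)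
          \<comment> \<open>Shifting by the integer part of t puts the representative into the strip
            where m applies.\<close>
          have c': "c = cls (shift_by \<lfloor>t\<rfloor> x) (t - real_of_int \<lfloor>t\<rfloor>)"
            using cls_shift[OF x(1)] x(2) by simp
          have "Q m (shift_by \<lfloor>t\<rfloor> x) (t - real_of_int \<lfloor>t\<rfloor>)"
            using x(1) by (intro m) (auto, linarith)
          then show ?thesis unfolding Q_def c' using u by blast
        qed
        then show ?thesis using hp u(1) by (intro V(3)) auto
      qed
      moreover have "1 / real (Suc m) > 0" by simp
      ultimately show ?thesis by blast
    qed
    then show "openin (top_of_set {0..1}) {u \<in> topspace (top_of_set {0..1}). F u \<in> W}"
      unfolding openin_euclidean_subtopology_iff by (auto simp: dist_real_def)
  qed
  moreover have "F 0 = time_change_map \<sigma>"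
  proof -
    have "\<sigma>' 0 = \<sigma>" by (simp add: \<sigma>'_def fun_eq_iff)
    then show ?thesis by (simp add: F_def)
  qed
  moreover have "F 1 = \<one>\<^bsub>homeo_plus_group X\<^esub>"
  proof
    fix c
    show "F 1 c = \<one>\<^bsub>homeo_plus_group X\<^esub> c"
    proof (cases "c \<in> suspension X")
      case True
      then show ?thesis
        using Fcls[of 1] by (auto elim!: suspensionE simp: one_homeo_plus_group \<sigma>'_def)
    qed (simp add: one_homeo_plus_group F_def time_change_map_def)
  qed
  ultimately have "path_component_of (homeo_plus_space X) (time_change_map \<sigma>) \<one>\<^bsub>homeo_plus_group X\<^esub>"
    unfolding path_component_of_def by blast
  then show ?thesis unfolding homeo_plus_0_def by (simp add: path_component_of_sym)
qed

section \<open>Lifts to the product of the subshift with the line\<close>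

text \<open>A lift is unique up to replacing y x by \<open>shift_by (b x) (y x)\<close> and \<tau> x
  by \<tau> x - b x with b locally constant. The action on contents must not depend on this choice;
  the last step of the proof exploits it to make y commute with the shift.\<close>

definition is_lift ::
    "(((int \<Rightarrow> 'a) \<times> real) set \<Rightarrow> ((int \<Rightarrow> 'a) \<times> real) set) \<Rightarrow> ((int \<Rightarrow> 'a) \<Rightarrow> int \<Rightarrow> 'a) \<Rightarrow>
      ((int \<Rightarrow> 'a) \<Rightarrow> real \<Rightarrow> real) \<Rightarrow> bool" where
  "is_lift f y \<tau> \<longleftrightarrow>
     (\<forall>x\<in>X. y x \<in> X) \<and> (\<forall>x\<in>X. \<forall>m. \<exists>n. \<forall>x'\<in>X. agree n x x' \<longrightarrow> agree m (y x) (y x')) \<and>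
     jointly_continuous \<tau> \<and> (\<forall>x\<in>X. strict_mono (\<tau> x) \<and> range (\<tau> x) = UNIV) \<and>
     (\<forall>x\<in>X. \<forall>t. f (cls x t) = cls (y x) (\<tau> x t))"

text \<open>Representatives of one class have times that differ by integers. So the projection from
  X \<times> R is injective on strips of height less than 1, which is how continuity in the
  suspension is turned into continuity of lifts.\<close>

lemma cls_close_unique:
  assumes "z \<in> X" "z' \<in> X" "cls z r = cls z' r'" "\<bar>r - r'\<bar> < 1"
  shows "z = z'" "r = r'"
proof -
  obtain n where n: "z' = shift_by n z" "r' = r - real_of_int n"
    using assms by (auto simp: cls_eq_iff)
  then have "\<bar>real_of_int n\<bar> < 1" using assms(4) by simp
  then have "n = 0" by linarith
  then show "z = z'" "r = r'" using n by auto
qed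

text \<open>The projection from X \<times> R is open: points near another representative of the same
  class are carried back by the integer k relating the two.\<close>

lemma openin_cls_ball:
  assumes "z \<in> X"
  shows "openin (susp_space X) {cls z' r' |z' r'. z' \<in> X \<and> agree m z z' \<and> \<bar>r' - r\<bar> < e}" (is "openin _ ?U")
  unfolding openin_susp_iff
proof (intro conjI ballI allI impI)
  fix x t assume x: "x \<in> X" and "cls x t \<in> ?U"
  then obtain z' r' where z: "cls x t = cls z' r'" "z' \<in> X" "agree m z z'" "\<bar>r' - r\<bar> < e" by blast
  then obtain k where k: "z' = shift_by k x" "r' = t - real_of_int k"
    using cls_eq_iff[OF x z(2)] by blast
  have "cls y s \<in> ?U" if y: "y \<in> X" "agree (m + nat \<bar>k\<bar>) x y" "\<bar>s - t\<bar> < e - \<bar>r' - r\<bar>" for y s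
  proof -
    have "cls y s = cls (shift_by k y) (s - real_of_int k)" using y(1) by (simp add: cls_shift)
    moreover have "agree m z (shift_by k y)" using agree_trans[OF z(3)] agree_shift[OF y(2)] k(1) by simp
    moreover have "\<bar>(s - real_of_int k) - r\<bar> < e" using y(3) k(2) by linarith
    ultimately show ?thesis using y(1)
      by (intro CollectI exI[of _ "shift_by k y"] exI[of _ "s - real_of_int k"]) auto
  qed
  then show "\<exists>n d. d > 0 \<and> (\<forall>y\<in>X. \<forall>s. agree n x y \<and> \<bar>s - t\<bar> < d \<longrightarrow> cls y s \<in> ?U)"
    using z(4) by (intro exI[of _ "m + nat \<bar>k\<bar>"] exI[of _ "e - \<bar>r' - r\<bar>"]) auto
qed auto

lemma homeo_plus_local:
  assumes f: "f \<in> homeo_plus X" and x: "x \<in> X" and z: "z \<in> X" "f (cls x t) = cls z r" and e: "e > 0"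
  shows "\<exists>n d. d > 0 \<and> (\<forall>x'\<in>X. \<forall>t'. agree n x x' \<and> \<bar>t' - t\<bar> < d \<longrightarrow>
    (\<exists>z' r'. z' \<in> X \<and> agree m z z' \<and> \<bar>r' - r\<bar> < e \<and> f (cls x' t') = cls z' r'))"
proof -
  let ?U = "{cls z' r' |z' r'. z' \<in> X \<and> agree m z z' \<and> \<bar>r' - r\<bar> < e}"
  have "openin (susp_space X) {c \<in> topspace (susp_space X). f c \<in> ?U}"
    by (rule openin_continuous_map_preimage[OF homeo_plus_continuous[OF f] openin_cls_ball[OF z(1)]])
  moreover have "cls x t \<in> {c \<in> topspace (susp_space X). f c \<in> ?U}"
    using x z e by (auto intro!: exI[of _ z] exI[of _ r])
  ultimately have "\<exists>n d. d > 0 \<and> (\<forall>x'\<in>X. \<forall>t'. agree n x x' \<and> \<bar>t' - t\<bar> < d \<longrightarrow>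
      cls x' t' \<in> {c \<in> topspace (susp_space X). f c \<in> ?U})"
    using x unfolding openin_susp_iff by blast
  then obtain n d where nd: "d > 0" "\<forall>x'\<in>X. \<forall>t'. agree n x x' \<and> \<bar>t' - t\<bar> < d \<longrightarrow>
      cls x' t' \<in> {c \<in> topspace (susp_space X). f c \<in> ?U}" by blast
  have "\<exists>z' r'. z' \<in> X \<and> agree m z z' \<and> \<bar>r' - r\<bar> < e \<and> f (cls x' t') = cls z' r'"
    if "x' \<in> X" "agree n x x'" "\<bar>t' - t\<bar> < d" for x' t'
  proof -
    have "f (cls x' t') \<in> ?U" using nd(2) that by simp
    then show ?thesis by blast
  qed
  then show ?thesis using nd(1) by blast
qed

text \<open>The task is to choose representatives of f (x, 0) continuously in x. Near any point one
  can ask for a time within 1 / 4 of a fixed base time, and then the representative is unique. Since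
  X is totally disconnected, base times can be chosen locally constant, and no monodromy
  arises.\<close>

lemma lift_base:
  assumes f: "f \<in> homeo_plus X"
  obtains y a where "\<And>x. x \<in> X \<Longrightarrow> y x \<in> X" "\<And>x. x \<in> X \<Longrightarrow> f (cls x 0) = cls (y x) (a x)"
    "\<And>x m e. x \<in> X \<Longrightarrow> e > 0 \<Longrightarrow> \<exists>n. \<forall>x'\<in>X. agree n x x' \<longrightarrow> agree m (y x) (y x') \<and> \<bar>a x' - a x\<bar> < e"
proof -
  define rep where "rep p x q \<longleftrightarrow> fst q \<in> X \<and> \<bar>snd q - snd p\<bar> < 1 / 4 \<and> f (cls x 0) = cls (fst q) (snd q)"
    for p q :: "(int \<Rightarrow> 'a) \<times> real" and x
  define base where "base n x p \<longleftrightarrow> (\<forall>x'\<in>X. agree n x x' \<longrightarrow> (\<exists>q. rep p x' q))" for n x and p :: "(int \<Rightarrow> 'a) \<times> real"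
  \<comment> \<open>\<open>base n x\<close> depends only on the cylinder of radius n around x. Hence
    all points of the cylinder of radius \<open>N x\<close> have the same least radius and, the
    choice \<open>P\<close> being a function of the predicate, the same base point.\<close>
  define N where "N x = (LEAST n. \<exists>p. base n x p)" for x
  define P where "P x = (SOME p. base (N x) x p)" for x
  define Q where "Q x = (SOME q. rep (P x) x q)" for x
  have ex: "\<exists>n p. base n x p" if x: "x \<in> X" for x
  proof -
    obtain z r where z: "z \<in> X" "f (cls x 0) = cls z r"
      using suspensionE[OF homeo_plus_maps[OF f cls_mem[OF x, of 0]]] by metis
    have "(1 / 4 :: real) > 0" by simp
    from homeo_plus_local[OF f x z this, of 0] obtain n d where d: "d > 0" "\<forall>x'\<in>X. \<forall>t'. agree n x x' \<and> \<bar>t' - 0\<bar> < d \<longrightarrow>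
       (\<exists>z' r'. z' \<in> X \<and> agree 0 z z' \<and> \<bar>r' - r\<bar> < 1 / 4 \<and> f (cls x' t') = cls z' r')" by blast
    have "base n x (z, r)"
      unfolding base_def
    proof (intro ballI impI)
      fix x' assume "x' \<in> X" "agree n x x'"
      then obtain z' r' where "z' \<in> X" "\<bar>r' - r\<bar> < 1 / 4" "f (cls x' 0) = cls z' r'"
        using d(2)[rule_format, of x' 0] d(1) by auto
      then show "\<exists>q. rep (z, r) x' q" unfolding rep_def by (intro exI[of _ "(z', r')"]) simp
    qed
    then show ?thesis by blast
  qed
  have base: "base (N x) x (P x)" if x: "x \<in> X" for x
  proof -
    have "\<exists>p. base (N x) x p" unfolding N_def by (rule LeastI_ex[OF ex[OF x]])
    then show ?thesis unfolding P_def by (rule someI_ex)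
  qed
  have Q: "rep (P x) x (Q x)" if "x \<in> X" for x
  proof -
    have "\<exists>q. rep (P x) x q" using base[OF that] that unfolding base_def by simp
    then show ?thesis unfolding Q_def by (rule someI_ex)
  qed
  have base_cong: "base n x = base n x'" if "agree n x x'" for n x x'
  proof -
    have "agree n x u \<longleftrightarrow> agree n x' u" for u using that agree_sym agree_trans by blast
    then show ?thesis unfolding base_def by simp
  qed
  have P_cong: "P x = P x'" if x: "x \<in> X" "x' \<in> X" "agree (N x) x x'" for x x'
  proof -
    have 1: "base n x = base n x'" if "n \<le> N x" for n
      by (rule base_cong) (rule agree_mono[OF x(3) that])
    have "\<exists>p. base (N x) x p" using base[OF x(1)] by blast
    then have "\<exists>p. base (N x) x' p" using 1[of "N x"] by simp
    then have le: "N x' \<le> N x" unfolding N_def[of x'] by (rule Least_le)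
    have "\<exists>p. base (N x') x p" using base[OF x(2)] 1[OF le] by metis
    then have "N x \<le> N x'" unfolding N_def[of x] by (rule Least_le)
    then have "N x = N x'" using le by simp
    then show ?thesis unfolding P_def using 1[of "N x"] by simp
  qed
  define y where "y x = fst (Q x)" for x
  define a where "a x = snd (Q x)" for x
  have y: "y x \<in> X" and fa: "f (cls x 0) = cls (y x) (a x)" and near: "\<bar>a x - snd (P x)\<bar> < 1 / 4" if "x \<in> X" for x
    using Q[OF that] unfolding rep_def y_def a_def by auto
  have "\<exists>n. \<forall>x'\<in>X. agree n x x' \<longrightarrow> agree m (y x) (y x') \<and> \<bar>a x' - a x\<bar> < e"
    if x: "x \<in> X" and e: "e > 0" for x m e
  proof -
    have e': "min e (1 / 4) > 0" using e by simp
    from homeo_plus_local[OF f x y[OF x] fa[OF x] e', of m] obtain n d where d: "d > 0" "\<forall>x'\<in>X. \<forall>t'. agree n x x' \<and> \<bar>t' - 0\<bar> < d \<longrightarrow>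
       (\<exists>z' r'. z' \<in> X \<and> agree m (y x) z' \<and> \<bar>r' - a x\<bar> < min e (1 / 4) \<and> f (cls x' t') = cls z' r')" by blast
    have "agree m (y x) (y x') \<and> \<bar>a x' - a x\<bar> < e" if x': "x' \<in> X" "agree (max n (N x)) x x'" for x'
    proof -
      have "agree n x x'" "agree (N x) x x'" using agree_mono[OF x'(2)] by auto
      then have P: "P x = P x'" using P_cong x x'(1) by blast
      have "\<exists>z' r'. z' \<in> X \<and> agree m (y x) z' \<and> \<bar>r' - a x\<bar> < min e (1 / 4) \<and> f (cls x' 0) = cls z' r'"
        using d(2)[rule_format, OF x'(1), of 0] \<open>agree n x x'\<close> d(1) by simp
      then obtain z' r' where z': "z' \<in> X" "agree m (y x) z'" "\<bar>r' - a x\<bar> < min e (1 / 4)" "f (cls x' 0) = cls z' r'"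
        by blast
      have "cls z' r' = cls (y x') (a x')" using z'(4) fa[OF x'(1)] by simp
      \<comment> \<open>Three errors of less than 1 / 4 each: r' to \<open>a x\<close>, and
        \<open>a x\<close> and \<open>a x'\<close> to their common base time.\<close>
      moreover have "\<bar>r' - a x'\<bar> < 1"
        using z'(3) near[OF x] near[OF x'(1)] unfolding P by linarith
      ultimately have "z' = y x'" "r' = a x'" using cls_close_unique z'(1) y[OF x'(1)] by blast+
      then show ?thesis using z' by simp
    qed
    then show ?thesis by blast
  qed
  then show ?thesis using that[of y a] y fa by blast
qed

theorem lift_exists:
  assumes f: "f \<in> homeo_plus X"
  obtains y \<tau> where "is_lift f y \<tau>"
proof -
  obtain y a where y: "\<And>x. x \<in> X \<Longrightarrow> y x \<in> X" and fa: "\<And>x. x \<in> X \<Longrightarrow> f (cls x 0) = cls (y x) (a x)"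
    and cont: "\<And>x m e. x \<in> X \<Longrightarrow> e > 0 \<Longrightarrow> \<exists>n. \<forall>x'\<in>X. agree n x x' \<longrightarrow> agree m (y x) (y x') \<and> \<bar>a x' - a x\<bar> < e"
    using lift_base[OF f] by blast
  have "\<exists>h. strict_mono h \<and> range h = UNIV \<and> h 0 = a x \<and> (\<forall>t. f (cls x t) = cls (y x) (h t))" if x: "x \<in> X" for x
  proof -
    obtain h where h: "strict_mono h" "range h = UNIV" "\<And>s. f (flow s (cls x 0)) = flow (h s) (f (cls x 0))"
      using homeo_plus_flowE[OF f cls_mem[OF x]] by blast
    have h': "f (cls x s) = cls (y x) (a x + h s)" for s
      using h(3)[of s] fa[OF x] by (simp add: flow_cls)
    \<comment> \<open>The reparametrisation h given by the flow fixes 0, because the leaf of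
      \<open>y x\<close> is not periodic; so it is compatible with the chosen base time.\<close>
    have "cls (y x) (a x) = cls (y x) (a x + h 0)" using h'[of 0] fa[OF x] by simp
    then obtain n where n: "shift_by n (y x) = y x" "a x + h 0 = a x - real_of_int n"
      using cls_eq_iff[OF y[OF x] y[OF x]] by metis
    then have "n = 0" using aperiodic[OF y[OF x], of n 0] by simp
    then have "h 0 = 0" using n(2) by simp
    moreover have "strict_mono (\<lambda>s. a x + h s)" using h(1) by (simp add: strict_mono_def)
    moreover have "range (\<lambda>s. a x + h s) = UNIV"
    proof -
      have "r \<in> range (\<lambda>s. a x + h s)" for r
      proof -
        obtain s where "h s = r - a x" using h(2) by (metis surj_def)
        then show ?thesis by (intro range_eqI[of _ _ s]) simp
      qed
      then show ?thesis by blast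
    qed
    ultimately show ?thesis using h' by (intro exI[of _ "\<lambda>s. a x + h s"]) simp
  qed
  then obtain \<tau> where \<tau>: "\<And>x. x \<in> X \<Longrightarrow> strict_mono (\<tau> x) \<and> range (\<tau> x) = UNIV \<and> \<tau> x 0 = a x \<and>
      (\<forall>t. f (cls x t) = cls (y x) (\<tau> x t))"
    by metis
  have ft: "f (cls x t) = cls (y x) (\<tau> x t)" if "x \<in> X" for x t using \<tau>[OF that] by blast
  have \<tau>cont: "continuous_on UNIV (\<tau> x)" if "x \<in> X" for x
    using \<tau>[OF that] strict_mono_surj_continuous by blast
  \<comment> \<open>Continuity in x at a fixed time propagates along the line by connectedness; joint continuity
    then follows from monotonicity in time.\<close>
  have fix_time: "\<exists>n. \<forall>x'\<in>X. agree n x x' \<longrightarrow> \<bar>\<tau> x' t - \<tau> x t\<bar> < e" if x: "x \<in> X" and "e > 0" for x t e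
  proof -
    define G where "G = {t. \<forall>e>0. \<exists>n. \<forall>x'\<in>X. agree n x x' \<longrightarrow> \<bar>\<tau> x' t - \<tau> x t\<bar> < e}"
    \<comment> \<open>Close to any t0 either all times or none belong to G. Applied at members of G
      and of its complement, this makes both sets open.\<close>
    have step: "\<exists>d>0. \<forall>t1 t2. \<bar>t1 - t0\<bar> < d \<and> \<bar>t2 - t0\<bar> < d \<and> t1 \<in> G \<longrightarrow> t2 \<in> G" for t0
    proof -
      have "(1 / 4 :: real) > 0" by simp
      from homeo_plus_local[OF f x y[OF x] ft[OF x, of t0] this, of 0] obtain n d where d: "d > 0" and
        near: "\<forall>x'\<in>X. \<forall>t'. agree n x x' \<and> \<bar>t' - t0\<bar> < d \<longrightarrow> (\<exists>z' r'. z' \<in> X \<and> agree 0 (y x) z' \<and>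
          \<bar>r' - \<tau> x t0\<bar> < 1 / 4 \<and> f (cls x' t') = cls z' r')" by blast
      have frac: "\<exists>j::int. \<bar>\<tau> x' t' - (\<tau> x t0 + real_of_int j)\<bar> < 1 / 4"
        if x': "x' \<in> X" "agree n x x'" "\<bar>t' - t0\<bar> < d" for x' t'
      proof -
        obtain z' r' where z: "z' \<in> X" "\<bar>r' - \<tau> x t0\<bar> < 1 / 4" "cls (y x') (\<tau> x' t') = cls z' r'"
          using near x' ft[OF x'(1)] by metis
        then obtain j where "r' = \<tau> x' t' - real_of_int j" using cls_eq_iff[OF y[OF x'(1)] z(1)] by blast
        then have "\<tau> x' t' - (\<tau> x t0 + real_of_int j) = r' - \<tau> x t0" by simp
        then show ?thesis using z(2) by (intro exI[of _ j]) (simp only:)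
      qed
      have stay: "\<bar>\<tau> x' t2 - \<tau> x t0\<bar> < 1 / 4"
        if x': "x' \<in> X" "agree n x x'" and t: "\<bar>t1 - t0\<bar> < d" "\<bar>t2 - t0\<bar> < d" and t1: "\<bar>\<tau> x' t1 - \<tau> x t0\<bar> < 1 / 4" for x' t1 t2
      proof (rule ccontr)
        assume far: "\<not> \<bar>\<tau> x' t2 - \<tau> x t0\<bar> < 1 / 4"
        \<comment> \<open>A path leaving the interval of radius 1 / 4 around \<tau> x t0 must pass
          through an end point, and an end point has distance at least 1 / 4 from every integer
          translate of \<tau> x t0, contradicting \<open>frac\<close>.\<close>
        define w where "w = (if \<tau> x' t2 > \<tau> x t0 then \<tau> x t0 + 1 / 4 else \<tau> x t0 - 1 / 4)"
        have w: "w \<in> closed_segment (\<tau> x' t1) (\<tau> x' t2)"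
        proof -
          have "\<tau> x' t1 < \<tau> x t0 + 1 / 4" "\<tau> x t0 - 1 / 4 < \<tau> x' t1"
            using t1 unfolding abs_less_iff by linarith+
          moreover have "\<tau> x t0 + 1 / 4 \<le> \<tau> x' t2 \<or> \<tau> x' t2 \<le> \<tau> x t0 - 1 / 4"
            using far unfolding abs_less_iff by linarith
          ultimately show ?thesis unfolding w_def closed_segment_eq_real_ivl by auto
        qed
        have "connected (\<tau> x' ` closed_segment t1 t2)"
          by (rule connected_continuous_image[OF continuous_on_subset[OF \<tau>cont[OF x'(1)]]]) auto
        then have "closed_segment (\<tau> x' t1) (\<tau> x' t2) \<subseteq> \<tau> x' ` closed_segment t1 t2"
          by (intro closed_segment_subset) (auto simp: is_interval_connected_1[symmetric] is_interval_convex_1)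
        then obtain s where s: "s \<in> closed_segment t1 t2" "\<tau> x' s = w" using w by blast
        then have "\<bar>s - t0\<bar> < d" using t by (auto simp: closed_segment_eq_real_ivl split: if_splits)
        then obtain j :: int where "\<bar>w - (\<tau> x t0 + real_of_int j)\<bar> < 1 / 4" using frac[OF x'] s(2) by blast
        then have j: "\<bar>1 / 4 - real_of_int j\<bar> < 1 / 4 \<or> \<bar>- 1 / 4 - real_of_int j\<bar> < 1 / 4"
          unfolding w_def by (auto split: if_splits)
        then have "\<bar>real_of_int j\<bar> < 1" by linarith
        moreover have "j \<noteq> 0" using j by auto
        ultimately show False by linarith
      qed
      have "t2 \<in> G" if t: "\<bar>t1 - t0\<bar> < d" "\<bar>t2 - t0\<bar> < d" "t1 \<in> G" for t1 t2
        unfolding G_def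
      proof (intro CollectI allI impI)
        fix e :: real assume e: "e > 0"
        have x0: "\<bar>\<tau> x t' - \<tau> x t0\<bar> < 1 / 4" if "\<bar>t' - t0\<bar> < d" for t'
          using stay[OF x agree_refl, of t0 t'] that d by simp
        define e1 where "e1 = 1 / 4 - \<bar>\<tau> x t1 - \<tau> x t0\<bar>"
        have "e1 > 0" using x0[OF t(1)] by (simp add: e1_def)
        then obtain n1 where n1: "\<forall>x'\<in>X. agree n1 x x' \<longrightarrow> \<bar>\<tau> x' t1 - \<tau> x t1\<bar> < e1"
          using t(3) unfolding G_def by blast
        have e2: "min e (1 / 4) > 0" using e by simp
        from homeo_plus_local[OF f x y[OF x] ft[OF x, of t2] e2, of 0] obtain n2 d2 where d2: "d2 > 0" and
          near2: "\<forall>x'\<in>X. \<forall>t'. agree n2 x x' \<and> \<bar>t' - t2\<bar> < d2 \<longrightarrow> (\<exists>z' r'. z' \<in> X \<and> agree 0 (y x) z' \<and>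
            \<bar>r' - \<tau> x t2\<bar> < min e (1 / 4) \<and> f (cls x' t') = cls z' r')" by blast
        have "\<bar>\<tau> x' t2 - \<tau> x t2\<bar> < e" if x': "x' \<in> X" "agree (max n (max n1 n2)) x x'" for x'
        proof -
          have ag: "agree n x x'" "agree n1 x x'" "agree n2 x x'" using agree_mono[OF x'(2)] by auto
          have "\<bar>\<tau> x' t1 - \<tau> x t1\<bar> < e1" using n1 x'(1) ag by blast
          then have "\<bar>\<tau> x' t1 - \<tau> x t0\<bar> < 1 / 4" unfolding e1_def by linarith
          then have A: "\<bar>\<tau> x' t2 - \<tau> x t0\<bar> < 1 / 4" by (rule stay[OF x'(1) ag(1) t(1,2)])
          have "\<exists>z' r'. z' \<in> X \<and> \<bar>r' - \<tau> x t2\<bar> < min e (1 / 4) \<and> f (cls x' t2) = cls z' r'"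
            using near2[rule_format, OF x'(1), of t2] ag(3) d2 by auto
          then obtain z' r' where z: "z' \<in> X" "\<bar>r' - \<tau> x t2\<bar> < min e (1 / 4)" "f (cls x' t2) = cls z' r'" by blast
          have "cls z' r' = cls (y x') (\<tau> x' t2)" using z(3) ft[OF x'(1)] by simp
          moreover have "\<bar>r' - \<tau> x' t2\<bar> < 1" using z(2) A x0[OF t(2)] by linarith
          ultimately have "r' = \<tau> x' t2" using cls_close_unique z(1) y[OF x'(1)] by blast
          then show ?thesis using z(2) by simp
        qed
        then show "\<exists>n. \<forall>x'\<in>X. agree n x x' \<longrightarrow> \<bar>\<tau> x' t2 - \<tau> x t2\<bar> < e" by blast
      qed
      then show ?thesis using d by blast
    qed
    have "open G"
      unfolding open_dist dist_real_def
    proof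
      fix t assume "t \<in> G"
      then show "\<exists>e>0. \<forall>s. \<bar>s - t\<bar> < e \<longrightarrow> s \<in> G" using step[of t] by (metis abs_zero diff_self)
    qed
    moreover have "open (- G)"
      unfolding open_dist dist_real_def
    proof
      fix t assume "t \<in> - G"
      then show "\<exists>e>0. \<forall>s. \<bar>s - t\<bar> < e \<longrightarrow> s \<in> - G" using step[of t] by (metis ComplD ComplI abs_zero diff_self)
    qed
    then have "closed G" by (simp add: closed_def)
    moreover have "0 \<in> G"
      unfolding G_def using cont[OF x, of _ 0] \<tau> x by (auto, metis)
    ultimately have "G = UNIV" using clopen[of G] by auto
    then show ?thesis using \<open>e > 0\<close> unfolding G_def by blast
  qed
  have "jointly_continuous \<tau>"
    unfolding jointly_continuous_def
  proof (intro ballI allI impI)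
    fix x t and e :: real assume x: "x \<in> X" and e: "e > 0"
    obtain d where d: "d > 0" "\<And>s. \<bar>s - t\<bar> \<le> d \<Longrightarrow> \<bar>\<tau> x s - \<tau> x t\<bar> < e / 2"
    proof -
      have "isCont (\<tau> x) t" using \<tau>cont[OF x] by (simp add: continuous_on_eq_continuous_at)
      moreover have "e / 2 > 0" using e by simp
      ultimately obtain d where "d > 0" "\<forall>s. \<bar>s - t\<bar> < d \<longrightarrow> \<bar>\<tau> x s - \<tau> x t\<bar> < e / 2"
        unfolding continuous_at_eps_delta dist_real_def by blast
      then show ?thesis by (intro that[of "d / 2"]) auto
    qed
    have e2: "e / 2 > 0" using e by simp
    obtain n1 where n1: "\<forall>x'\<in>X. agree n1 x x' \<longrightarrow> \<bar>\<tau> x' (t - d) - \<tau> x (t - d)\<bar> < e / 2" using fix_time[OF x e2] by blast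
    obtain n2 where n2: "\<forall>x'\<in>X. agree n2 x x' \<longrightarrow> \<bar>\<tau> x' (t + d) - \<tau> x (t + d)\<bar> < e / 2" using fix_time[OF x e2] by blast
    have "\<bar>\<tau> x' s - \<tau> x t\<bar> < e" if x': "x' \<in> X" "agree (max n1 n2) x x'" "\<bar>s - t\<bar> < d" for x' s
    proof -
      have ag: "agree n1 x x'" "agree n2 x x'" using agree_mono[OF x'(2)] by auto
      have "\<tau> x' (t - d) \<le> \<tau> x' s" "\<tau> x' s \<le> \<tau> x' (t + d)"
        using \<tau>[OF x'(1)] x'(3) by (auto simp: strict_mono_less_eq)
      moreover have "\<bar>\<tau> x' (t - d) - \<tau> x (t - d)\<bar> < e / 2" "\<bar>\<tau> x' (t + d) - \<tau> x (t + d)\<bar> < e / 2"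
        using n1 n2 ag x'(1) by blast+
      moreover have "\<bar>\<tau> x (t - d) - \<tau> x t\<bar> < e / 2" "\<bar>\<tau> x (t + d) - \<tau> x t\<bar> < e / 2"
        using d by auto
      ultimately show ?thesis unfolding abs_less_iff by linarith
    qed
    then show "\<exists>n. \<exists>d>0. \<forall>x'\<in>X. \<forall>s. agree n x x' \<and> \<bar>s - t\<bar> < d \<longrightarrow> \<bar>\<tau> x' s - \<tau> x t\<bar> < e"
      using d(1) by blast
  qed
  moreover have "\<exists>n. \<forall>x'\<in>X. agree n x x' \<longrightarrow> agree m (y x) (y x')" if "x \<in> X" for x m
    using cont[OF that zero_less_one] by blast
  ultimately have "is_lift f y \<tau>" unfolding is_lift_def using y \<tau> by blast
  then show ?thesis by (rule that)
qed

lemma lift_mem: "is_lift f y \<tau> \<Longrightarrow> x \<in> X \<Longrightarrow> y x \<in> X"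
  and lift_cont: "is_lift f y \<tau> \<Longrightarrow> x \<in> X \<Longrightarrow> \<exists>n. \<forall>x'\<in>X. agree n x x' \<longrightarrow> agree m (y x) (y x')"
  and lift_jcont: "is_lift f y \<tau> \<Longrightarrow> jointly_continuous \<tau>"
  and lift_mono: "is_lift f y \<tau> \<Longrightarrow> x \<in> X \<Longrightarrow> strict_mono (\<tau> x)"
  and lift_surj: "is_lift f y \<tau> \<Longrightarrow> x \<in> X \<Longrightarrow> range (\<tau> x) = UNIV"
  and lift_cls: "is_lift f y \<tau> \<Longrightarrow> x \<in> X \<Longrightarrow> f (cls x t) = cls (y x) (\<tau> x t)"
  unfolding is_lift_def by blast+

text \<open>For j = 1 this is the function k of the overview. For a lift the real difference is
  already an integer, and the floor only changes its type.\<close>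

definition lift_cocycle :: "((int \<Rightarrow> 'a) \<Rightarrow> real \<Rightarrow> real) \<Rightarrow> (int \<Rightarrow> 'a) \<Rightarrow> int \<Rightarrow> int" where
  "lift_cocycle \<tau> x j = \<lfloor>\<tau> x (real_of_int j) - \<tau> (shift_by j x) 0\<rfloor>"

text \<open>Two representatives of a point have images that represent the same point, so they differ
  by some integer. It does not depend on t, since by \<open>aperiodic\<close> it can be read off
  from y alone.\<close>

lemma lift_cocycle:
  assumes l: "is_lift f y \<tau>" and x: "x \<in> X"
  shows "y (shift_by j x) = shift_by (lift_cocycle \<tau> x j) (y x)"
    and "\<tau> (shift_by j x) (t - real_of_int j) = \<tau> x t - real_of_int (lift_cocycle \<tau> x j)"
proof -
  have ex: "\<exists>n. y (shift_by j x) = shift_by n (y x) \<and> \<tau> (shift_by j x) (t - real_of_int j) = \<tau> x t - real_of_int n" for t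
  proof -
    have "cls x t = cls (shift_by j x) (t - real_of_int j)" using x by (simp add: cls_shift)
    then have "cls (y x) (\<tau> x t) = cls (y (shift_by j x)) (\<tau> (shift_by j x) (t - real_of_int j))"
      using lift_cls[OF l] x by (metis shift_mem_iff)
    then show ?thesis using cls_eq_iff lift_mem[OF l] x by simp
  qed
  obtain n where n: "y (shift_by j x) = shift_by n (y x)"
      "\<tau> (shift_by j x) (real_of_int j - real_of_int j) = \<tau> x (real_of_int j) - real_of_int n"
    using ex[of "real_of_int j"] by blast
  have k: "lift_cocycle \<tau> x j = n" using n(2) by (simp add: lift_cocycle_def)
  obtain m where m: "y (shift_by j x) = shift_by m (y x)"
      "\<tau> (shift_by j x) (t - real_of_int j) = \<tau> x t - real_of_int m"
    using ex[of t] by blast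
  have "m = n" using aperiodic[OF lift_mem[OF l x]] m(1) n(1) by metis
  then show "y (shift_by j x) = shift_by (lift_cocycle \<tau> x j) (y x)"
    "\<tau> (shift_by j x) (t - real_of_int j) = \<tau> x t - real_of_int (lift_cocycle \<tau> x j)"
    using n m k by auto
qed

lemma lift_cocycle_add:
  assumes l: "is_lift f y \<tau>" and x: "x \<in> X"
  shows "lift_cocycle \<tau> x (i + j) = lift_cocycle \<tau> x i + lift_cocycle \<tau> (shift_by i x) j"
proof -
  have "shift_by (lift_cocycle \<tau> x (i + j)) (y x) = y (shift_by j (shift_by i x))"
    using lift_cocycle(1)[OF l x, of "i + j"] by (simp add: shift_by_shift_by add.commute)
  also have "\<dots> = shift_by (lift_cocycle \<tau> (shift_by i x) j + lift_cocycle \<tau> x i) (y x)"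
    using lift_cocycle(1)[OF l, of "shift_by i x" j] lift_cocycle(1)[OF l x, of i] x
    by (simp add: shift_by_shift_by)
  finally show ?thesis using aperiodic[OF lift_mem[OF l x]] by fastforce
qed

lemma lift_time_bound:
  assumes l: "is_lift f y \<tau>"
  obtains B :: nat where "\<And>x. x \<in> X \<Longrightarrow> \<bar>\<tau> x 0\<bar> \<le> real B"
proof (rule compact_uniform[where Q = "\<lambda>B x. \<bar>\<tau> x 0\<bar> \<le> real B"])
  fix x assume x: "x \<in> X"
  obtain n d where nd: "d > 0" "\<forall>y\<in>X. \<forall>s. agree n x y \<and> \<bar>s - 0\<bar> < d \<longrightarrow> \<bar>\<tau> y s - \<tau> x 0\<bar> < 1"
    using jointly_continuousD[OF lift_jcont[OF l] x zero_less_one, of 0] by blast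
  obtain m where m: "\<bar>\<tau> x 0\<bar> + 1 \<le> real m" using real_arch_simple by blast
  have "\<bar>\<tau> y 0\<bar> \<le> real m" if "y \<in> X" "agree n x y" for y
  proof -
    have "\<bar>\<tau> y 0 - \<tau> x 0\<bar> < 1" using nd that by simp
    then show ?thesis using m by linarith
  qed
  then show "\<exists>m n. \<forall>y\<in>X. agree n x y \<longrightarrow> \<bar>\<tau> y 0\<bar> \<le> real m" by blast
qed (use that in auto)

lemma integer_step_locally_const:
  assumes a: "jointly_continuous \<sigma>" and b: "jointly_continuous \<tau>"
    and k: "\<And>x. x \<in> X \<Longrightarrow> \<sigma> x s - \<tau> (shift_by j x) t = real_of_int (k x)"
  shows "locally_const X k"
  unfolding locally_const_def
proof
  fix x assume x: "x \<in> X"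
  have h: "(1 / 2 :: real) > 0" by simp
  obtain n1 d1 where 1: "d1 > 0" "\<forall>y\<in>X. \<forall>r. agree n1 x y \<and> \<bar>r - s\<bar> < d1 \<longrightarrow> \<bar>\<sigma> y r - \<sigma> x s\<bar> < 1 / 2"
    using jointly_continuousD[OF a x h, of s] by blast
  have sx: "shift_by j x \<in> X" using x by simp
  obtain n2 d2 where 2: "d2 > 0" "\<forall>y\<in>X. \<forall>r. agree n2 (shift_by j x) y \<and> \<bar>r - t\<bar> < d2 \<longrightarrow> \<bar>\<tau> y r - \<tau> (shift_by j x) t\<bar> < 1 / 2"
    using jointly_continuousD[OF b sx h, of t] by blast
  have "k y = k x" if y: "y \<in> X" "agree (max n1 (n2 + nat \<bar>j\<bar>)) x y" for y
  proof -
    have "agree n1 x y" "agree (n2 + nat \<bar>j\<bar>) x y" using agree_mono[OF y(2)] by auto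
    then have "\<bar>\<sigma> y s - \<sigma> x s\<bar> < 1 / 2" "\<bar>\<tau> (shift_by j y) t - \<tau> (shift_by j x) t\<bar> < 1 / 2"
      using 1 2 y(1) agree_shift[of n2 j x y] by auto
    then have "\<bar>real_of_int (k y) - real_of_int (k x)\<bar> < 1" using k[OF x] k[OF y(1)] by linarith
    then show ?thesis by linarith
  qed
  then show "\<exists>n. \<forall>y\<in>X. agree n x y \<longrightarrow> k y = k x" by blast
qed

lemma lift_cocycle_locally_const:
  assumes l: "is_lift f y \<tau>"
  shows "locally_const X (\<lambda>x. lift_cocycle \<tau> x j)"
proof (rule integer_step_locally_const[OF lift_jcont[OF l] lift_jcont[OF l]])
  fix x assume "x \<in> X"
  from lift_cocycle(2)[OF l this, of j "real_of_int j"]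
  show "\<tau> x (real_of_int j) - \<tau> (shift_by j x) 0 = real_of_int (lift_cocycle \<tau> x j)" by simp
qed

lemma locally_const_lift:
  assumes l: "is_lift f y \<tau>" and g: "locally_const X g"
  shows "locally_const X (\<lambda>x. g (y x))"
proof -
  obtain m where m: "\<And>x x'. x \<in> X \<Longrightarrow> x' \<in> X \<Longrightarrow> agree m x x' \<Longrightarrow> g x = g x'"
    using locally_const_uniform[OF g] by blast
  show ?thesis
    unfolding locally_const_def
  proof
    fix x assume x: "x \<in> X"
    obtain n where "\<forall>x'\<in>X. agree n x x' \<longrightarrow> agree m (y x) (y x')" using lift_cont[OF l x] by blast
    then have "\<forall>x'\<in>X. agree n x x' \<longrightarrow> g (y x') = g (y x)"
      using m lift_mem[OF l] x by metis
    then show "\<exists>n. \<forall>x'\<in>X. agree n x x' \<longrightarrow> g (y x') = g (y x)" by blast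
  qed
qed

section \<open>Birkhoff sums and pullbacks of integer functions\<close>

text \<open>The sign for negative n is the one for which the cocycle identity
  \<open>birkhoff_add\<close> holds for all integers; lift cocycles can be negative.\<close>

definition birkhoff :: "((int \<Rightarrow> 'a) \<Rightarrow> int) \<Rightarrow> int \<Rightarrow> (int \<Rightarrow> 'a) \<Rightarrow> int" where
  "birkhoff g n z = (if n \<ge> 0 then \<Sum>i\<in>{0..<n}. g (shift_by i z) else - (\<Sum>i\<in>{n..<0}. g (shift_by i z)))"

lemma birkhoff_0 [simp]: "birkhoff g 0 z = 0"
  by (simp add: birkhoff_def)

lemma birkhoff_step: "birkhoff g (n + 1) z = birkhoff g n z + g (shift_by n z)"
proof (cases "n \<ge> 0")
  case True
  then have "{0..<n + 1} = insert n {0..<n}" by auto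
  then show ?thesis using True by (simp add: birkhoff_def)
next
  case False
  then have "{n..<0} = insert n {n + 1..<0}" by auto
  then have "(\<Sum>i\<in>{n..<0}. g (shift_by i z)) = g (shift_by n z) + (\<Sum>i\<in>{n + 1..<0}. g (shift_by i z))" by simp
  then show ?thesis using False by (cases "n + 1 = 0") (auto simp: birkhoff_def)
qed

lemma birkhoff_1 [simp]: "birkhoff g 1 z = g z"
  using birkhoff_step[of g 0 z] by simp

lemma birkhoff_add: "birkhoff g (m + n) z = birkhoff g m z + birkhoff g n (shift_by m z)"
proof (induction n rule: int_induct[where k = 0])
  case (step1 i)
  then show ?case
    using birkhoff_step[of g "m + i" z] birkhoff_step[of g i "shift_by m z"]
    by (simp add: shift_by_shift_by add.commute add.left_commute)
next
  case (step2 i)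
  then show ?case
    using birkhoff_step[of g "m + (i - 1)" z] birkhoff_step[of g "i - 1" "shift_by m z"]
    by (simp add: shift_by_shift_by add.commute add.left_commute)
qed simp

lemma birkhoff_sum: "birkhoff (\<lambda>x. g x + h x) n z = birkhoff g n z + birkhoff h n z"
  by (simp add: birkhoff_def sum.distrib)

lemma birkhoff_const_1: "birkhoff (\<lambda>_. 1) n z = n"
  by (simp add: birkhoff_def)

lemma birkhoff_shift: "birkhoff (\<lambda>x. g (shift x)) n z = birkhoff g n z + g (shift_by n z) - g z"
proof -
  have "birkhoff (\<lambda>x. g (shift x)) n z = birkhoff g n (shift z)"
    by (simp add: birkhoff_def shift_by_shift_by add.commute)
  moreover have "birkhoff g (1 + n) z = birkhoff g (n + 1) z" by (simp add: add.commute)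
  ultimately show ?thesis unfolding birkhoff_step birkhoff_add[of g 1 n] by simp
qed

lemma birkhoff_lower_bound:
  assumes z: "z \<in> X" and g: "\<And>x. x \<in> X \<Longrightarrow> 0 \<le> g x \<and> g x \<le> int M" and n: "- int c \<le> n"
  shows "- (int c * int M) \<le> birkhoff g n z"
proof (cases "n \<ge> 0")
  case True
  then have "0 \<le> birkhoff g n z" using g z by (auto simp: birkhoff_def intro!: sum_nonneg)
  then show ?thesis by (smt (verit) mult_nonneg_nonneg of_nat_0_le_iff)
next
  case False
  have "(\<Sum>i\<in>{n..<0}. g (shift_by i z)) \<le> (\<Sum>i\<in>{n..<0}. int M)" using g z by (intro sum_mono) auto
  also have "\<dots> = (- n) * int M" using False by simp
  also have "\<dots> \<le> int c * int M" using n by (intro mult_right_mono) auto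
  finally show ?thesis using False by (simp add: birkhoff_def)
qed

lemma birkhoff_locally_const:
  assumes g: "locally_const X g" and l: "is_lift f y \<tau>" and k: "locally_const X k"
  shows "locally_const X (\<lambda>x. birkhoff g (k x) (y x))"
  unfolding locally_const_def
proof
  fix x assume x: "x \<in> X"
  obtain n1 where n1: "\<forall>x'\<in>X. agree n1 x x' \<longrightarrow> k x' = k x"
    using k x unfolding locally_const_def by blast
  have "locally_const X (\<lambda>x'. birkhoff g (k x) (y x'))"
  proof -
    have *: "locally_const X (\<lambda>x'. \<Sum>i\<in>I. g (shift_by i (y x')))" if "finite I" for I :: "int set"
      using that by (intro locally_const_sum locally_const_lift[OF l] locally_const_shift[OF g])
    show ?thesis
      unfolding birkhoff_def using *[of "{0..<k x}"] locally_const_comp[OF *[of "{k x..<0}"], of uminus]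
      by (cases "0 \<le> k x") simp_all
  qed
  then obtain n2 where n2: "\<forall>x'\<in>X. agree n2 x x' \<longrightarrow> birkhoff g (k x) (y x') = birkhoff g (k x) (y x)"
    using x unfolding locally_const_def by blast
  have "birkhoff g (k x') (y x') = birkhoff g (k x) (y x)" if x': "x' \<in> X" "agree (max n1 n2) x x'" for x'
  proof -
    have "agree n1 x x'" "agree n2 x x'" using agree_mono[OF x'(2)] by auto
    then show ?thesis using n1 n2 x'(1) by metis
  qed
  then show "\<exists>n. \<forall>x'\<in>X. agree n x x' \<longrightarrow> birkhoff g (k x') (y x') = birkhoff g (k x) (y x)" by blast
qed

text \<open>In terms of the cohomology of the suspension with integer coefficients, this is the map induced
  by the homeomorphism with lift \<open>(y, \<tau>)\<close>.\<close>

definition pullback :: "((int \<Rightarrow> 'a) \<Rightarrow> int \<Rightarrow> 'a) \<Rightarrow> ((int \<Rightarrow> 'a) \<Rightarrow> real \<Rightarrow> real) \<Rightarrow>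
    ((int \<Rightarrow> 'a) \<Rightarrow> int) \<Rightarrow> (int \<Rightarrow> 'a) \<Rightarrow> int" where
  "pullback y \<tau> g x = birkhoff g (lift_cocycle \<tau> x 1) (y x)"

lemma pullback_locally_const:
  assumes "is_lift f y \<tau>" "locally_const X g"
  shows "locally_const X (pullback y \<tau> g)"
  using birkhoff_locally_const[OF assms(2,1) lift_cocycle_locally_const[OF assms(1)]]
  by (simp add: pullback_def[abs_def])

text \<open>A chain rule: n steps from x correspond to \<open>lift_cocycle \<tau> x n\<close> steps
  from y x. Both sides vanish at n = 0 and have the same increments, so induction goes in both
  directions.\<close>

lemma birkhoff_pullback:
  assumes l: "is_lift f y \<tau>" and x: "x \<in> X"
  shows "birkhoff (pullback y \<tau> g) n x = birkhoff g (lift_cocycle \<tau> x n) (y x)"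
proof -
  have step: "birkhoff g (lift_cocycle \<tau> x (i + 1)) (y x) =
      birkhoff g (lift_cocycle \<tau> x i) (y x) + pullback y \<tau> g (shift_by i x)" for i
    unfolding lift_cocycle_add[OF l x] birkhoff_add pullback_def lift_cocycle(1)[OF l x] ..
  show ?thesis
  proof (induction n rule: int_induct[where k = 0])
    case base
    have "lift_cocycle \<tau> x 0 = 0" by (simp add: lift_cocycle_def)
    then show ?case by simp
  next
    case (step1 i)
    then show ?case using step[of i] birkhoff_step[of "pullback y \<tau> g" i x] by simp
  next
    case (step2 i)
    then show ?case using step[of "i - 1"] birkhoff_step[of "pullback y \<tau> g" "i - 1" x] by simp
  qed
qed

section \<open>Invariant contents\<close>

text \<open>Restricting an invariant measure to clopen sets gives such a functional; countable additivity
  plays no role in the argument.\<close>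

definition contents :: "(((int \<Rightarrow> 'a) \<Rightarrow> int) \<Rightarrow> real) set" where
  "contents = {\<phi>. (\<forall>g. \<not> locally_const X g \<longrightarrow> \<phi> g = 0) \<and>
     (\<forall>g h. locally_const X g \<longrightarrow> locally_const X h \<longrightarrow> \<phi> (\<lambda>x. g x + h x) = \<phi> g + \<phi> h) \<and>
     (\<forall>g. locally_const X g \<longrightarrow> (\<forall>x\<in>X. 0 \<le> g x) \<longrightarrow> 0 \<le> \<phi> g) \<and>
     (\<forall>g. locally_const X g \<longrightarrow> \<phi> (\<lambda>x. g (shift x)) = \<phi> g)}"

lemma content_undef: "\<phi> \<in> contents \<Longrightarrow> \<not> locally_const X g \<Longrightarrow> \<phi> g = 0"
  and content_add: "\<phi> \<in> contents \<Longrightarrow> locally_const X g \<Longrightarrow> locally_const X h \<Longrightarrow> \<phi> (\<lambda>x. g x + h x) = \<phi> g + \<phi> h"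
  and content_nonneg: "\<phi> \<in> contents \<Longrightarrow> locally_const X g \<Longrightarrow> (\<And>x. x \<in> X \<Longrightarrow> 0 \<le> g x) \<Longrightarrow> 0 \<le> \<phi> g"
  and content_shift_1: "\<phi> \<in> contents \<Longrightarrow> locally_const X g \<Longrightarrow> \<phi> (\<lambda>x. g (shift x)) = \<phi> g"
  unfolding contents_def by blast+

lemma content_zero: "\<phi> \<in> contents \<Longrightarrow> \<phi> (\<lambda>_. 0) = 0"
  using content_add[of \<phi> "\<lambda>_. 0" "\<lambda>_. 0"] by simp

lemma content_diff:
  assumes "\<phi> \<in> contents" "locally_const X g" "locally_const X h"
  shows "\<phi> (\<lambda>x. g x - h x) = \<phi> g - \<phi> h"
  using content_add[OF assms(1) locally_const_comp2[OF assms(2,3), of "(-)"] assms(3)] by simp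

lemma content_mono:
  assumes "\<phi> \<in> contents" "locally_const X g" "locally_const X h" "\<And>x. x \<in> X \<Longrightarrow> g x \<le> h x"
  shows "\<phi> g \<le> \<phi> h"
  using content_nonneg[OF assms(1) locally_const_comp2[OF assms(3,2), of "(-)"]] assms(4)
    content_diff[OF assms(1,3,2)] by simp

text \<open>Positivity is tested on X only, so a content ignores the values of a function outside X.
  This allows work with functions on the full shift in place of extensional ones.\<close>

lemma content_cong:
  assumes "\<phi> \<in> contents" "\<And>x. x \<in> X \<Longrightarrow> g x = h x"
  shows "\<phi> g = \<phi> h"
proof (cases "locally_const X g")
  case True
  then have "locally_const X h" using locally_const_cong[of X g h] assms(2) by blast
  then show ?thesis using True content_mono[OF assms(1)] assms(2) by (metis order_antisym order_refl)
next
  case False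
  then show ?thesis using locally_const_cong[of X g h] assms(2) content_undef[OF assms(1)] by metis
qed

lemma content_sum:
  assumes "\<phi> \<in> contents" "finite I" "\<And>i. i \<in> I \<Longrightarrow> locally_const X (g i)"
  shows "\<phi> (\<lambda>x. \<Sum>i\<in>I. g i x) = (\<Sum>i\<in>I. \<phi> (g i))"
  using assms(2,3)
proof (induction I rule: finite_induct)
  case (insert i I)
  have "\<phi> (\<lambda>x. g i x + (\<Sum>j\<in>I. g j x)) = \<phi> (g i) + \<phi> (\<lambda>x. \<Sum>j\<in>I. g j x)"
    using insert by (intro content_add[OF assms(1)] locally_const_sum) auto
  then show ?case using insert by simp
qed (simp add: content_zero[OF assms(1)])

lemma content_scale_nat:
  assumes "\<phi> \<in> contents" "locally_const X g"
  shows "\<phi> (\<lambda>x. int n * g x) = real n * \<phi> g"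
  using content_sum[OF assms(1), of "{..<n}" "\<lambda>_. g"] assms(2) by simp

lemma content_scale:
  assumes "\<phi> \<in> contents" "locally_const X g"
  shows "\<phi> (\<lambda>x. c * g x) = real_of_int c * \<phi> g"
proof (cases "c \<ge> 0")
  case True
  then show ?thesis using content_scale_nat[OF assms, of "nat c"] by simp
next
  case False
  define n where "n = nat (- c)"
  have c: "c = - int n" using False by (simp add: n_def)
  have "\<phi> (\<lambda>x. 0 - int n * g x) = 0 - real n * \<phi> g"
    using content_diff[OF assms(1), of "\<lambda>_. 0" "\<lambda>x. int n * g x"] content_scale_nat[OF assms]
      content_zero[OF assms(1)] locally_const_comp[OF assms(2), of "\<lambda>v. int n * v"] by simp
  then show ?thesis unfolding c by simp
qed

lemma content_shift:
  assumes "\<phi> \<in> contents" "locally_const X g"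
  shows "\<phi> (\<lambda>x. g (shift_by k x)) = \<phi> g"
proof -
  have step: "\<phi> (\<lambda>x. g (shift_by (i + 1) x)) = \<phi> (\<lambda>x. g (shift_by i x))" for i
    using content_shift_1[OF assms(1) locally_const_shift[OF assms(2), of i]]
    by (simp add: shift_by_shift_by)
  show ?thesis
  proof (induction k rule: int_induct[where k = 0])
    case (step2 i)
    then show ?case using step[of "i - 1"] by simp
  qed (simp_all add: step)
qed

lemma content_coboundary:
  assumes "\<phi> \<in> contents" "locally_const X h" "locally_const X g" "locally_const X g'"
    and "\<And>x. x \<in> X \<Longrightarrow> g' x = g x + h (shift x) - h x"
  shows "\<phi> g' = \<phi> g"
proof -
  have hs: "locally_const X (\<lambda>x. h (shift x))" by (rule locally_const_shift[OF assms(2)])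
  have d: "locally_const X (\<lambda>x. h (shift x) - h x)" by (rule locally_const_comp2[OF hs assms(2)])
  have "\<phi> g' = \<phi> (\<lambda>x. g x + (h (shift x) - h x))"
    using assms(5) by (intro content_cong[OF assms(1)]) simp
  also have "\<dots> = \<phi> g + (\<phi> (\<lambda>x. h (shift x)) - \<phi> h)"
    using content_add[OF assms(1,3) d] content_diff[OF assms(1) hs assms(2)] by simp
  finally show ?thesis using content_shift_1[OF assms(1,2)] by simp
qed

lemma content_birkhoff:
  assumes "\<phi> \<in> contents" "locally_const X g"
  shows "\<phi> (birkhoff g (int n)) = real n * \<phi> g"
proof -
  have "\<phi> (\<lambda>x. \<Sum>i\<in>{0..<int n}. g (shift_by i x)) = (\<Sum>i\<in>{0..<int n}. \<phi> g)"
    using content_sum[OF assms(1), of "{0..<int n}" "\<lambda>i x. g (shift_by i x)"]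
    by (simp add: locally_const_shift[OF assms(2)] content_shift[OF assms])
  then show ?thesis by (simp add: birkhoff_def[abs_def])
qed

text \<open>A locally constant integer function is bounded by some M, and then its value is bounded
  by M times the value at the constant 1.\<close>

lemma content_mass_zero:
  assumes \<phi>: "\<phi> \<in> contents" and 0: "\<phi> (\<lambda>_. 1) = 0"
  shows "\<phi> = (\<lambda>_. 0)"
proof
  fix g
  show "\<phi> g = 0"
  proof (cases "locally_const X g")
    case True
    obtain M where M: "\<And>x. x \<in> X \<Longrightarrow> \<bar>g x\<bar> \<le> int M" using locally_const_bounded[OF True] by blast
    have c: "\<phi> (\<lambda>_. c * 1) = 0" for c using content_scale[OF \<phi>, of "\<lambda>_. 1" c] 0 by simp
    have "\<phi> g \<le> \<phi> (\<lambda>_. int M * 1)" "\<phi> (\<lambda>_. - int M * 1) \<le> \<phi> g"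
      using M True by (intro content_mono[OF \<phi>]; fastforce simp: abs_le_iff)+
    then show ?thesis using c by simp
  qed (use content_undef[OF \<phi>] in simp)
qed

text \<open>A lift moves every orbit forward up to a bounded error, so the Birkhoff sums of a pullback
  of a nonnegative function are bounded below.\<close>

lemma content_pullback_nonneg:
  assumes l: "is_lift f y \<tau>" and \<phi>: "\<phi> \<in> contents" and g: "locally_const X g"
    and pos: "\<And>x. x \<in> X \<Longrightarrow> 0 \<le> g x"
  shows "0 \<le> \<phi> (pullback y \<tau> g)"
proof -
  obtain B where B: "\<And>x. x \<in> X \<Longrightarrow> \<bar>\<tau> x 0\<bar> \<le> real B" using lift_time_bound[OF l] by blast
  obtain M where M: "\<And>x. x \<in> X \<Longrightarrow> \<bar>g x\<bar> \<le> int M" using locally_const_bounded[OF g] by blast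
  \<comment> \<open>After N steps the image has gone back by at most 2 B steps: \<tau> x is
    increasing, and its values at time 0 are bounded by B at both ends of the orbit segment. Each
    step costs at most M.\<close>
  let ?c = "int (2 * B) * int M"
  let ?h = "pullback y \<tau> g"
  have h: "locally_const X ?h" by (rule pullback_locally_const[OF l g])
  have "- ?c \<le> birkhoff ?h (int N) x" if x: "x \<in> X" for N x
  proof -
    have "\<tau> x 0 \<le> \<tau> x (real N)" using lift_mono[OF l x] by (simp add: strict_mono_less_eq)
    moreover have "\<tau> (shift_by (int N) x) 0 = \<tau> x (real N) - real_of_int (lift_cocycle \<tau> x (int N))"
      using lift_cocycle(2)[OF l x, of "int N" "real N"] by simp
    moreover have "\<bar>\<tau> (shift_by (int N) x) 0\<bar> \<le> real B" "\<bar>\<tau> x 0\<bar> \<le> real B" using B x by auto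
    ultimately have "real_of_int (- int (2 * B)) \<le> real_of_int (lift_cocycle \<tau> x (int N))" by simp
    then have "- int (2 * B) \<le> lift_cocycle \<tau> x (int N)" by linarith
    then show ?thesis
      unfolding birkhoff_pullback[OF l x]
      using pos M by (intro birkhoff_lower_bound lift_mem[OF l x]) (auto simp: abs_le_iff)
  qed
  moreover have "locally_const X (birkhoff ?h (int N))" for N
    using locally_const_sum[of "{0..<int N}" X "\<lambda>i x. ?h (shift_by i x)"] locally_const_shift[OF h]
    by (simp add: birkhoff_def[abs_def])
  ultimately have "\<phi> (\<lambda>_. - ?c * 1) \<le> \<phi> (birkhoff ?h (int N))" for N
    by (intro content_mono[OF \<phi>]) auto
  then have ge: "- real_of_int ?c * \<phi> (\<lambda>_. 1) \<le> real N * \<phi> ?h" for N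
    using content_birkhoff[OF \<phi> h] content_scale[OF \<phi>, of "\<lambda>_. 1" "- ?c"] by simp
  \<comment> \<open>The bound on N times the value does not depend on N, which rules out a negative
    value.\<close>
  show ?thesis
  proof (rule ccontr)
    assume "\<not> 0 \<le> \<phi> ?h"
    then obtain N :: nat where "real_of_int ?c * \<phi> (\<lambda>_. 1) < real N * (- \<phi> ?h)"
      using reals_Archimedean3[of "- \<phi> ?h"] by auto
    then show False using ge[of N] by simp
  qed
qed

text \<open>Two lifts differ by a locally constant integer b, and the two pullbacks of g differ by
  the coboundary of the Birkhoff sum of g over b steps from y x.\<close>

lemma content_pullback_unique:
  assumes l: "is_lift f y \<tau>" and l': "is_lift f y' \<tau>'" and \<phi>: "\<phi> \<in> contents" and g: "locally_const X g"
  shows "\<phi> (pullback y' \<tau>' g) = \<phi> (pullback y \<tau> g)"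
proof -
  define b where "b x = \<lfloor>\<tau> x 0 - \<tau>' x 0\<rfloor>" for x
  have b: "y' x = shift_by (b x) (y x)" "\<tau> x 0 - \<tau>' (shift_by 0 x) 0 = real_of_int (b x)" if x: "x \<in> X" for x
  proof -
    have "cls (y x) (\<tau> x 0) = cls (y' x) (\<tau>' x 0)" using lift_cls[OF l x] lift_cls[OF l' x] by metis
    then obtain n where n: "y' x = shift_by n (y x)" "\<tau>' x 0 = \<tau> x 0 - real_of_int n"
      using cls_eq_iff[OF lift_mem[OF l x] lift_mem[OF l' x]] by blast
    then have "b x = n" by (simp add: b_def)
    then show "y' x = shift_by (b x) (y x)" "\<tau> x 0 - \<tau>' (shift_by 0 x) 0 = real_of_int (b x)" using n by auto
  qed
  have bl: "locally_const X b"
    using b(2) by (rule integer_step_locally_const[OF lift_jcont[OF l] lift_jcont[OF l']])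
  define h where "h x = birkhoff g (b x) (y x)" for x
  have hl: "locally_const X h" unfolding h_def by (rule birkhoff_locally_const[OF g l bl])
  show ?thesis
  proof (rule content_coboundary[OF \<phi> hl pullback_locally_const[OF l g] pullback_locally_const[OF l' g]])
    fix x assume x: "x \<in> X"
    let ?k = "lift_cocycle \<tau> x 1" and ?k' = "lift_cocycle \<tau>' x 1"
    have "shift_by (b x + ?k') (y x) = y' (shift x)"
      using lift_cocycle(1)[OF l' x, of 1] b(1)[OF x] by (simp add: shift_by_shift_by add.commute)
    also have "\<dots> = shift_by (?k + b (shift x)) (y x)"
      using lift_cocycle(1)[OF l x, of 1] b(1)[of "shift x"] x by (simp add: shift_by_shift_by add.commute)
    \<comment> \<open>The two ways around the square from y x to y' (T x) have the same length, as
      the shift acts freely.\<close>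
    finally have k: "b x + ?k' = ?k + b (shift x)" using aperiodic[OF lift_mem[OF l x]] by blast
    have "birkhoff g (b x) (y x) + birkhoff g ?k' (y' x)
        = birkhoff g ?k (y x) + birkhoff g (b (shift x)) (y (shift x))"
      unfolding b(1)[OF x] birkhoff_add[symmetric] k
      unfolding birkhoff_add lift_cocycle(1)[OF l x] ..
    then show "pullback y' \<tau>' g x = pullback y \<tau> g x + h (shift x) - h x"
      by (simp add: pullback_def h_def)
  qed
qed

section \<open>The action of homeomorphisms on contents\<close>

definition content_act :: "(((int \<Rightarrow> 'a) \<times> real) set \<Rightarrow> ((int \<Rightarrow> 'a) \<times> real) set) \<Rightarrow>
    (((int \<Rightarrow> 'a) \<Rightarrow> int) \<Rightarrow> real) \<Rightarrow> ((int \<Rightarrow> 'a) \<Rightarrow> int) \<Rightarrow> real" where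
  "content_act f \<phi> g = (if locally_const X g then
     let p = SOME p. is_lift f (fst p) (snd p) in \<phi> (pullback (fst p) (snd p) g) else 0)"

text \<open>The lift chosen in the definition may be replaced by any other one, by
  \<open>content_pullback_unique\<close>. The action is dual to the pullback of functions, hence
  covariant.\<close>

lemma content_act:
  assumes "is_lift f y \<tau>" "\<phi> \<in> contents" "locally_const X g"
  shows "content_act f \<phi> g = \<phi> (pullback y \<tau> g)"
proof -
  define p where "p = (SOME p. is_lift f (fst p) (snd p))"
  have "is_lift f (fst p) (snd p)"
    unfolding p_def using assms(1) by (intro someI[of "\<lambda>p. is_lift f (fst p) (snd p)" "(y, \<tau>)"]) simp
  then have "\<phi> (pullback (fst p) (snd p) g) = \<phi> (pullback y \<tau> g)"
    using content_pullback_unique assms by blast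
  then show ?thesis using assms(3) by (simp add: content_act_def p_def[symmetric] Let_def)
qed

lemma content_act_mem:
  assumes f: "f \<in> homeo_plus X" and \<phi>: "\<phi> \<in> contents"
  shows "content_act f \<phi> \<in> contents"
proof -
  obtain y \<tau> where l: "is_lift f y \<tau>" using lift_exists[OF f] by blast
  note act = content_act[OF l \<phi>]
  have "content_act f \<phi> (\<lambda>x. g x + h x) = content_act f \<phi> g + content_act f \<phi> h"
    if g: "locally_const X g" and h: "locally_const X h" for g h
  proof -
    have "pullback y \<tau> (\<lambda>x. g x + h x) = (\<lambda>x. pullback y \<tau> g x + pullback y \<tau> h x)"
      by (simp add: pullback_def birkhoff_sum fun_eq_iff)
    then show ?thesis
      using act g h locally_const_comp2[OF g h, of "(+)"]
        content_add[OF \<phi> pullback_locally_const[OF l g] pullback_locally_const[OF l h]] by simp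
  qed
  moreover have "0 \<le> content_act f \<phi> g" if "locally_const X g" "\<forall>x\<in>X. 0 \<le> g x" for g
    using act that content_pullback_nonneg[OF l \<phi>] by simp
  moreover have "content_act f \<phi> (\<lambda>x. g (shift x)) = content_act f \<phi> g" if g: "locally_const X g" for g
  proof -
    have gs: "locally_const X (\<lambda>x. g (shift x))" by (rule locally_const_shift[OF g])
    \<comment> \<open>The pullbacks of g \<circ> T and of g differ by the coboundary of g \<circ> y,
      since the Birkhoff sum of g \<circ> T - g telescopes.\<close>
    have "\<phi> (pullback y \<tau> (\<lambda>x. g (shift x))) = \<phi> (pullback y \<tau> g)"
    proof (rule content_coboundary[OF \<phi> locally_const_lift[OF l g] pullback_locally_const[OF l g]
          pullback_locally_const[OF l gs]])
      fix x assume "x \<in> X"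
      then show "pullback y \<tau> (\<lambda>x. g (shift x)) x = pullback y \<tau> g x + g (y (shift x)) - g (y x)"
        using lift_cocycle(1)[OF l, of x 1] by (simp add: pullback_def birkhoff_shift)
    qed
    then show ?thesis using act[OF g] act[OF gs] by simp
  qed
  ultimately show ?thesis unfolding contents_def by (simp add: content_act_def)
qed

lemma is_lift_id: "is_lift (\<lambda>c\<in>suspension X. c) (\<lambda>x. x) (\<lambda>_ t. t)"
  unfolding is_lift_def jointly_continuous_def by (auto simp: strict_mono_def)

lemma is_lift_compose:
  assumes f: "is_lift f y \<tau>" and g: "is_lift g z \<sigma>"
  shows "is_lift (compose (suspension X) f g) (\<lambda>x. y (z x)) (\<lambda>x t. \<tau> (z x) (\<sigma> x t))"
  unfolding is_lift_def
proof (intro conjI ballI allI)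
  fix x assume x: "x \<in> X"
  show "y (z x) \<in> X" using lift_mem[OF f] lift_mem[OF g] x by blast
  show "\<exists>n. \<forall>x'\<in>X. agree n x x' \<longrightarrow> agree m (y (z x)) (y (z x'))" for m
  proof -
    obtain n1 where n1: "\<forall>x'\<in>X. agree n1 (z x) x' \<longrightarrow> agree m (y (z x)) (y x')"
      using lift_cont[OF f lift_mem[OF g x]] by blast
    obtain n2 where "\<forall>x'\<in>X. agree n2 x x' \<longrightarrow> agree n1 (z x) (z x')" using lift_cont[OF g x] by blast
    then show ?thesis using n1 lift_mem[OF g] by blast
  qed
  show "strict_mono (\<lambda>t. \<tau> (z x) (\<sigma> x t))"
    using lift_mono[OF f lift_mem[OF g x]] lift_mono[OF g x] by (simp add: strict_mono_def)
  show "range (\<lambda>t. \<tau> (z x) (\<sigma> x t)) = UNIV"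
    using lift_surj[OF f lift_mem[OF g x]] lift_surj[OF g x] by (metis image_image)
  show "compose (suspension X) f g (cls x t) = cls (y (z x)) (\<tau> (z x) (\<sigma> x t))" for t
    using lift_cls[OF f lift_mem[OF g x]] lift_cls[OF g x] x by (simp add: compose_eq)
next
  show "jointly_continuous (\<lambda>x t. \<tau> (z x) (\<sigma> x t))"
    unfolding jointly_continuous_def
  proof (intro ballI allI impI)
    fix x t and e :: real assume x: "x \<in> X" and e: "e > 0"
    obtain n d where d: "d > 0"
        "\<forall>x'\<in>X. \<forall>s. agree n (z x) x' \<and> \<bar>s - \<sigma> x t\<bar> < d \<longrightarrow> \<bar>\<tau> x' s - \<tau> (z x) (\<sigma> x t)\<bar> < e"
      using jointly_continuousD[OF lift_jcont[OF f] lift_mem[OF g x] e] by blast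
    obtain n1 d1 where d1: "d1 > 0" "\<forall>x'\<in>X. \<forall>s. agree n1 x x' \<and> \<bar>s - t\<bar> < d1 \<longrightarrow> \<bar>\<sigma> x' s - \<sigma> x t\<bar> < d"
      using jointly_continuousD[OF lift_jcont[OF g] x d(1)] by blast
    obtain n2 where n2: "\<forall>x'\<in>X. agree n2 x x' \<longrightarrow> agree n (z x) (z x')" using lift_cont[OF g x] by blast
    have "\<bar>\<tau> (z x') (\<sigma> x' s) - \<tau> (z x) (\<sigma> x t)\<bar> < e" if x': "x' \<in> X" "agree (max n1 n2) x x'" "\<bar>s - t\<bar> < d1" for x' s
    proof -
      have "agree n1 x x'" "agree n2 x x'" using agree_mono[OF x'(2)] by auto
      then show ?thesis using d(2) d1(2) n2 x' lift_mem[OF g x'(1)] by blast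
    qed
    then show "\<exists>n. \<exists>d>0. \<forall>x'\<in>X. \<forall>s. agree n x x' \<and> \<bar>s - t\<bar> < d \<longrightarrow>
        \<bar>\<tau> (z x') (\<sigma> x' s) - \<tau> (z x) (\<sigma> x t)\<bar> < e" using d1(1) by blast
  qed
qed

lemma content_act_id:
  assumes "\<phi> \<in> contents"
  shows "content_act (\<lambda>c\<in>suspension X. c) \<phi> = \<phi>"
proof
  fix g
  have "pullback (\<lambda>x. x) (\<lambda>_ t. t) g = g"
    by (simp add: pullback_def lift_cocycle_def fun_eq_iff)
  then show "content_act (\<lambda>c\<in>suspension X. c) \<phi> g = \<phi> g"
    using content_act[OF is_lift_id assms] content_undef[OF assms]
    by (cases "locally_const X g") (auto simp: content_act_def)
qed

text \<open>The cocycle of a composite is the cocycle of the outer map over the number of steps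
  given by the inner one, so on the level of functions the claim is the chain rule
  \<open>birkhoff_pullback\<close>.\<close>

lemma content_act_compose:
  assumes f: "f \<in> homeo_plus X" and g: "g \<in> homeo_plus X" and \<phi>: "\<phi> \<in> contents"
  shows "content_act (compose (suspension X) f g) \<phi> = content_act f (content_act g \<phi>)"
proof
  fix u
  obtain y \<tau> where l: "is_lift f y \<tau>" using lift_exists[OF f] by blast
  obtain z \<sigma> where k: "is_lift g z \<sigma>" using lift_exists[OF g] by blast
  note fg = is_lift_compose[OF l k]
  show "content_act (compose (suspension X) f g) \<phi> u = content_act f (content_act g \<phi>) u"
  proof (cases "locally_const X u")
    case True
    have "pullback (\<lambda>x. y (z x)) (\<lambda>x t. \<tau> (z x) (\<sigma> x t)) u x = pullback z \<sigma> (pullback y \<tau> u) x" if x: "x \<in> X" for x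
    proof -
      let ?k = "lift_cocycle (\<lambda>x t. \<tau> (z x) (\<sigma> x t)) x 1" and ?m = "lift_cocycle \<sigma> x 1"
      have "shift_by ?k (y (z x)) = y (z (shift x))" using lift_cocycle(1)[OF fg x, of 1] by simp
      also have "\<dots> = shift_by (lift_cocycle \<tau> (z x) ?m) (y (z x))"
        using lift_cocycle(1)[OF k x, of 1] lift_cocycle(1)[OF l lift_mem[OF k x], of ?m] by simp
      finally have "?k = lift_cocycle \<tau> (z x) ?m" using aperiodic lift_mem[OF fg x] by blast
      then show ?thesis
        using birkhoff_pullback[OF l lift_mem[OF k x]] by (simp add: pullback_def)
    qed
    then have "\<phi> (pullback (\<lambda>x. y (z x)) (\<lambda>x t. \<tau> (z x) (\<sigma> x t)) u) = \<phi> (pullback z \<sigma> (pullback y \<tau> u))"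
      by (rule content_cong[OF \<phi>])
    then show ?thesis
      unfolding content_act[OF fg \<phi> True] content_act[OF l content_act_mem[OF g \<phi>] True]
        content_act[OF k \<phi> pullback_locally_const[OF l True]] .
  qed (simp add: content_act_def)
qed

end

section \<open>Right special words\<close>

definition word :: "(int \<Rightarrow> 'a) \<Rightarrow> nat \<Rightarrow> 'a list" where
  "word x n = map (\<lambda>j. x (int j)) [0..<n]"

lemma word_eq_iff: "word x n = word y n \<longleftrightarrow> (\<forall>j<n. x (int j) = y (int j))"
  by (auto simp: word_def)

lemma word_Suc: "word x (Suc n) = word x n @ [x (int n)]"
  by (simp add: word_def)

definition right_special :: "(int \<Rightarrow> 'a) set \<Rightarrow> nat \<Rightarrow> 'a list set" where
  "right_special X n = {word x n |x. x \<in> X \<and> (\<exists>y\<in>X. word y n = word x n \<and> y (int n) \<noteq> x (int n))}"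

lemma finite_words: "finite ((\<lambda>x :: int \<Rightarrow> 'a::finite. word x n) ` X)"
proof (rule finite_subset)
  show "(\<lambda>x. word x n) ` X \<subseteq> {xs. set xs \<subseteq> UNIV \<and> length xs = n}" by (auto simp: word_def)
  show "finite {xs :: 'a list. set xs \<subseteq> UNIV \<and> length xs = n}" by (rule finite_lists_length_eq) simp
qed

lemma finite_right_special: "finite (right_special (X :: (int \<Rightarrow> 'a::finite) set) n)"
  by (rule finite_subset[OF _ finite_words[of n X]]) (auto simp: right_special_def)

context minimal_infinite_subshift
begin

lemma words_eq: "words X n = (\<lambda>x. word x n) ` X"
proof (intro Set.set_eqI iffI)
  fix w assume "w \<in> words X n"
  then obtain x i where x: "x \<in> X" "w = map (\<lambda>j. x (i + int j)) [0..<n]" by (auto simp: words_def)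
  then have "w = word (shift_by i x) n" by (simp add: word_def shift_by_apply add.commute)
  then show "w \<in> (\<lambda>x. word x n) ` X" using x(1) by auto
next
  fix w assume "w \<in> (\<lambda>x. word x n) ` X"
  then obtain x where "x \<in> X" "w = map (\<lambda>j. x (0 + int j)) [0..<n]" by (auto simp: word_def)
  then show "w \<in> words X n" unfolding words_def by blast
qed

text \<open>Every word of length n gets one chosen extension, given by \<open>p\<close>, and every
  right special word a second one with another last letter, given by \<open>q\<close>.\<close>

lemma card_right_special: "complexity X n + card (right_special X n) \<le> complexity X (Suc n)"
proof -
  define W where "W = (\<lambda>x. word x n) ` X"
  define p where "p w = (SOME x. x \<in> X \<and> word x n = w)" for w
  have p: "p w \<in> X" "word (p w) n = w" if "w \<in> W" for w
  proof -
    have "\<exists>x. x \<in> X \<and> word x n = w" using that by (auto simp: W_def)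
    then have "p w \<in> X \<and> word (p w) n = w" unfolding p_def by (rule someI_ex)
    then show "p w \<in> X" "word (p w) n = w" by auto
  qed
  define q where "q w = (SOME x. x \<in> X \<and> word x n = w \<and> x (int n) \<noteq> p w (int n))" for w
  have q: "q w \<in> X" "word (q w) n = w" "q w (int n) \<noteq> p w (int n)" if "w \<in> right_special X n" for w
  proof -
    have "\<exists>x. x \<in> X \<and> word x n = w \<and> x (int n) \<noteq> p w (int n)"
      using that unfolding right_special_def by (smt (verit) mem_Collect_eq)
    then have "q w \<in> X \<and> word (q w) n = w \<and> q w (int n) \<noteq> p w (int n)" unfolding q_def by (rule someI_ex)
    then show "q w \<in> X" "word (q w) n = w" "q w (int n) \<noteq> p w (int n)" by auto
  qed
  have RW: "right_special X n \<subseteq> W" by (auto simp: right_special_def W_def)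
  define A where "A = (\<lambda>w. word (p w) (Suc n)) ` W"
  define B where "B = (\<lambda>w. word (q w) (Suc n)) ` right_special X n"
  have cA: "card A = card W"
    unfolding A_def by (rule card_image) (rule inj_onI, use p in \<open>simp add: word_Suc\<close>)
  have cB: "card B = card (right_special X n)"
    unfolding B_def by (rule card_image) (rule inj_onI, use q in \<open>simp add: word_Suc\<close>)
  have disj: "A \<inter> B = {}"
  proof (rule ccontr)
    assume "A \<inter> B \<noteq> {}"
    then obtain u v where uv: "u \<in> W" "v \<in> right_special X n" "word (p u) (Suc n) = word (q v) (Suc n)"
      by (auto simp: A_def B_def)
    then have "u = v" using p[of u] q[of v] by (simp add: word_Suc)
    then show False using uv q(3)[of v] by (simp add: word_Suc)
  qed
  have sub: "A \<union> B \<subseteq> (\<lambda>x. word x (Suc n)) ` X"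
    using p(1) q(1) by (auto simp: A_def B_def)
  have fin: "finite A" "finite B"
    using finite_subset[OF sub finite_words] by auto
  have "card W + card (right_special X n) = card (A \<union> B)"
    using cA cB disj fin by (simp add: card_Un_disjoint)
  also have "\<dots> \<le> card ((\<lambda>x. word x (Suc n)) ` X)" by (rule card_mono[OF finite_words sub])
  finally show ?thesis by (simp add: complexity_def words_eq W_def)
qed

text \<open>If from some N on there were always at least C + 1 right special words, the complexity
  would grow with slope C + 1 from N on, and the quotient P(n) / n would eventually be at least
  C.\<close>

lemma frequently_few_right_special:
  assumes "liminf (\<lambda>n. ereal (real (complexity X n) / real n)) < \<infinity>"
  obtains C where "\<And>N. \<exists>n\<ge>N. card (right_special X n) \<le> C"
proof -
  obtain c where c: "liminf (\<lambda>n. ereal (real (complexity X n) / real n)) < ereal c"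
    using assms less_PInf_Ex_of_nat by (metis ereal_dense2)
  define C where "C = nat \<lceil>c\<rceil> + 1"
  have "\<exists>n\<ge>N. card (right_special X n) \<le> C" for N
  proof (rule ccontr)
    assume none: "\<nexists>n. n \<ge> N \<and> card (right_special X n) \<le> C"
    have big: "C + 1 \<le> card (right_special X n)" if "n \<ge> N" for n
    proof -
      have "\<not> card (right_special X n) \<le> C" using none that by blast
      then show ?thesis by simp
    qed
    have grow: "k * (C + 1) \<le> complexity X (N + k)" for k
    proof (induction k)
      case (Suc k)
      then show ?case using card_right_special[of "N + k"] big[of "N + k"] by simp
    qed simp
    have "eventually (\<lambda>n. ereal c \<le> ereal (real (complexity X n) / real n)) sequentially"
      unfolding eventually_sequentially
    proof (intro exI allI impI)
      \<comment> \<open>From this bound on, the surplus of slope C + 1 over slope C makes up for the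
        N initial lengths without any growth.\<close>
      fix n assume n: "n \<ge> N * (C + 1) + 1"
      define k where "k = n - N"
      have "N \<le> n" using n by (simp add: algebra_simps)
      then have nk: "n = N + k" by (simp add: k_def)
      have "n * C \<le> k * (C + 1)" using n nk by (simp add: algebra_simps)
      also have "\<dots> \<le> complexity X n" using grow[of k] nk by simp
      finally have "real n * real C \<le> real (complexity X n)" by (metis of_nat_le_iff of_nat_mult)
      moreover have "c \<le> real C" unfolding C_def by linarith
      moreover have n0: "real n > 0" using n by simp
      ultimately have "c * real n \<le> real (complexity X n)"
        by (smt (verit) mult.commute mult_left_mono)
      then show "ereal c \<le> ereal (real (complexity X n) / real n)" using n0 by (simp add: pos_le_divide_eq)
    qed
    then have "ereal c \<le> liminf (\<lambda>n. ereal (real (complexity X n) / real n))" by (rule Liminf_bounded)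
    then show False using c by simp
  qed
  then show ?thesis by (rule that)
qed

text \<open>Otherwise each word of length n determines the next letter. Some word occurs at two
  places of x, and from there on x would be periodic.\<close>

lemma right_special_nonempty: "right_special X n \<noteq> {}"
proof
  assume none: "right_special X n = {}"
  have det: "y (int n) = x (int n)" if "x \<in> X" "y \<in> X" "word y n = word x n" for x y
    using none that unfolding right_special_def by blast
  obtain x where x: "x \<in> X" using infinite_X by fastforce
  let ?w = "\<lambda>j::nat. word (shift_by (int j) x) n"
  have "range ?w \<subseteq> (\<lambda>x. word x n) ` X" using x by auto
  then have "finite (range ?w)" using finite_words finite_subset by blast
  then have "\<not> inj ?w" using finite_imageD infinite_UNIV_nat by blast
  then obtain i' j' where ij': "i' \<noteq> j'" "?w i' = ?w j'" by (auto simp: inj_on_def)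
  obtain i j where ij: "i < j" "?w i = ?w j"
  proof (cases "i' < j'")
    case False
    then show ?thesis using ij' by (intro that[of j' i']) auto
  qed (use ij' that in blast)
  have same: "word (shift_by (int i + int l) x) n = word (shift_by (int j + int l) x) n" for l
  proof (induction l)
    case (Suc l)
    let ?u = "shift_by (int i + int l) x" and ?v = "shift_by (int j + int l) x"
    have "?v (int n) = ?u (int n)" using Suc x by (intro det) auto
    then have "word ?u (Suc n) = word ?v (Suc n)" using Suc by (simp add: word_Suc)
    then have *: "?u (int m) = ?v (int m)" if "m \<le> n" for m using that unfolding word_eq_iff by (simp add: less_Suc_eq_le)
    show ?case
      unfolding word_eq_iff
    proof (intro allI impI)
      fix m assume "m < n"
      then show "shift_by (int i + int (Suc l)) x (int m) = shift_by (int j + int (Suc l)) x (int m)"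
        using *[of "Suc m"] by (simp add: shift_by_apply algebra_simps)
    qed
  qed (use ij in simp)
  show False
  proof (rule not_right_periodic[OF x, of "int j - int i" "int i + int n"])
    show "int j - int i > 0" using ij(1) by simp
    fix m assume m: "int i + int n \<le> m"
    define l where "l = nat (m - int i - int n)"
    have "shift_by (int j + int l) x (int n) = shift_by (int i + int l) x (int n)"
      using same[of l] x by (intro det) auto
    then show "x (m + (int j - int i)) = x m" using m by (simp add: l_def shift_by_apply algebra_simps)
  qed
qed

section \<open>Left tails\<close>

definition left_tail :: "(int \<Rightarrow> 'a) \<Rightarrow> (int \<Rightarrow> 'a) \<Rightarrow> bool" where
  "left_tail x y \<longleftrightarrow> (\<exists>k m. \<forall>i\<le>m. x i = y (i + k))"

lemma left_tail_refl [simp]: "left_tail x x"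
  unfolding left_tail_def by (intro exI[of _ 0]) simp

lemma left_tail_shift [simp]: "left_tail x (shift_by n x)"
  unfolding left_tail_def by (intro exI[of _ "- n"]) (simp add: shift_by_apply)

lemma left_tail_sym:
  assumes "left_tail x y"
  shows "left_tail y x"
proof -
  obtain k m where "\<And>i. i \<le> m \<Longrightarrow> x i = y (i + k)" using assms unfolding left_tail_def by blast
  then have "\<forall>i\<le>m + k. y i = x (i + - k)" by simp
  then show ?thesis unfolding left_tail_def by blast
qed

lemma left_tail_trans:
  assumes "left_tail x y" "left_tail y z"
  shows "left_tail x z"
proof -
  obtain k m where k: "\<And>i. i \<le> m \<Longrightarrow> x i = y (i + k)" using assms(1) unfolding left_tail_def by blast
  obtain l n where l: "\<And>i. i \<le> n \<Longrightarrow> y i = z (i + l)" using assms(2) unfolding left_tail_def by blast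
  have "\<forall>i\<le>min m (n - k). x i = z (i + (k + l))" using k l by (simp add: add.assoc)
  then show ?thesis unfolding left_tail_def by blast
qed

text \<open>Realised as a set of points of the suspension, so that homeomorphisms act by direct
  image without reference to lifts.\<close>

definition tail_class :: "(int \<Rightarrow> 'a) \<Rightarrow> ((int \<Rightarrow> 'a) \<times> real) set set" where
  "tail_class x = {cls y s |y s. y \<in> X \<and> left_tail x y}"

lemma cls_in_tail_class:
  assumes "y \<in> X"
  shows "cls y s \<in> tail_class x \<longleftrightarrow> left_tail x y"
proof
  assume "cls y s \<in> tail_class x"
  then obtain z r where z: "cls y s = cls z r" "z \<in> X" "left_tail x z" by (auto simp: tail_class_def)
  then obtain n where "z = shift_by n y" using cls_eq_iff[OF assms] by blast
  then have "left_tail z y" using left_tail_sym[OF left_tail_shift] by simp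
  then show "left_tail x y" using z(3) left_tail_trans by blast
qed (use assms in \<open>auto simp: tail_class_def\<close>)

lemma tail_class_eq_iff:
  assumes "x \<in> X" "y \<in> X"
  shows "tail_class x = tail_class y \<longleftrightarrow> left_tail x y"
proof
  assume "tail_class x = tail_class y"
  moreover have "cls y 0 \<in> tail_class y" using assms by (simp add: cls_in_tail_class)
  ultimately show "left_tail x y" using assms by (metis cls_in_tail_class)
next
  assume "left_tail x y"
  then have "left_tail x z \<longleftrightarrow> left_tail y z" for z using left_tail_sym left_tail_trans by blast
  then show "tail_class x = tail_class y" by (simp add: tail_class_def)
qed

text \<open>The first disagreement is normalised to coordinate 0, so that for every n the word of
  length n just before the origin is right special.\<close>

definition branching :: "(int \<Rightarrow> 'a) \<Rightarrow> bool" where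
  "branching x \<longleftrightarrow> x \<in> X \<and> (\<exists>y\<in>X. (\<forall>i<0. x i = y i) \<and> x 0 \<noteq> y 0)"

definition special_tails :: "((int \<Rightarrow> 'a) \<times> real) set set set" where
  "special_tails = tail_class ` {x. branching x}"

text \<open>The right-hand side, that the class contains a second orbit, no longer mentions
  coordinates; this is the form that homeomorphisms visibly preserve. In one direction a partner in
  the same orbit would make the branching point periodic to the left; in the other one aligns the
  two points and moves their first disagreement to 0.\<close>

lemma special_tails_iff:
  assumes x: "x \<in> X"
  shows "tail_class x \<in> special_tails \<longleftrightarrow> (\<exists>y\<in>X. left_tail x y \<and> (\<forall>n. y \<noteq> shift_by n x))"
proof
  assume "tail_class x \<in> special_tails"
  then obtain b where b: "branching b" "tail_class x = tail_class b" by (auto simp: special_tails_def)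
  then obtain y where y: "b \<in> X" "y \<in> X" "\<And>i. i < 0 \<Longrightarrow> b i = y i" "b 0 \<noteq> y 0" by (auto simp: branching_def)
  have "left_tail b y" unfolding left_tail_def using y(3) by (intro exI[of _ 0] exI[of _ "-1"]) simp
  have xb: "left_tail x b" using b(2) tail_class_eq_iff[OF x y(1)] by simp
  have nb: "y \<noteq> shift_by n b" for n
  proof
    assume n: "y = shift_by n b"
    then have per: "b i = b (i + n)" if "i < 0" for i using y(3)[OF that] by (simp add: shift_by_apply)
    consider "n = 0" | "n > 0" | "n < 0" by linarith
    then show False
    proof cases
      case 1
      then show ?thesis using n y(4) by simp
    next
      case 2
      then show ?thesis using not_left_periodic[OF y(1), of n "-1"] per by force
    next
      case 3
      show ?thesis
      proof (rule not_left_periodic[OF y(1), of "- n" "n - 1"])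
        fix i assume "i \<le> n - 1"
        then show "b (i + - n) = b i" using per[of "i - n"] by simp
      qed (use 3 in simp)
    qed
  qed
  \<comment> \<open>If the branching point b lies in the orbit of x, its partner y does not;
    otherwise b itself is the second orbit.\<close>
  show "\<exists>y\<in>X. left_tail x y \<and> (\<forall>n. y \<noteq> shift_by n x)"
  proof (cases "\<exists>n. b = shift_by n x")
    case True
    then obtain n where n: "b = shift_by n x" by blast
    have "y \<noteq> shift_by k x" for k using nb[of "k - n"] n by (simp add: shift_by_shift_by)
    moreover have "left_tail x y" using xb \<open>left_tail b y\<close> left_tail_trans by blast
    ultimately show ?thesis using y(2) by blast
  qed (use xb y(1) in blast)
next
  assume "\<exists>y\<in>X. left_tail x y \<and> (\<forall>n. y \<noteq> shift_by n x)"
  then obtain y k m where y: "y \<in> X" "\<And>n. y \<noteq> shift_by n x" "\<And>i. i \<le> m \<Longrightarrow> x i = y (i + k)"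
    unfolding left_tail_def by blast
  define z where "z = shift_by k y"
  have z: "z \<in> X" "\<And>i. i \<le> m \<Longrightarrow> x i = z i" using y by (auto simp: z_def shift_by_apply)
  have "x \<noteq> z" using y(2)[of "- k"] by (auto simp: z_def shift_by_shift_by)
  then obtain i where i: "x i \<noteq> z i" by blast
  define l where "l = (LEAST l::nat. x (m + int l) \<noteq> z (m + int l))"
  have "i > m" using i z(2)[of i] by linarith
  then have "x (m + int (nat (i - m))) \<noteq> z (m + int (nat (i - m)))" using i by simp
  then have l: "x (m + int l) \<noteq> z (m + int l)" unfolding l_def by (rule LeastI)
  have before: "x j = z j" if "j < m + int l" for j
  proof (cases "j \<le> m")
    case False
    then have "nat (j - m) < l" using that by simp
    then have "\<not> x (m + int (nat (j - m))) \<noteq> z (m + int (nat (j - m)))" unfolding l_def by (rule not_less_Least)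
    then show ?thesis using False by simp
  qed (use z(2) in blast)
  let ?b = "shift_by (m + int l) x"
  have "branching ?b"
    unfolding branching_def
  proof (intro conjI bexI[of _ "shift_by (m + int l) z"])
    show "?b \<in> X" "shift_by (m + int l) z \<in> X" using x z(1) by auto
    show "\<forall>i<0. ?b i = shift_by (m + int l) z i" using before by (simp add: shift_by_apply)
    show "?b 0 \<noteq> shift_by (m + int l) z 0" using l by (simp add: shift_by_apply)
  qed
  moreover have "tail_class x = tail_class ?b" using x by (subst tail_class_eq_iff) auto
  ultimately show "tail_class x \<in> special_tails" by (auto simp: special_tails_def)
qed

text \<open>Right special words give pairs that agree on n places before the origin and differ at
  it. Compactness is used twice: for a point x having such a partner for every n, and then for one
  partner of x that works for all n at once.\<close>

lemma special_tails_nonempty: "special_tails \<noteq> {}"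
proof -
  define D where "D n x \<longleftrightarrow> (\<exists>y\<in>X. (\<forall>i. - int n \<le> i \<and> i < 0 \<longrightarrow> x i = y i) \<and> x 0 \<noteq> y 0)" for n x
  have ex: "\<exists>x\<in>X. D n x" for n
  proof -
    obtain x y where xy: "x \<in> X" "y \<in> X" "word y n = word x n" "y (int n) \<noteq> x (int n)"
      using right_special_nonempty[of n] unfolding right_special_def by blast
    have "shift_by (int n) x i = shift_by (int n) y i" if "- int n \<le> i" "i < 0" for i
    proof -
      have "nat (i + int n) < n" using that by linarith
      then have "y (int (nat (i + int n))) = x (int (nat (i + int n)))" using xy(3) unfolding word_eq_iff by blast
      then show ?thesis using that by (simp add: shift_by_apply)
    qed
    then have "D n (shift_by (int n) x)"
      unfolding D_def using xy by (intro bexI[of _ "shift_by (int n) y"]) (auto simp: shift_by_apply)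
    then show ?thesis using xy(1) shift_mem by blast
  qed
  have mono: "\<not> D m' x" if m: "m \<le> m'" "\<not> D m x" for m m' x
  proof -
    have "- int m' \<le> i" if "- int m \<le> i" for i using that m(1) by linarith
    then show ?thesis using m(2) unfolding D_def by blast
  qed
  have "\<exists>x\<in>X. \<forall>n. D n x"
  proof (rule ccontr)
    assume *: "\<not> (\<exists>x\<in>X. \<forall>n. D n x)"
    obtain m where "\<And>x. x \<in> X \<Longrightarrow> \<not> D m x"
    proof (rule compact_uniform[where Q = "\<lambda>m x. \<not> D m x"])
      fix x assume "x \<in> X"
      then obtain m where m: "\<not> D m x" using * by blast
      have "\<not> D m y" if "agree m x y" for y
      proof -
        have "x i = y i" if "- int m \<le> i" "i \<le> 0" for i using agreeD[OF \<open>agree m x y\<close>, of i] that by simp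
        then have "D m y \<longleftrightarrow> D m x" unfolding D_def by (simp add: order_less_imp_le)
        then show ?thesis using m by simp
      qed
      then show "\<exists>m n. \<forall>y\<in>X. agree n x y \<longrightarrow> \<not> D m y" by blast
    qed (use mono in blast)+
    then show False using ex by blast
  qed
  then obtain x where x: "x \<in> X" "\<And>n. D n x" by blast
  have "\<exists>y\<in>X. x 0 \<noteq> y 0 \<and> (\<forall>i<0. x i = y i)"
  proof (rule ccontr)
    assume *: "\<not> (\<exists>y\<in>X. x 0 \<noteq> y 0 \<and> (\<forall>i<0. x i = y i))"
    define Q where "Q m y \<longleftrightarrow> x 0 = y 0 \<or> (\<exists>i. - int m \<le> i \<and> i < 0 \<and> x i \<noteq> y i)" for m y
    obtain m where "\<And>y. y \<in> X \<Longrightarrow> Q m y"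
    proof (rule compact_uniform[of Q])
      fix y assume y: "y \<in> X"
      obtain m where m: "Q m y"
      proof (cases "x 0 = y 0")
        case False
        then obtain i where "i < 0" "x i \<noteq> y i" using * y by blast
        then have "Q (nat (- i)) y" unfolding Q_def by (intro disjI2 exI[of _ i]) simp
        then show ?thesis by (rule that)
      qed (use that in \<open>auto simp: Q_def\<close>)
      have "Q m z" if "agree m y z" for z
      proof -
        have "y i = z i" if "- int m \<le> i" "i \<le> 0" for i using agreeD[OF \<open>agree m y z\<close>, of i] that by simp
        then show ?thesis using m unfolding Q_def by (metis (no_types, lifting) neg_le_0_iff_le of_nat_0_le_iff order_less_imp_le order_refl)
      qed
      then show "\<exists>m n. \<forall>z\<in>X. agree n y z \<longrightarrow> Q m z" by blast
    next
      fix m m' :: nat and y assume "m \<le> m'" "Q m y"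
      moreover have "- int m' \<le> i" if "- int m \<le> i" for i using that \<open>m \<le> m'\<close> by linarith
      ultimately show "Q m' y" unfolding Q_def by blast
    qed blast
    then show False using x(2)[of m] unfolding D_def Q_def by blast
  qed
  then have "branching x" using x(1) by (auto simp: branching_def)
  then show ?thesis by (auto simp: special_tails_def)
qed

text \<open>After alignment x and z agree on the left. Far to the left they have the same local
  windows, so the two cocycles have equal increments there and differ by a constant d, and y x and y
  z have equal windows around corresponding positions. These windows cover a whole left
  half-line.\<close>

lemma lift_left_tail:
  assumes l: "is_lift f y \<tau>" and x: "x \<in> X" and u: "u \<in> X" and xu: "left_tail x u"
  shows "left_tail (y x) (y u)"
proof -
  obtain k n0 where k: "\<And>i. i \<le> n0 \<Longrightarrow> x i = u (i + k)" using xu unfolding left_tail_def by blast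
  define z where "z = shift_by k u"
  have z: "z \<in> X" "\<And>i. i \<le> n0 \<Longrightarrow> x i = z i" using u k by (auto simp: z_def shift_by_apply)
  have zu: "left_tail (y z) (y u)"
    using lift_cocycle(1)[OF l u, of k] left_tail_sym[OF left_tail_shift] by (simp add: z_def)
  let ?c = "\<lambda>x. lift_cocycle \<tau> x 1"
  have cl: "locally_const X ?c" by (rule lift_cocycle_locally_const[OF l])
  obtain M where M: "\<And>x. x \<in> X \<Longrightarrow> \<bar>?c x\<bar> \<le> int M" using locally_const_bounded[OF cl] by blast
  obtain R1 where R1: "\<And>x x'. x \<in> X \<Longrightarrow> x' \<in> X \<Longrightarrow> agree R1 x x' \<Longrightarrow> ?c x = ?c x'"
    using locally_const_uniform[OF cl] by blast
  \<comment> \<open>The radius M bounds the steps of the cocycle, so the windows around consecutive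
    positions \<open>a j\<close> leave no gap.\<close>
  let ?win = "\<lambda>x. restrict (y x) {- int M..int M}"
  have "locally_const X ?win"
    unfolding locally_const_def
  proof
    fix x assume "x \<in> X"
    then obtain n where "\<forall>x'\<in>X. agree n x x' \<longrightarrow> agree M (y x) (y x')" using lift_cont[OF l] by blast
    then have "\<forall>x'\<in>X. agree n x x' \<longrightarrow> ?win x' = ?win x"
      unfolding agree_def[of M] fun_eq_iff restrict_def by (simp add: abs_le_iff)
    then show "\<exists>n. \<forall>x'\<in>X. agree n x x' \<longrightarrow> ?win x' = ?win x" by blast
  qed
  then obtain R2 where R2: "\<And>x x'. x \<in> X \<Longrightarrow> x' \<in> X \<Longrightarrow> agree R2 x x' \<Longrightarrow> ?win x = ?win x'"
    using locally_const_uniform by blast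
  define J where "J = n0 - int (max R1 R2)"
  have ag: "agree R1 (shift_by j x) (shift_by j z)" "agree R2 (shift_by j x) (shift_by j z)" if "j \<le> J" for j
    using that z(2) by (auto simp: agree_def shift_by_apply J_def)
  define a where "a j = lift_cocycle \<tau> x j" for j
  define b where "b j = lift_cocycle \<tau> z j" for j
  have a1: "a (j + 1) = a j + ?c (shift_by j x)" for j unfolding a_def by (rule lift_cocycle_add[OF l x])
  have b1: "b (j + 1) = b j + ?c (shift_by j z)" for j unfolding b_def by (rule lift_cocycle_add[OF l z(1)])
  have cc: "?c (shift_by j x) = ?c (shift_by j z)" if "j \<le> J" for j
    using R1 ag(1)[OF that] x z(1) by simp
  define d where "d = a J - b J"
  have "a (J - int i) - b (J - int i) = d" for i
  proof (induction i)
    case (Suc i)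
    have "a (J - int (Suc i) + 1) - b (J - int (Suc i) + 1) = a (J - int (Suc i)) - b (J - int (Suc i))"
      unfolding a1 b1 using cc[of "J - int (Suc i)"] by simp
    then show ?case using Suc by (simp add: algebra_simps)
  qed (simp add: d_def)
  then have ab: "b j = a j - d" if "j \<le> J" for j
    using that spec[of "\<lambda>i. a (J - int i) - b (J - int i) = d" "nat (J - j)"] by simp
  have win: "y x (i + a j) = y z (i + a j - d)" if "j \<le> J" "\<bar>i\<bar> \<le> int M" for i j
  proof -
    have "?win (shift_by j x) = ?win (shift_by j z)"
      by (rule R2) (use ag(2)[OF that(1)] x z(1) in simp_all)
    then have "?win (shift_by j x) i = ?win (shift_by j z) i" by (rule fun_cong)
    then have "y (shift_by j x) i = y (shift_by j z) i" using that(2) by (simp add: abs_le_iff)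
    then have "y x (i + a j) = y z (i + b j)"
      using lift_cocycle(1)[OF l x, of j] lift_cocycle(1)[OF l z(1), of j]
      by (simp add: a_def b_def shift_by_apply)
    then show ?thesis using ab[OF that(1)] by (simp add: add_diff_eq)
  qed
  obtain B where B: "\<And>x. x \<in> X \<Longrightarrow> \<bar>\<tau> x 0\<bar> \<le> real B" using lift_time_bound[OF l] by blast
  \<comment> \<open>The positions \<open>a j\<close> tend to the left: \<tau> x takes arbitrarily
    small values, and \<open>a j\<close> stays within B of \<tau> x j.\<close>
  have low: "\<exists>i::nat. a (J - int i) \<le> m" for m
  proof -
    obtain t where t: "\<tau> x t = real_of_int m - real B" using lift_surj[OF l x] by (metis surj_def)
    define j where "j = min J \<lfloor>t\<rfloor>"
    have "real_of_int j \<le> t" unfolding j_def by linarith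
    then have "\<tau> x (real_of_int j) \<le> \<tau> x t" using lift_mono[OF l x] by (simp add: strict_mono_less_eq)
    moreover have "\<tau> (shift_by j x) 0 = \<tau> x (real_of_int j) - real_of_int (a j)"
      using lift_cocycle(2)[OF l x, of j "real_of_int j"] by (simp add: a_def)
    moreover have "\<bar>\<tau> (shift_by j x) 0\<bar> \<le> real B" using B x by simp
    ultimately have "real_of_int (a j) \<le> real_of_int m" using t by linarith
    then have "a (J - int (nat (J - j))) \<le> m" by (simp add: j_def)
    then show ?thesis by blast
  qed
  have "y x m = y z (m + - d)" if m: "m \<le> a J" for m
  proof -
    \<comment> \<open>The first position at or below m when moving left. The position before it is
      beyond m and at most one step of size M away, so m lies in the window.\<close>
    define i where "i = (LEAST i::nat. a (J - int i) \<le> m)"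
    have i: "a (J - int i) \<le> m" unfolding i_def by (rule LeastI_ex[OF low])
    have "m - a (J - int i) \<le> int M"
    proof (cases i)
      case 0
      then show ?thesis using m by simp
    next
      case (Suc i')
      then have "\<not> a (J - int i') \<le> m" unfolding i_def using not_less_Least[of i' "\<lambda>i. a (J - int i) \<le> m"] by simp
      moreover have "a (J - int i') = a (J - int i) + ?c (shift_by (J - int i) x)"
        using a1[of "J - int i"] Suc by simp
      moreover have "\<bar>?c (shift_by (J - int i) x)\<bar> \<le> int M" using M x by simp
      ultimately show ?thesis by linarith
    qed
    then show ?thesis using win[of "J - int i" "m - a (J - int i)"] i by simp
  qed
  then have "left_tail (y x) (y z)" unfolding left_tail_def by blast
  then show ?thesis using zu left_tail_trans by blast
qed

lemma inverse_of_homeo_plus: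
  assumes f: "f \<in> homeo_plus X"
  obtains g where "g \<in> homeo_plus X" "\<And>c. c \<in> suspension X \<Longrightarrow> g (f c) = c" "\<And>c. c \<in> suspension X \<Longrightarrow> f (g c) = c"
proof -
  have bij: "bij_betw f (suspension X) (suspension X)"
    using homeo_plus_Bij[OF f] by (simp add: Bij_def)
  show ?thesis
    by (rule that[OF homeo_plus_inverse[OF f]])
      (use bij homeo_plus_maps[OF f] in \<open>simp_all add: bij_betw_inv_into_left bij_betw_inv_into_right\<close>)
qed

text \<open>One inclusion is \<open>lift_left_tail\<close> for f, the other is the same lemma for
  the inverse of f.\<close>

lemma image_tail_class:
  assumes f: "f \<in> homeo_plus X" and l: "is_lift f y \<tau>" and x: "x \<in> X"
  shows "f ` tail_class x = tail_class (y x)"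
proof
  show "f ` tail_class x \<subseteq> tail_class (y x)"
  proof
    fix c assume "c \<in> f ` tail_class x"
    then obtain u s where u: "c = f (cls u s)" "u \<in> X" "left_tail x u" by (auto simp: tail_class_def)
    then show "c \<in> tail_class (y x)"
      using lift_cls[OF l] lift_mem[OF l] lift_left_tail[OF l x] by (simp add: cls_in_tail_class)
  qed
  obtain g where g: "g \<in> homeo_plus X" "\<And>c. c \<in> suspension X \<Longrightarrow> g (f c) = c" "\<And>c. c \<in> suspension X \<Longrightarrow> f (g c) = c"
    using inverse_of_homeo_plus[OF f] by blast
  obtain z \<sigma> where k: "is_lift g z \<sigma>" using lift_exists[OF g(1)] by blast
  show "tail_class (y x) \<subseteq> f ` tail_class x"
  proof
    fix c assume "c \<in> tail_class (y x)"
    then obtain u s where u: "c = cls u s" "u \<in> X" "left_tail (y x) u" by (auto simp: tail_class_def)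
    have "cls x 0 = cls (z (y x)) (\<sigma> (y x) (\<tau> x 0))"
      using g(2)[of "cls x 0"] lift_cls[OF l x] lift_cls[OF k lift_mem[OF l x]] x by simp
    then obtain n where "z (y x) = shift_by n x"
      using cls_eq_iff[OF x lift_mem[OF k lift_mem[OF l x]]] by blast
    then have "left_tail x (z (y x))" by simp
    moreover have "left_tail (z (y x)) (z u)" by (rule lift_left_tail[OF k lift_mem[OF l x] u(2,3)])
    ultimately have "left_tail x (z u)" by (rule left_tail_trans)
    then have "g c \<in> tail_class x"
      using lift_cls[OF k u(2)] lift_mem[OF k u(2)] by (simp add: u(1) cls_in_tail_class)
    moreover have "c = f (g c)" using g(3) u by simp
    ultimately show "c \<in> f ` tail_class x" by blast
  qed
qed

lemma image_special_tails:
  assumes f: "f \<in> homeo_plus X" and t: "t \<in> special_tails"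
  shows "f ` t \<in> special_tails"
proof -
  obtain y \<tau> where l: "is_lift f y \<tau>" using lift_exists[OF f] by blast
  obtain x where x: "x \<in> X" "t = tail_class x" using t by (auto simp: special_tails_def branching_def)
  then obtain u where u: "u \<in> X" "left_tail x u" "\<And>n. u \<noteq> shift_by n x"
    using special_tails_iff[OF x(1)] t by blast
  have "y u \<noteq> shift_by n (y x)" for n
  proof
    assume n: "y u = shift_by n (y x)"
    \<comment> \<open>If y u were in the orbit of y x, the point of the leaf of x at this time would
      have the same image as (u, 0), against injectivity.\<close>
    obtain s where s: "\<tau> x s = \<tau> u 0 + real_of_int n" using lift_surj[OF l x(1)] by (metis surj_def)
    have "f (cls x s) = f (cls u 0)"
      using lift_cls[OF l x(1)] lift_cls[OF l u(1)] n s lift_mem[OF l x(1)] by (simp add: cls_shift)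
    then have "cls x s = cls u 0" using homeo_plus_inj[OF f] x(1) u(1) by simp
    then show False using cls_eq_iff[OF x(1) u(1)] u(3) by blast
  qed
  then have "tail_class (y x) \<in> special_tails"
    using special_tails_iff lift_mem[OF l] lift_left_tail[OF l x(1) u(1,2)] u(1) x(1) by blast
  then show ?thesis using image_tail_class[OF f l x(1)] x(2) by simp
qed

end

section \<open>Finiteness of the set of special tails\<close>

locale low_complexity_subshift = minimal_infinite_subshift +
  fixes C :: nat
  assumes few_right_special: "\<And>N. \<exists>n\<ge>N. card (right_special X n) \<le> C"
begin

text \<open>Branching points of different classes disagree somewhere to the left of the origin. For
  all large n the words of length n just before the origin are therefore distinct for the members of
  a finite family, and they are right special.\<close>

lemma finite_special_tails: "finite special_tails"
proof -
  have "card G \<le> C" if G: "G \<subseteq> special_tails" "finite G" for G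
  proof -
    have "\<exists>b. branching b \<and> tail_class b = t" if "t \<in> G" for t
      using that G(1) by (auto simp: special_tails_def)
    then obtain b where b: "\<And>t. t \<in> G \<Longrightarrow> branching (b t)" "\<And>t. t \<in> G \<Longrightarrow> tail_class (b t) = t" by metis
    have bX: "b t \<in> X" if "t \<in> G" for t using b(1)[OF that] by (simp add: branching_def)
    define P where "P p n \<longleftrightarrow> fst p = snd p \<or> (\<exists>i. - int n \<le> i \<and> i < 0 \<and> b (fst p) i \<noteq> b (snd p) i)" for p n
    have "eventually (P p) sequentially" if p: "p \<in> G \<times> G" for p
    proof (cases "fst p = snd p")
      case False
      have "\<not> left_tail (b (fst p)) (b (snd p))"
        using False b(2)[of "fst p"] b(2)[of "snd p"] p tail_class_eq_iff[OF bX bX, of "fst p" "snd p"]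
        by (metis mem_Times_iff)
      \<comment> \<open>The negation of \<open>left_tail\<close> for the trivial displacement and
        the left half-line ending at -1.\<close>
      then have "\<exists>i\<le>-1. b (fst p) i \<noteq> b (snd p) (i + 0)" unfolding left_tail_def by blast
      then obtain i where i: "i \<le> -1" "b (fst p) i \<noteq> b (snd p) i" by auto
      show ?thesis
        unfolding eventually_sequentially
      proof (intro exI allI impI)
        fix n assume "nat (- i) \<le> n"
        then show "P p n" unfolding P_def using i by (intro disjI2 exI[of _ i]) auto
      qed
    next
      case True
      then have "P p = (\<lambda>_. True)" by (simp add: P_def fun_eq_iff)
      then show ?thesis by simp
    qed
    then have "eventually (\<lambda>n. \<forall>p\<in>G \<times> G. P p n) sequentially"
      using G(2) by (intro eventually_ball_finite) auto
    then obtain N where N: "\<And>n p. n \<ge> N \<Longrightarrow> p \<in> G \<times> G \<Longrightarrow> P p n" unfolding eventually_sequentially by blast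
    obtain n where n: "n \<ge> N" "card (right_special X n) \<le> C" using few_right_special by blast
    let ?w = "\<lambda>t. word (shift_by (- int n) (b t)) n"
    have "inj_on ?w G"
    proof (rule inj_onI, rule ccontr)
      fix s t assume st: "s \<in> G" "t \<in> G" "?w s = ?w t" "s \<noteq> t"
      then obtain i where i: "- int n \<le> i" "i < 0" "b s i \<noteq> b t i" using N[OF n(1), of "(s, t)"] by (auto simp: P_def)
      then have "nat (i + int n) < n" by linarith
      then have "shift_by (- int n) (b s) (int (nat (i + int n))) = shift_by (- int n) (b t) (int (nat (i + int n)))"
        using st(3) unfolding word_eq_iff by blast
      then show False using i by (simp add: shift_by_apply)
    qed
    moreover have "?w ` G \<subseteq> right_special X n"
    proof
      fix w assume "w \<in> ?w ` G"
      then obtain t where t: "t \<in> G" "w = ?w t" by blast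
      obtain y where y: "y \<in> X" "\<And>i. i < 0 \<Longrightarrow> b t i = y i" "b t 0 \<noteq> y 0" using b(1)[OF t(1)] by (auto simp: branching_def)
      show "w \<in> right_special X n"
        unfolding right_special_def t(2)
        using y bX[OF t(1)] by (intro CollectI exI[of _ "shift_by (- int n) (b t)"] conjI refl bexI[of _ "shift_by (- int n) y"])
          (auto simp: word_eq_iff shift_by_apply)
    qed
    ultimately have "card G \<le> card (right_special X n)" using finite_right_special by (rule card_inj_on_le)
    then show ?thesis using n(2) by simp
  qed
  then show ?thesis using finite_if_finite_subsets_card_bdd by blast
qed

end

section \<open>Cones of functionals with meets\<close>

text \<open>The order is the one of the cone: \<open>\<psi> \<le> \<phi>\<close> iff \<open>\<phi> - \<psi>\<close> lies in the cone. The
  assumption \<open>split\<close> subtracts the meet of two elements from both. Boundedly many disjoint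
  elements fit into the cone, hence it is generated by finitely many atoms.\<close>

locale lattice_cone =
  fixes E :: "('g \<Rightarrow> real) set" and u :: 'g and disj :: "('g \<Rightarrow> real) \<Rightarrow> ('g \<Rightarrow> real) \<Rightarrow> bool" and N :: nat
  assumes scale: "\<And>\<phi> c. \<phi> \<in> E \<Longrightarrow> 0 \<le> c \<Longrightarrow> (\<lambda>g. c * \<phi> g) \<in> E"
    and add: "\<And>\<phi> \<psi>. \<phi> \<in> E \<Longrightarrow> \<psi> \<in> E \<Longrightarrow> (\<lambda>g. \<phi> g + \<psi> g) \<in> E"
    and mass_nonneg: "\<And>\<phi>. \<phi> \<in> E \<Longrightarrow> 0 \<le> \<phi> u"
    and mass_zero: "\<And>\<phi>. \<phi> \<in> E \<Longrightarrow> \<phi> u = 0 \<Longrightarrow> \<phi> = (\<lambda>_. 0)"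
    and split: "\<And>\<phi> \<psi>. \<phi> \<in> E \<Longrightarrow> \<psi> \<in> E \<Longrightarrow> \<exists>m\<in>E. (\<lambda>g. \<phi> g - m g) \<in> E \<and> (\<lambda>g. \<psi> g - m g) \<in> E \<and>
      disj (\<lambda>g. \<phi> g - m g) (\<lambda>g. \<psi> g - m g)"
    and disj_sym: "\<And>\<phi> \<psi>. disj \<phi> \<psi> \<Longrightarrow> disj \<psi> \<phi>"
    and disj_mono: "\<And>\<phi> \<phi>' \<psi>. disj \<phi> \<psi> \<Longrightarrow> \<phi>' \<in> E \<Longrightarrow> (\<lambda>g. \<phi> g - \<phi>' g) \<in> E \<Longrightarrow> disj \<phi>' \<psi>"
    and disj_scale: "\<And>\<phi> \<psi> c. disj \<phi> \<psi> \<Longrightarrow> 0 \<le> c \<Longrightarrow> disj (\<lambda>g. c * \<phi> g) \<psi>"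
    and disj_self: "\<And>\<phi>. \<phi> \<in> E \<Longrightarrow> disj \<phi> \<phi> \<Longrightarrow> \<phi> = (\<lambda>_. 0)"
    and disj_bound: "\<And>S. S \<subseteq> E \<Longrightarrow> finite S \<Longrightarrow> (\<lambda>_. 0) \<notin> S \<Longrightarrow>
      (\<And>\<phi> \<psi>. \<phi> \<in> S \<Longrightarrow> \<psi> \<in> S \<Longrightarrow> \<phi> \<noteq> \<psi> \<Longrightarrow> disj \<phi> \<psi>) \<Longrightarrow> card S \<le> N"
begin

text \<open>Unit mass selects one vector on each extreme ray, so atoms stand for extreme
  rays.\<close>

definition atom :: "('g \<Rightarrow> real) \<Rightarrow> bool" where
  "atom a \<longleftrightarrow> a \<in> E \<and> a u = 1 \<and> (\<forall>\<psi>\<in>E. (\<lambda>g. a g - \<psi> g) \<in> E \<longrightarrow> (\<exists>c. \<psi> = (\<lambda>g. c * a g)))"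

lemma zero_mem: "\<phi> \<in> E \<Longrightarrow> (\<lambda>_. 0) \<in> E"
  using scale[of \<phi> 0] by simp

lemma diff_trans:
  assumes "(\<lambda>g. \<phi> g - \<psi> g) \<in> E" "(\<lambda>g. \<psi> g - \<xi> g) \<in> E"
  shows "(\<lambda>g. \<phi> g - \<xi> g) \<in> E"
  using add[OF assms] by simp

text \<open>An element of a disjoint family of maximal size is proportional to everything below it, as a
  non-proportional smaller element could be used to split it into two disjoint pieces.\<close>

lemma atom_below:
  assumes \<phi>: "\<phi> \<in> E" "\<phi> \<noteq> (\<lambda>_. 0)"
  obtains a c where "atom a" "c > 0" "(\<lambda>g. \<phi> g - c * a g) \<in> E"
proof -
  define fam where "fam S \<longleftrightarrow> S \<subseteq> E \<and> finite S \<and> (\<lambda>_. 0) \<notin> S \<and> (\<forall>\<psi>\<in>S. (\<lambda>g. \<phi> g - \<psi> g) \<in> E) \<and>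
    (\<forall>\<psi>\<in>S. \<forall>\<xi>\<in>S. \<psi> \<noteq> \<xi> \<longrightarrow> disj \<psi> \<xi>)" for S
  define has_size where "has_size k \<longleftrightarrow> (\<exists>S. fam S \<and> card S = k)" for k
  have "fam {\<phi>}" using \<phi> zero_mem by (auto simp: fam_def)
  then have 1: "has_size 1" unfolding has_size_def by (intro exI[of _ "{\<phi>}"]) simp
  have bd: "k \<le> N" if k: "has_size k" for k
  proof -
    obtain S where "fam S" "card S = k" using k unfolding has_size_def by blast
    then show ?thesis using disj_bound[of S] unfolding fam_def by metis
  qed
  define k where "k = (GREATEST k. has_size k)"
  have k: "has_size k" unfolding k_def using 1 bd by (rule GreatestI_nat)
  have kmax: "j \<le> k" if "has_size j" for j unfolding k_def using that bd by (rule Greatest_le_nat)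
  obtain S where S: "fam S" "card S = k" using k by (auto simp: has_size_def)
  have "k \<ge> 1" using kmax[OF 1] .
  then obtain \<psi> where \<psi>: "\<psi> \<in> S" using S(2) by fastforce
  have \<psi>E: "\<psi> \<in> E" "\<psi> \<noteq> (\<lambda>_. 0)" "(\<lambda>g. \<phi> g - \<psi> g) \<in> E" using \<psi> S(1) by (auto simp: fam_def)
  have "\<psi> u \<noteq> 0" using mass_zero[OF \<psi>E(1)] \<psi>E(2) by blast
  then have m: "\<psi> u > 0" using mass_nonneg[OF \<psi>E(1)] by simp
  have multiple: "\<exists>c. \<eta> = (\<lambda>g. c * \<psi> g)" if \<eta>: "\<eta> \<in> E" "(\<lambda>g. \<psi> g - \<eta> g) \<in> E" for \<eta>
  proof -
    \<comment> \<open>Comparing masses, this is the only possible factor.\<close>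
    define c where "c = \<eta> u / \<psi> u"
    have c: "c \<ge> 0" using m mass_nonneg[OF \<eta>(1)] by (simp add: c_def)
    obtain l where l: "l \<in> E" "(\<lambda>g. \<eta> g - l g) \<in> E" "(\<lambda>g. c * \<psi> g - l g) \<in> E"
        "disj (\<lambda>g. \<eta> g - l g) (\<lambda>g. c * \<psi> g - l g)"
      using split[OF \<eta>(1) scale[OF \<psi>E(1) c]] by blast
    define \<alpha> where "\<alpha> = (\<lambda>g. \<eta> g - l g)"
    \<comment> \<open>Scales the second remainder down so that it lies below \<psi>, which needs d *
      c \<le> 1; \<open>max 1\<close> also covers c = 0.\<close>
    define d where "d = 1 / max 1 c"
    have d: "d > 0" "d * c \<le> 1" by (auto simp: d_def)
    define \<beta> where "\<beta> = (\<lambda>g. d * (c * \<psi> g - l g))"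
    have \<alpha>E: "\<alpha> \<in> E" using l(2) by (simp add: \<alpha>_def)
    have \<beta>E: "\<beta> \<in> E" using scale[OF l(3), of d] d(1) by (simp add: \<beta>_def)
    have \<alpha>le: "(\<lambda>g. \<psi> g - \<alpha> g) \<in> E" using add[OF \<eta>(2) l(1)] by (simp add: \<alpha>_def algebra_simps)
    have \<beta>le: "(\<lambda>g. \<psi> g - \<beta> g) \<in> E"
      using add[OF scale[OF \<psi>E(1), of "1 - d * c"] scale[OF l(1), of d]] d
      by (simp add: \<beta>_def algebra_simps)
    have \<alpha>\<beta>: "disj \<alpha> \<beta>"
      using disj_sym[OF disj_scale[OF disj_sym[OF l(4)], of d]] d(1) by (simp add: \<alpha>_def \<beta>_def)
    \<comment> \<open>Two nonzero disjoint remainders below \<psi> could replace \<psi> in the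
      family and make it larger.\<close>
    have "\<alpha> = (\<lambda>_. 0) \<or> \<beta> = (\<lambda>_. 0)"
    proof (rule ccontr)
      assume nz: "\<not> (\<alpha> = (\<lambda>_. 0) \<or> \<beta> = (\<lambda>_. 0))"
      let ?S = "S - {\<psi>}"
      have dS: "disj \<alpha> \<xi>" "disj \<beta> \<xi>" if "\<xi> \<in> ?S" for \<xi>
      proof -
        have "disj \<psi> \<xi>" using that \<psi> S(1) by (auto simp: fam_def)
        then show "disj \<alpha> \<xi>" "disj \<beta> \<xi>" using disj_mono \<alpha>E \<beta>E \<alpha>le \<beta>le by blast+
      qed
      have "\<alpha> \<noteq> \<beta>" using disj_self[OF \<alpha>E] \<alpha>\<beta> nz by blast
      moreover have "\<alpha> \<notin> ?S" "\<beta> \<notin> ?S" using dS disj_self \<alpha>E \<beta>E nz by blast+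
      moreover have fS: "finite ?S" "Suc (card ?S) = k" using S \<psi> card_Suc_Diff1[of S \<psi>] by (auto simp: fam_def)
      ultimately have "card (insert \<alpha> (insert \<beta> ?S)) = Suc k" by simp
      moreover have "fam (insert \<alpha> (insert \<beta> ?S))"
        unfolding fam_def
      proof (intro conjI ballI impI)
        show "insert \<alpha> (insert \<beta> ?S) \<subseteq> E" "finite (insert \<alpha> (insert \<beta> ?S))" "(\<lambda>_. 0) \<notin> insert \<alpha> (insert \<beta> ?S)"
          using S(1) \<alpha>E \<beta>E nz by (auto simp: fam_def)
        fix \<xi> assume \<xi>: "\<xi> \<in> insert \<alpha> (insert \<beta> ?S)"
        show "(\<lambda>g. \<phi> g - \<xi> g) \<in> E"
          using \<xi> S(1) diff_trans[OF \<psi>E(3) \<alpha>le] diff_trans[OF \<psi>E(3) \<beta>le] by (auto simp: fam_def)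
        fix \<omega> assume "\<omega> \<in> insert \<alpha> (insert \<beta> ?S)" "\<xi> \<noteq> \<omega>"
        moreover have "disj \<xi> \<omega>" if "\<xi> \<in> ?S" "\<omega> \<in> ?S" "\<xi> \<noteq> \<omega>" for \<xi> \<omega>
          using that S(1) unfolding fam_def by blast
        ultimately show "disj \<xi> \<omega>" using \<xi> \<alpha>\<beta> dS disj_sym by (metis insert_iff)
      qed
      ultimately have "has_size (Suc k)" by (auto simp: has_size_def)
      then show False using kmax by fastforce
    qed
    then show ?thesis
    proof
      assume "\<alpha> = (\<lambda>_. 0)"
      \<comment> \<open>Now \<eta> is the meet itself, hence lies below c * \<psi>; as the masses
        agree, the two are equal. The other case is symmetric.\<close>
      then have "\<eta> = l" by (simp add: \<alpha>_def fun_eq_iff)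
      moreover have "c * \<psi> u - \<eta> u = 0" using m by (simp add: c_def)
      ultimately have "(\<lambda>g. c * \<psi> g - \<eta> g) = (\<lambda>_. 0)" using mass_zero[OF l(3)] by simp
      then have "\<eta> g = c * \<psi> g" for g by (metis eq_iff_diff_eq_0)
      then show ?thesis by blast
    next
      assume "\<beta> = (\<lambda>_. 0)"
      then have "l g = c * \<psi> g" for g using d(1) by (simp add: \<beta>_def fun_eq_iff)
      then have lp: "l = (\<lambda>g. c * \<psi> g)" by blast
      have "\<eta> u - c * \<psi> u = 0" using m by (simp add: c_def)
      then have "(\<lambda>g. \<eta> g - c * \<psi> g) = (\<lambda>_. 0)" using mass_zero[OF l(2)] by (simp add: lp)
      then have "\<eta> g = c * \<psi> g" for g by (metis eq_iff_diff_eq_0)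
      then show ?thesis by blast
    qed
  qed
  define a where "a = (\<lambda>g. (1 / \<psi> u) * \<psi> g)"
  have "atom a"
    unfolding atom_def
  proof (intro conjI ballI impI)
    show "a \<in> E" unfolding a_def using m by (intro scale[OF \<psi>E(1)]) simp
    show "a u = 1" using m by (simp add: a_def)
    fix \<eta> assume \<eta>: "\<eta> \<in> E" "(\<lambda>g. a g - \<eta> g) \<in> E"
    have "(\<lambda>g. \<psi> g - \<psi> u * \<eta> g) \<in> E"
      using scale[OF \<eta>(2), of "\<psi> u"] m by (simp add: a_def algebra_simps)
    moreover have "(\<lambda>g. \<psi> u * \<eta> g) \<in> E" using m by (intro scale[OF \<eta>(1)]) simp
    ultimately obtain c where c: "(\<lambda>g. \<psi> u * \<eta> g) = (\<lambda>g. c * \<psi> g)" using multiple[of "\<lambda>g. \<psi> u * \<eta> g"] by blast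
    have "\<eta> g = c * a g" for g using m fun_cong[OF c, of g] by (simp add: a_def field_simps)
    then show "\<exists>c. \<eta> = (\<lambda>g. c * a g)" by blast
  qed
  moreover have "(\<lambda>g. \<phi> g - \<psi> u * a g) \<in> E" using \<psi>E(3) m by (simp add: a_def)
  ultimately show ?thesis using that m by blast
qed

lemma atomD:
  assumes "atom a"
  shows "a \<in> E" "a u = 1" "a \<noteq> (\<lambda>_. 0)"
    "\<And>\<psi>. \<psi> \<in> E \<Longrightarrow> (\<lambda>g. a g - \<psi> g) \<in> E \<Longrightarrow> \<exists>c. \<psi> = (\<lambda>g. c * a g)"
proof -
  show 1: "a \<in> E" "a u = 1" using assms unfolding atom_def by blast+
  show "a \<noteq> (\<lambda>_. 0)"
  proof
    assume "a = (\<lambda>_. 0)"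
    then have "a u = 0" by simp
    then show False using 1(2) by simp
  qed
  show "\<exists>c. \<psi> = (\<lambda>g. c * a g)" if "\<psi> \<in> E" "(\<lambda>g. a g - \<psi> g) \<in> E" for \<psi>
    using assms that unfolding atom_def by blast
qed

text \<open>The meet of the two is a multiple of both, with the same factor since both have mass 1.
  For distinct atoms the factor must be 0.\<close>

lemma atoms_disj:
  assumes a: "atom a" and b: "atom b" and "a \<noteq> b"
  shows "disj a b"
proof -
  obtain m where m: "m \<in> E" "(\<lambda>g. a g - m g) \<in> E" "(\<lambda>g. b g - m g) \<in> E" "disj (\<lambda>g. a g - m g) (\<lambda>g. b g - m g)"
    using split[OF atomD(1)[OF a] atomD(1)[OF b]] by blast
  obtain c where c: "m = (\<lambda>g. c * a g)" using atomD(4)[OF a m(1,2)] by blast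
  obtain d where d: "m = (\<lambda>g. d * b g)" using atomD(4)[OF b m(1,3)] by blast
  have "c = d" using fun_cong[OF c, of u] fun_cong[OF d, of u] atomD(2)[OF a] atomD(2)[OF b] by simp
  have "c = 0"
  proof (rule ccontr)
    assume "c \<noteq> 0"
    then have "a g = b g" for g using fun_cong[OF c, of g] fun_cong[OF d, of g] \<open>c = d\<close> by simp
    then show False using \<open>a \<noteq> b\<close> by blast
  qed
  then show ?thesis using m(4) by (simp add: c)
qed

lemma finite_atoms: "finite {a. atom a}"
proof -
  have "card G \<le> N" if G: "G \<subseteq> {a. atom a}" "finite G" for G
  proof (rule disj_bound)
    show "G \<subseteq> E" using G(1) atomD(1) by blast
    show "(\<lambda>_. 0) \<notin> G" using G(1) atomD(3) by blast
    show "disj a b" if "a \<in> G" "b \<in> G" "a \<noteq> b" for a b using G(1) that atoms_disj by blast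
  qed (fact G(2))
  then show ?thesis using finite_if_finite_subsets_card_bdd by blast
qed

text \<open>The meet of \<phi> with a large multiple K * a is some c * a. As K exceeds the mass of
  \<phi>, and hence c, the remainder of K * a is a positive multiple of a, so disjointness of the
  remainders means disjointness from a.\<close>

lemma split_atom:
  assumes \<phi>: "\<phi> \<in> E" and a: "atom a"
  obtains c where "(\<lambda>g. \<phi> g - c * a g) \<in> E" "c \<ge> 0" "disj (\<lambda>g. \<phi> g - c * a g) a"
proof -
  define K where "K = \<phi> u + 1"
  note aE = atomD(1,2)[OF a]
  have K: "K > 0" using mass_nonneg[OF \<phi>] by (simp add: K_def)
  obtain m where m: "m \<in> E" "(\<lambda>g. \<phi> g - m g) \<in> E" "(\<lambda>g. K * a g - m g) \<in> E" "disj (\<lambda>g. \<phi> g - m g) (\<lambda>g. K * a g - m g)"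
    using split[OF \<phi> scale[OF aE(1)], of K] K by auto
  have "(\<lambda>g. a g - (1 / K) * m g) \<in> E" using scale[OF m(3), of "1 / K"] K by (simp add: algebra_simps)
  moreover have "(\<lambda>g. (1 / K) * m g) \<in> E" using K by (intro scale[OF m(1)]) simp
  ultimately obtain c' where c': "(\<lambda>g. (1 / K) * m g) = (\<lambda>g. c' * a g)"
    using atomD(4)[OF a, of "\<lambda>g. (1 / K) * m g"] by blast
  define c where "c = K * c'"
  have mc: "m = (\<lambda>g. c * a g)"
  proof
    fix g show "m g = c * a g" using fun_cong[OF c', of g] K by (simp add: c_def field_simps)
  qed
  have "c = m u" using aE by (simp add: mc)
  then have c: "c \<ge> 0" "c \<le> \<phi> u" using mass_nonneg[OF m(1)] mass_nonneg[OF m(2)] by auto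
  then have pos: "K - c > 0" by (simp add: K_def)
  have "disj (\<lambda>g. K * a g - m g) (\<lambda>g. \<phi> g - m g)" using m(4) by (rule disj_sym)
  then have "disj (\<lambda>g. 1 / (K - c) * (K * a g - m g)) (\<lambda>g. \<phi> g - m g)" using pos by (intro disj_scale) auto
  moreover have "1 / (K - c) * (K * a g - m g) = a g" for g
    using pos by (simp add: mc field_simps)
  ultimately have "disj a (\<lambda>g. \<phi> g - c * a g)" by (simp add: mc)
  then show ?thesis using that m(2) c disj_sym by (simp add: mc)
qed

text \<open>Removing the atoms one at a time leaves a remainder disjoint from all of them. If it
  were nonzero, \<open>atom_below\<close> would place a multiple of an atom under it, and this atom
  would be disjoint from itself.\<close>

theorem atomic_decomposition:
  assumes \<phi>: "\<phi> \<in> E"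
  obtains c where "\<phi> = (\<lambda>g. \<Sum>a | atom a. c a * a g)"
proof -
  define rest where "rest c A = (\<lambda>g. \<phi> g - (\<Sum>a\<in>A. c a * a g))" for c :: "('g \<Rightarrow> real) \<Rightarrow> real" and A
  have "\<exists>c. rest c A \<in> E \<and> (\<forall>a\<in>A. disj (rest c A) a)" if "finite A" "A \<subseteq> {a. atom a}" for A
    using that
  proof (induction A rule: finite_induct)
    case empty
    then show ?case using \<phi> by (simp add: rest_def)
  next
    case (insert b A)
    have "A \<subseteq> {a. atom a}" and b: "atom b" using insert.prems by auto
    from insert.IH[OF this(1)] obtain c where c: "rest c A \<in> E" "\<And>a. a \<in> A \<Longrightarrow> disj (rest c A) a" by blast
    obtain d where d: "(\<lambda>g. rest c A g - d * b g) \<in> E" "d \<ge> 0" "disj (\<lambda>g. rest c A g - d * b g) b"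
      using split_atom[OF c(1) b] by blast
    have eq: "rest (c(b := d)) (insert b A) = (\<lambda>g. rest c A g - d * b g)"
    proof
      fix g
      have "(\<Sum>a\<in>A. (c(b := d)) a * a g) = (\<Sum>a\<in>A. c a * a g)" using insert.hyps by (intro sum.cong) auto
      then show "rest (c(b := d)) (insert b A) g = rest c A g - d * b g" using insert.hyps by (simp add: rest_def)
    qed
    have "(\<lambda>g. d * b g) \<in> E" by (rule scale[OF atomD(1)[OF b] d(2)])
    then have "disj (\<lambda>g. rest c A g - d * b g) a" if "a \<in> A" for a
      using disj_mono[OF c(2)[OF that] d(1)] by simp
    then have "rest (c(b := d)) (insert b A) \<in> E \<and> (\<forall>a\<in>insert b A. disj (rest (c(b := d)) (insert b A)) a)"
      unfolding eq using d(1,3) by blast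
    then show ?case by blast
  qed
  from this[OF finite_atoms subset_refl] obtain c where
    c: "rest c {a. atom a} \<in> E" "\<And>a. atom a \<Longrightarrow> disj (rest c {a. atom a}) a" by blast
  have "rest c {a. atom a} = (\<lambda>_. 0)"
  proof (rule ccontr)
    assume "\<not> ?thesis"
    then obtain b d where b: "atom b" "d > 0" "(\<lambda>g. rest c {a. atom a} g - d * b g) \<in> E"
      using atom_below[OF c(1)] by blast
    have "(\<lambda>g. d * b g) \<in> E" using b(2) by (intro scale[OF atomD(1)[OF b(1)]]) simp
    from disj_mono[OF c(2)[OF b(1)] this b(3)] have "disj (\<lambda>g. d * b g) b" .
    then have "disj (\<lambda>g. (1 / d) * (d * b g)) b" by (rule disj_scale) (use b(2) in simp)
    moreover have "(\<lambda>g. (1 / d) * (d * b g)) = b" using b(2) by (simp add: fun_eq_iff)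
    ultimately have "disj b b" by metis
    then show False using disj_self[OF atomD(1)[OF b(1)]] atomD(3)[OF b(1)] by blast
  qed
  then have "\<phi> g = (\<Sum>a | atom a. c a * a g)" for g
    unfolding rest_def by (metis eq_iff_diff_eq_0)
  then show ?thesis using that by blast
qed

end

section \<open>Meets of contents\<close>

context minimal_infinite_subshift
begin

lemma content_add_mem: "\<phi> \<in> contents \<Longrightarrow> \<psi> \<in> contents \<Longrightarrow> (\<lambda>g. \<phi> g + \<psi> g) \<in> contents"
  unfolding contents_def by simp

lemma content_scale_mem: "\<phi> \<in> contents \<Longrightarrow> 0 \<le> c \<Longrightarrow> (\<lambda>g. c * \<phi> g) \<in> contents"
  unfolding contents_def by (simp add: distrib_left)

lemma content_one_nonneg: "\<phi> \<in> contents \<Longrightarrow> 0 \<le> \<phi> (\<lambda>_. 1)"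
  by (rule content_nonneg) auto

text \<open>Mutual singularity for finitely additive set functions: the clopen set with indicator a
  carries almost all of \<psi> and almost nothing of \<phi>. Clopen sets need not separate exactly,
  hence the error e.\<close>

definition content_disj :: "(((int \<Rightarrow> 'a) \<Rightarrow> int) \<Rightarrow> real) \<Rightarrow> (((int \<Rightarrow> 'a) \<Rightarrow> int) \<Rightarrow> real) \<Rightarrow> bool" where
  "content_disj \<phi> \<psi> \<longleftrightarrow> (\<forall>e>0. \<exists>a. locally_const X a \<and> (\<forall>x\<in>X. a x \<in> {0, 1}) \<and> \<phi> a < e \<and> \<psi> (\<lambda>x. 1 - a x) < e)"

lemma content_disj_sym:
  assumes "content_disj \<phi> \<psi>"
  shows "content_disj \<psi> \<phi>"
  unfolding content_disj_def
proof (intro allI impI)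
  fix e :: real assume "e > 0"
  then obtain a where a: "locally_const X a" "\<forall>x\<in>X. a x \<in> {0, 1}" "\<phi> a < e" "\<psi> (\<lambda>x. 1 - a x) < e"
    using assms unfolding content_disj_def by blast
  have "locally_const X (\<lambda>x. 1 - a x)" by (rule locally_const_comp[OF a(1)])
  then show "\<exists>a. locally_const X a \<and> (\<forall>x\<in>X. a x \<in> {0, 1}) \<and> \<psi> a < e \<and> \<phi> (\<lambda>x. 1 - a x) < e"
    using a by (intro exI[of _ "\<lambda>x. 1 - a x"]) auto
qed

lemma content_disj_mono:
  assumes d: "content_disj \<phi> \<psi>" and "(\<lambda>g. \<phi> g - \<phi>' g) \<in> contents"
  shows "content_disj \<phi>' \<psi>"
  unfolding content_disj_def
proof (intro allI impI)
  fix e :: real assume "e > 0"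
  then obtain a where a: "locally_const X a" "\<forall>x\<in>X. a x \<in> {0, 1}" "\<phi> a < e" "\<psi> (\<lambda>x. 1 - a x) < e"
    using d unfolding content_disj_def by blast
  have "0 \<le> \<phi> a - \<phi>' a" using content_nonneg[OF assms(2) a(1)] a(2) by force
  then show "\<exists>a. locally_const X a \<and> (\<forall>x\<in>X. a x \<in> {0, 1}) \<and> \<phi>' a < e \<and> \<psi> (\<lambda>x. 1 - a x) < e"
    using a by (intro exI[of _ a]) auto
qed

lemma content_disj_scale:
  assumes d: "content_disj \<phi> \<psi>" and c: "0 \<le> c"
  shows "content_disj (\<lambda>g. c * \<phi> g) \<psi>"
  unfolding content_disj_def
proof (intro allI impI)
  fix e :: real assume e: "e > 0"
  define e' where "e' = min e (e / (c + 1))"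
  have "e' > 0" using e c by (simp add: e'_def)
  then obtain a where a: "locally_const X a" "\<forall>x\<in>X. a x \<in> {0, 1}" "\<phi> a < e'" "\<psi> (\<lambda>x. 1 - a x) < e'"
    using d unfolding content_disj_def by blast
  have "c * \<phi> a \<le> c * (e / (c + 1))" using a(3) c by (intro mult_left_mono) (auto simp: e'_def)
  also have "\<dots> < e" using c e by (simp add: field_simps)
  finally show "\<exists>a. locally_const X a \<and> (\<forall>x\<in>X. a x \<in> {0, 1}) \<and> c * \<phi> a < e \<and> \<psi> (\<lambda>x. 1 - a x) < e"
    using a by (intro exI[of _ a]) (auto simp: e'_def)
qed

lemma content_disj_self:
  assumes \<phi>: "\<phi> \<in> contents" and d: "content_disj \<phi> \<phi>"
  shows "\<phi> = (\<lambda>_. 0)"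
proof (rule content_mass_zero[OF \<phi>], rule ccontr)
  assume "\<phi> (\<lambda>_. 1) \<noteq> 0"
  then have "\<phi> (\<lambda>_. 1) / 2 > 0" using content_one_nonneg[OF \<phi>] by simp
  then obtain a where a: "locally_const X a" "\<phi> a < \<phi> (\<lambda>_. 1) / 2" "\<phi> (\<lambda>x. 1 - a x) < \<phi> (\<lambda>_. 1) / 2"
    using d unfolding content_disj_def by blast
  then show False using content_diff[OF \<phi> locally_const_const[of X 1] a(1)] by simp
qed

text \<open>The meet is given by the Riesz-Kantorovich formula.\<close>

lemma content_split:
  assumes \<phi>: "\<phi> \<in> contents" and \<psi>: "\<psi> \<in> contents"
  shows "\<exists>m\<in>contents. (\<lambda>g. \<phi> g - m g) \<in> contents \<and> (\<lambda>g. \<psi> g - m g) \<in> contents \<and>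
    content_disj (\<lambda>g. \<phi> g - m g) (\<lambda>g. \<psi> g - m g)"
proof -
  define D where "D g = {a. locally_const X a \<and> (\<forall>x\<in>X. 0 \<le> a x \<and> a x \<le> g x)}" for g :: "(int \<Rightarrow> 'a) \<Rightarrow> int"
  define v where "v g a = \<phi> a + \<psi> (\<lambda>x. g x - a x)" for g a
  define I where "I g = Inf (v g ` D g)" for g
  have lsub: "locally_const X (\<lambda>x. g x - h x)" and ladd: "locally_const X (\<lambda>x. g x + h x)"
    and lmax: "locally_const X (\<lambda>x. max (g x) (h x))" and lmin: "locally_const X (\<lambda>x. min (g x) (h x))"
    if "locally_const X g" "locally_const X h" for g h :: "(int \<Rightarrow> 'a) \<Rightarrow> int"
    using locally_const_comp2[OF that] by blast+
  have v0: "0 \<le> v g a" if "locally_const X g" "a \<in> D g" for g a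
    using that lsub[of g a] unfolding v_def D_def
    by (intro add_nonneg_nonneg content_nonneg[OF \<phi>] content_nonneg[OF \<psi>]) auto
  have bdd: "bdd_below (v g ` D g)" if "locally_const X g" for g using v0[OF that] by (auto intro!: bdd_belowI)
  have ne: "v g ` D g \<noteq> {}" if "\<And>x. x \<in> X \<Longrightarrow> 0 \<le> g x" for g
  proof -
    have "(\<lambda>_. 0) \<in> D g" using that by (simp add: D_def)
    then show ?thesis by blast
  qed
  have I_le: "I g \<le> v g a" if "locally_const X g" "a \<in> D g" for g a
    unfolding I_def using that bdd by (intro cInf_lower) auto
  have I_ge: "b \<le> I g" if "\<And>x. x \<in> X \<Longrightarrow> 0 \<le> g x" "\<And>a. a \<in> D g \<Longrightarrow> b \<le> v g a" for g b
    unfolding I_def using that ne by (intro cInf_greatest) auto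
  have I_close: "\<exists>a\<in>D g. v g a < I g + e" if "\<And>x. x \<in> X \<Longrightarrow> 0 \<le> g x" "e > 0" for g e
  proof (rule ccontr)
    assume "\<not> ?thesis"
    then have "I g + e \<le> I g" using that(1) by (intro I_ge) (auto simp: not_less)
    then show False using that(2) by simp
  qed
  have I_nonneg: "0 \<le> I g" if "locally_const X g" "\<And>x. x \<in> X \<Longrightarrow> 0 \<le> g x" for g
    using that v0 by (intro I_ge) auto
  have I_add: "I (\<lambda>x. g x + h x) = I g + I h"
    if g: "locally_const X g" "\<And>x. x \<in> X \<Longrightarrow> 0 \<le> g x" and h: "locally_const X h" "\<And>x. x \<in> X \<Longrightarrow> 0 \<le> h x" for g h
  proof (rule antisym)
    show "I (\<lambda>x. g x + h x) \<le> I g + I h"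
    proof (rule field_le_epsilon)
      fix e :: real assume "e > 0"
      then have e: "e / 2 > 0" by simp
      obtain a where a: "a \<in> D g" "v g a < I g + e / 2" using I_close[of g, OF g(2) e] by blast
      obtain b where b: "b \<in> D h" "v h b < I h + e / 2" using I_close[of h, OF h(2) e] by blast
      have al: "locally_const X a" "locally_const X b" using a b by (auto simp: D_def)
      have "(\<lambda>x. a x + b x) \<in> D (\<lambda>x. g x + h x)"
        using a(1) b(1) ladd unfolding D_def by (auto simp: add_mono)
      then have "I (\<lambda>x. g x + h x) \<le> v (\<lambda>x. g x + h x) (\<lambda>x. a x + b x)"
        using I_le ladd[OF g(1) h(1)] by blast
      also have "\<dots> = v g a + v h b"
      proof -
        have "\<psi> (\<lambda>x. (g x - a x) + (h x - b x)) = \<psi> (\<lambda>x. g x - a x) + \<psi> (\<lambda>x. h x - b x)"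
          by (intro content_add[OF \<psi>] lsub g h al)
        moreover have "(\<lambda>x. g x + h x - (a x + b x)) = (\<lambda>x. (g x - a x) + (h x - b x))" by (simp add: fun_eq_iff)
        ultimately show ?thesis using content_add[OF \<phi> al] by (simp add: v_def)
      qed
      finally show "I (\<lambda>x. g x + h x) \<le> I g + I h + e" using a(2) b(2) by simp
    qed
    show "I g + I h \<le> I (\<lambda>x. g x + h x)"
    proof (rule I_ge)
      show "0 \<le> g x + h x" if "x \<in> X" for x using g h that by simp
      fix c assume c: "c \<in> D (\<lambda>x. g x + h x)"
      then have cl: "locally_const X c" by (simp add: D_def)
      \<comment> \<open>The Riesz decomposition property: a function below g + h is split into a
        part below g and a rest below h.\<close>
      define a where "a = (\<lambda>x. min (c x) (g x))"
      define b where "b = (\<lambda>x. c x - a x)"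
      have al: "locally_const X a" "locally_const X b"
        unfolding b_def a_def by (intro lsub lmin cl g(1))+
      have "a \<in> D g" "b \<in> D h" using c g h al unfolding D_def a_def b_def by (auto simp: min_def)
      then have "I g + I h \<le> v g a + v h b" using I_le g h by (intro add_mono) auto
      also have "\<dots> = v (\<lambda>x. g x + h x) c"
      proof -
        have "\<psi> (\<lambda>x. (g x - a x) + (h x - b x)) = \<psi> (\<lambda>x. g x - a x) + \<psi> (\<lambda>x. h x - b x)"
          by (intro content_add[OF \<psi>] lsub g h al)
        moreover have "(\<lambda>x. (g x - a x) + (h x - b x)) = (\<lambda>x. g x + h x - c x)" by (simp add: b_def fun_eq_iff)
        moreover have "(\<lambda>x. a x + b x) = c" by (simp add: b_def fun_eq_iff)
        ultimately show ?thesis using content_add[OF \<phi> al] by (simp add: v_def)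
      qed
      finally show "I g + I h \<le> v (\<lambda>x. g x + h x) c" .
    qed
  qed
  have I_cong: "I g = I h" if "\<And>x. x \<in> X \<Longrightarrow> g x = h x" for g h
  proof -
    have "D g = D h" using that by (auto simp: D_def)
    moreover have "v g a = v h a" for a
      unfolding v_def using that by (intro arg_cong2[where f = "(+)"] refl content_cong[OF \<psi>]) simp
    ultimately show ?thesis by (simp add: I_def)
  qed
  have I_shift: "I (\<lambda>x. g (shift x)) = I g" if g: "locally_const X g" for g
  proof -
    have vs: "v (\<lambda>x. g (shift x)) (\<lambda>x. a (shift x)) = v g a" if "a \<in> D g" for a
    proof -
      have "locally_const X a" using that by (simp add: D_def)
      then show ?thesis using content_shift_1[OF \<phi>] content_shift_1[OF \<psi> lsub[OF g]] by (simp add: v_def)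
    qed
    have "v (\<lambda>x. g (shift x)) ` D (\<lambda>x. g (shift x)) = v g ` D g"
    proof (intro Set.equalityI subsetI)
      fix w assume "w \<in> v g ` D g"
      then obtain a where a: "a \<in> D g" "w = v g a" by blast
      have "(\<lambda>x. a (shift x)) \<in> D (\<lambda>x. g (shift x))"
        using a(1) locally_const_shift unfolding D_def by auto
      then show "w \<in> v (\<lambda>x. g (shift x)) ` D (\<lambda>x. g (shift x))" using vs[OF a(1)] a(2) by (metis image_eqI)
    next
      fix w assume "w \<in> v (\<lambda>x. g (shift x)) ` D (\<lambda>x. g (shift x))"
      then obtain b where b: "b \<in> D (\<lambda>x. g (shift x))" "w = v (\<lambda>x. g (shift x)) b" by blast
      define a where "a = (\<lambda>x. b (shift_by (- 1) x))"
      have ba: "b = (\<lambda>x. a (shift x))" by (simp add: a_def shift_by_shift_by)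
      have "a \<in> D g"
        unfolding D_def
      proof (intro CollectI conjI ballI)
        show "locally_const X a" unfolding a_def using b(1) by (intro locally_const_shift) (simp add: D_def)
        fix x assume "x \<in> X"
        then have "0 \<le> b (shift_by (- 1) x)" "b (shift_by (- 1) x) \<le> g (shift (shift_by (- 1) x))"
          using b(1) unfolding D_def by auto
        then show "0 \<le> a x" "a x \<le> g x" by (simp_all add: a_def shift_by_shift_by)
      qed
      then show "w \<in> v g ` D g" using vs[of a] b(2) ba by (metis image_eqI)
    qed
    then show ?thesis by (simp add: I_def)
  qed
  \<comment> \<open>I is additive on nonnegative functions only and is extended to differences.
    Additivity of the extension rests on the identity of \<open>pos\<close> and \<open>neg\<close>
    parts used in \<open>m_add\<close>.\<close>
  define pos where "pos g = (\<lambda>x. max (g x) 0)" for g :: "(int \<Rightarrow> 'a) \<Rightarrow> int"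
  define neg where "neg g = (\<lambda>x. max (- g x) 0)" for g :: "(int \<Rightarrow> 'a) \<Rightarrow> int"
  define m where "m g = (if locally_const X g then I (pos g) - I (neg g) else 0)" for g
  have pl: "locally_const X (pos g)" "locally_const X (neg g)" if "locally_const X g" for g
    unfolding pos_def neg_def using that by (rule locally_const_comp)+
  have p0: "0 \<le> pos g x" "0 \<le> neg g x" for g x by (auto simp: pos_def neg_def)
  have m_nonneg_eq: "m g = I g" if g: "locally_const X g" "\<And>x. x \<in> X \<Longrightarrow> 0 \<le> g x" for g
  proof -
    have "I (pos g) = I g" using g(2) by (intro I_cong) (simp add: pos_def)
    moreover have "I (neg g) = I (\<lambda>_. 0)" using g(2) by (intro I_cong) (simp add: neg_def)
    moreover have "I (\<lambda>_. 0) = 0" using I_add[of "\<lambda>_. 0" "\<lambda>_. 0"] by simp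
    ultimately show ?thesis using g(1) by (simp add: m_def)
  qed
  have m_add: "m (\<lambda>x. g x + h x) = m g + m h" if g: "locally_const X g" and h: "locally_const X h" for g h
  proof -
    have gh: "locally_const X (\<lambda>x. g x + h x)" by (rule ladd[OF g h])
    have "I (\<lambda>x. pos (\<lambda>x. g x + h x) x + (neg g x + neg h x)) = I (\<lambda>x. neg (\<lambda>x. g x + h x) x + (pos g x + pos h x))"
      by (intro I_cong) (auto simp: pos_def neg_def)
    moreover have "I (\<lambda>x. pos (\<lambda>x. g x + h x) x + (neg g x + neg h x)) = I (pos (\<lambda>x. g x + h x)) + (I (neg g) + I (neg h))"
      using I_add[OF pl(1)[OF gh] _ ladd[OF pl(2)[OF g] pl(2)[OF h]]] I_add[OF pl(2)[OF g] _ pl(2)[OF h]] p0 by simp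
    moreover have "I (\<lambda>x. neg (\<lambda>x. g x + h x) x + (pos g x + pos h x)) = I (neg (\<lambda>x. g x + h x)) + (I (pos g) + I (pos h))"
      using I_add[OF pl(2)[OF gh] _ ladd[OF pl(1)[OF g] pl(1)[OF h]]] I_add[OF pl(1)[OF g] _ pl(1)[OF h]] p0 by simp
    ultimately show ?thesis using g h gh by (simp add: m_def)
  qed
  have m_shift: "m (\<lambda>x. g (shift x)) = m g" if g: "locally_const X g" for g
  proof -
    have "pos (\<lambda>x. g (shift x)) = (\<lambda>x. pos g (shift x))" "neg (\<lambda>x. g (shift x)) = (\<lambda>x. neg g (shift x))"
      by (simp_all add: pos_def neg_def)
    then show ?thesis using g locally_const_shift[OF g, of 1] I_shift pl[OF g] by (simp add: m_def)
  qed
  have mE: "m \<in> contents"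
    unfolding contents_def
    using m_add m_shift m_nonneg_eq I_nonneg by (simp add: m_def)
  have le: "(\<lambda>g. \<xi> g - m g) \<in> contents" if \<xi>: "\<xi> \<in> contents" and I\<xi>: "\<And>g. locally_const X g \<Longrightarrow> (\<And>x. x \<in> X \<Longrightarrow> 0 \<le> g x) \<Longrightarrow> I g \<le> \<xi> g" for \<xi>
    unfolding contents_def
  proof (intro CollectI conjI allI impI)
    show "\<xi> g - m g = 0" if "\<not> locally_const X g" for g using that content_undef[OF \<xi>] by (simp add: m_def)
    show "\<xi> (\<lambda>x. g x + h x) - m (\<lambda>x. g x + h x) = \<xi> g - m g + (\<xi> h - m h)"
      if "locally_const X g" "locally_const X h" for g h
      using content_add[OF \<xi> that] m_add[OF that] by simp
    show "0 \<le> \<xi> g - m g" if "locally_const X g" "\<forall>x\<in>X. 0 \<le> g x" for g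
      using m_nonneg_eq[of g] I\<xi>[of g] that by simp
    show "\<xi> (\<lambda>x. g (shift x)) - m (\<lambda>x. g (shift x)) = \<xi> g - m g" if "locally_const X g" for g
      using content_shift_1[OF \<xi> that] m_shift[OF that] by simp
  qed
  have \<phi>m: "(\<lambda>g. \<phi> g - m g) \<in> contents"
  proof (rule le[OF \<phi>])
    fix g :: "(int \<Rightarrow> 'a) \<Rightarrow> int" assume g: "locally_const X g" "\<And>x. x \<in> X \<Longrightarrow> 0 \<le> g x"
    have "g \<in> D g" using g by (simp add: D_def)
    from I_le[OF g(1) this] show "I g \<le> \<phi> g" using content_zero[OF \<psi>] by (simp add: v_def)
  qed
  have \<psi>m: "(\<lambda>g. \<psi> g - m g) \<in> contents"
  proof (rule le[OF \<psi>])
    fix g :: "(int \<Rightarrow> 'a) \<Rightarrow> int" assume g: "locally_const X g" "\<And>x. x \<in> X \<Longrightarrow> 0 \<le> g x"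
    have "(\<lambda>_. 0) \<in> D g" using g by (simp add: D_def)
    from I_le[OF g(1) this] show "I g \<le> \<psi> g" using content_zero[OF \<phi>] by (simp add: v_def)
  qed
  have "content_disj (\<lambda>g. \<phi> g - m g) (\<lambda>g. \<psi> g - m g)"
    unfolding content_disj_def
  proof (intro allI impI)
    fix e :: real assume "e > 0"
    \<comment> \<open>An almost optimal splitting of the constant 1. Being integer valued it is the
      indicator of a clopen set, and this set separates the two remainders up to e.\<close>
    then obtain a where a: "a \<in> D (\<lambda>_. 1)" "v (\<lambda>_. 1) a < I (\<lambda>_. 1) + e" using I_close[of "\<lambda>_. 1" e] by auto
    have al: "locally_const X a" "locally_const X (\<lambda>x. 1 - a x)" using a(1) lsub[of "\<lambda>_. 1" a] by (auto simp: D_def)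
    have a01: "a x \<in> {0, 1}" if "x \<in> X" for x
    proof -
      have "0 \<le> a x" "a x \<le> 1" using a(1) that by (auto simp: D_def)
      then show ?thesis by auto
    qed
    have "m a + m (\<lambda>x. 1 - a x) = I (\<lambda>_. 1)" using m_add[OF al] m_nonneg_eq[of "\<lambda>_. 1"] by simp
    then have "(\<phi> a - m a) + (\<psi> (\<lambda>x. 1 - a x) - m (\<lambda>x. 1 - a x)) < e" using a(2) by (simp add: v_def)
    moreover have "0 \<le> \<phi> a - m a" using content_nonneg[OF \<phi>m al(1)] a01 by force
    moreover have "0 \<le> \<psi> (\<lambda>x. 1 - a x) - m (\<lambda>x. 1 - a x)" using content_nonneg[OF \<psi>m al(2)] a01 by force
    ultimately show "\<exists>a. locally_const X a \<and> (\<forall>x\<in>X. a x \<in> {0, 1}) \<and> \<phi> a - m a < e \<and>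
        \<psi> (\<lambda>x. 1 - a x) - m (\<lambda>x. 1 - a x) < e" using al(1) a01 by (intro exI[of _ a]) auto
  qed
  then show ?thesis using mE \<phi>m \<psi>m by blast
qed

end

section \<open>Few special words allow few disjoint contents\<close>

text \<open>A homogeneous linear system with more unknowns than equations, by Gaussian elimination:
  equation j is solved for an unknown k with nonzero coefficient and substituted into the others.
  Below, the unknowns belong to contents and the equations to special edges.\<close>

lemma nontrivial_solution:
  fixes A :: "'i \<Rightarrow> 'j \<Rightarrow> real"
  assumes "finite J" "finite I" "card J < card I"
  shows "\<exists>c. (\<exists>i\<in>I. c i \<noteq> 0) \<and> (\<forall>j\<in>J. (\<Sum>i\<in>I. c i * A i j) = 0)"
  using assms
proof (induction J arbitrary: I A rule: finite_induct)
  case empty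
  then have "I \<noteq> {}" by auto
  then show ?case by (intro exI[of _ "\<lambda>_. 1"]) auto
next
  case (insert j J)
  show ?case
  proof (cases "\<forall>i\<in>I. A i j = 0")
    case True
    have "card J < card I" using insert.prems insert.hyps by simp
    from insert.IH[OF insert.prems(1) this, of A] show ?thesis using True by auto
  next
    case False
    then obtain k where k: "k \<in> I" "A k j \<noteq> 0" by blast
    define I' where "I' = I - {k}"
    have I': "finite I'" "k \<notin> I'" "I = insert k I'" using k(1) insert.prems(1) by (auto simp: I'_def)
    have "card J < card I'" using insert.prems insert.hyps I' by simp
    from insert.IH[OF I'(1) this, of "\<lambda>i l. A i l - A i j / A k j * A k l"]
    obtain c where c: "\<exists>i\<in>I'. c i \<noteq> 0" "\<And>l. l \<in> J \<Longrightarrow> (\<Sum>i\<in>I'. c i * (A i l - A i j / A k j * A k l)) = 0" by blast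
    define s where "s = (\<Sum>i\<in>I'. c i * A i j)"
    define d where "d = (\<lambda>i. if i = k then - s / A k j else c i)"
    have sum: "(\<Sum>i\<in>I. d i * A i l) = - s / A k j * A k l + (\<Sum>i\<in>I'. c i * A i l)" for l
    proof -
      have "(\<Sum>i\<in>I'. d i * A i l) = (\<Sum>i\<in>I'. c i * A i l)" using I'(2) by (intro sum.cong) (auto simp: d_def)
      then show ?thesis using I' by (simp add: d_def)
    qed
    have "(\<Sum>i\<in>I. d i * A i l) = 0" if "l \<in> insert j J" for l
    proof (cases "l = j")
      case True
      then show ?thesis using sum[of j] k(2) by (simp add: s_def)
    next
      case False
      then have "l \<in> J" using that by simp
      have "(\<Sum>i\<in>I'. c i * (A i l - A i j / A k j * A k l)) = (\<Sum>i\<in>I'. c i * A i l - c i * A i j * (A k l / A k j))"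
        by (intro sum.cong) (auto simp: field_simps)
      also have "\<dots> = (\<Sum>i\<in>I'. c i * A i l) - s * (A k l / A k j)"
        by (simp add: sum_subtractf s_def sum_distrib_right sum_divide_distrib)
      finally show ?thesis using c(2)[OF \<open>l \<in> J\<close>] sum[of l] by simp
    qed
    moreover have "\<exists>i\<in>I. d i \<noteq> 0" using c(1) I' by (auto simp: d_def)
    ultimately show ?thesis by blast
  qed
qed

lemma locally_const_ball:
  assumes "finite I" "\<And>i. i \<in> I \<Longrightarrow> locally_const X (P i)"
  shows "locally_const X (\<lambda>x. \<forall>i\<in>I. P i x)"
  using assms by (induction I rule: finite_induct) (auto intro: locally_const_comp2[where F = "(\<and>)"])

text \<open>In the Rauzy graph of order n these are the edges that leave vertices of out-degree at
  least two.\<close>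

definition special_edges :: "(int \<Rightarrow> 'a) set \<Rightarrow> nat \<Rightarrow> 'a list set" where
  "special_edges X n = {word x (Suc n) |x. x \<in> X \<and> word x n \<in> right_special X n}"

lemma card_special_edges:
  fixes X :: "(int \<Rightarrow> 'a::finite) set"
  shows "finite (special_edges X n)" "card (special_edges X n) \<le> card (right_special X n) * CARD('a)"
proof -
  let ?f = "\<lambda>(w :: 'a list, a). w @ [a]"
  have sub: "special_edges X n \<subseteq> ?f ` (right_special X n \<times> UNIV)"
  proof
    fix w assume "w \<in> special_edges X n"
    then obtain x where x: "w = word x (Suc n)" "word x n \<in> right_special X n" by (auto simp: special_edges_def)
    then have "w = ?f (word x n, x (int n))" by (simp add: word_Suc)
    then show "w \<in> ?f ` (right_special X n \<times> UNIV)" using x(2) by blast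
  qed
  have fin: "finite (right_special X n \<times> (UNIV :: 'a set))" by (simp add: finite_right_special)
  show "finite (special_edges X n)" using finite_subset[OF sub finite_imageI[OF fin]] .
  have "card (special_edges X n) \<le> card (right_special X n \<times> (UNIV :: 'a set))"
    using surj_card_le[OF fin sub] .
  then show "card (special_edges X n) \<le> card (right_special X n) * CARD('a)"
    by (simp add: card_cartesian_product)
qed

context minimal_infinite_subshift
begin

text \<open>Each cylinder function is a sum of functions supported on the points whose last right special
  word before the origin occurs at a given time; from this time up to the origin the point is
  determined by one letter. The summands are cohomologous to combinations of indicators of special
  edges, and finitely many of them suffice because special words occur with bounded gaps.\<close>

lemma determined_by_special_edges:
  fixes \<Lambda> :: "((int \<Rightarrow> 'a) \<Rightarrow> int) \<Rightarrow> real"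
  assumes add: "\<And>g h. locally_const X g \<Longrightarrow> locally_const X h \<Longrightarrow> \<Lambda> (\<lambda>x. g x + h x) = \<Lambda> g + \<Lambda> h"
    and sum: "\<And>(I :: 'a list set) g. finite I \<Longrightarrow> (\<And>i. i \<in> I \<Longrightarrow> locally_const X (g i)) \<Longrightarrow> \<Lambda> (\<lambda>x. \<Sum>i\<in>I. g i x) = (\<Sum>i\<in>I. \<Lambda> (g i))"
    and scale: "\<And>c g. locally_const X g \<Longrightarrow> \<Lambda> (\<lambda>x. c * g x) = real_of_int c * \<Lambda> g"
    and shift: "\<And>k g. locally_const X g \<Longrightarrow> \<Lambda> (\<lambda>x. g (shift_by k x)) = \<Lambda> g"
    and cong: "\<And>g h. (\<And>x. x \<in> X \<Longrightarrow> g x = h x) \<Longrightarrow> \<Lambda> g = \<Lambda> h"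
    and zero: "\<And>w. w \<in> special_edges X n \<Longrightarrow> \<Lambda> (\<lambda>x. if word x (Suc n) = w then 1 else 0) = 0"
    and g: "\<And>x y. x \<in> X \<Longrightarrow> y \<in> X \<Longrightarrow> word x n = word y n \<Longrightarrow> g x = g y"
  shows "\<Lambda> g = 0"
proof -
  have word_agree: "word x m = word y m" if "agree m x y" for x y m
    using that by (auto simp: word_eq_iff agree_def)
  have lw: "locally_const X (\<lambda>x. F (word x m))" for F and m
    by (rule locally_const_window[of X m]) (use word_agree in metis)
  have gl: "locally_const X g" by (rule locally_const_window[of X n]) (use word_agree g in blast)
  define R where "R x \<longleftrightarrow> word x n \<in> right_special X n" for x
  have Rl: "locally_const X R" using lw[of "\<lambda>w. w \<in> right_special X n" n] by (simp add: R_def[abs_def])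
  define noR where "noR k x \<longleftrightarrow> (\<forall>i\<in>{1..k}. \<not> R (shift_by (- int i) x))" for k x
  have nl: "locally_const X (noR k)" for k
    unfolding noR_def[abs_def]
    by (intro locally_const_ball locally_const_comp[where F = Not] locally_const_shift Rl) simp
  \<comment> \<open>\<gamma> k is the part of g on the points without a right special word at the
    times -1, ..., -k; \<delta> k is the part where the last one before the origin is at time -(k +
    1). So \<gamma> k = \<gamma> (k + 1) + \<delta> k, and \<gamma> 0 = g.\<close>
  define \<gamma> where "\<gamma> k x = (if noR k x then g x else 0)" for k x
  define \<delta> where "\<delta> k x = (if noR k x \<and> R (shift_by (- int (Suc k)) x) then g x else 0)" for k x
  have \<gamma>l: "locally_const X (\<gamma> k)" for k
    unfolding \<gamma>_def[abs_def] by (rule locally_const_comp2[OF nl gl, of "\<lambda>p v. if p then v else 0"])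
  have \<delta>l: "locally_const X (\<delta> k)" for k
    unfolding \<delta>_def[abs_def]
    by (rule locally_const_comp2[OF locally_const_comp2[OF nl locally_const_shift[OF Rl], of "(\<and>)"] gl, of "\<lambda>p v. if p then v else 0"])
  have "\<Lambda> (\<delta> k) = 0" for k
  proof -
    define h where "h x = \<delta> k (shift_by (int (Suc k)) x)" for x
    have hR: "h x = 0" if "\<not> R x" for x using that by (simp add: h_def \<delta>_def shift_by_shift_by)
    have hdet: "h y = h x" if x: "x \<in> X" "R x" "noR k (shift_by (int (Suc k)) x)" and y: "y \<in> X" "word x (Suc n) = word y (Suc n)" for x y
    proof -
      \<comment> \<open>After the special edge at the origin no right special word occurs during the
        next k steps, so every further letter is forced by the preceding word of length n.\<close>
      have same: "\<forall>i. 0 \<le> i \<and> i \<le> int n + int j \<longrightarrow> x i = y i" if "j \<le> k" for j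
        using that
      proof (induction j)
        case 0
        show ?case
        proof (intro allI impI)
          fix i assume "0 \<le> i \<and> i \<le> int n + int 0"
          then have "nat i < Suc n" "int (nat i) = i" by auto
          then show "x i = y i" using y(2) unfolding word_eq_iff by metis
        qed
      next
        case (Suc j)
        then have IH: "\<And>i. 0 \<le> i \<Longrightarrow> i \<le> int n + int j \<Longrightarrow> x i = y i" by auto
        let ?x = "shift_by (int (Suc j)) x" and ?y = "shift_by (int (Suc j)) y"
        have w: "word ?y n = word ?x n" using IH by (simp add: word_eq_iff shift_by_apply)
        have "\<not> R (shift_by (- int (k - j)) (shift_by (int (Suc k)) x))"
          using x(3) Suc.prems unfolding noR_def by (metis Suc_diff_le atLeastAtMost_iff diff_le_self le_add1 plus_1_eq_Suc Suc_leD diff_Suc_Suc)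
        moreover have "shift_by (- int (k - j)) (shift_by (int (Suc k)) x) = ?x"
          unfolding shift_by_shift_by using Suc.prems by (simp add: of_nat_diff add.commute)
        ultimately have "\<not> R ?x" by metis
        then have "?y (int n) = ?x (int n)"
          using w x(1) y(1) shift_mem unfolding R_def right_special_def by blast
        then have "x (int n + int (Suc j)) = y (int n + int (Suc j))" by (simp add: shift_by_apply)
        moreover have "i = int n + int (Suc j)" if "i \<le> int n + int (Suc j)" "\<not> i \<le> int n + int j" for i
          using that by simp
        ultimately show ?case using IH by blast
      qed
      have words: "word (shift_by (int i) x) n = word (shift_by (int i) y) n" if "i \<le> Suc k" for i
        unfolding word_eq_iff
      proof (intro allI impI)
        fix m assume "m < n"
        then show "shift_by (int i) x (int m) = shift_by (int i) y (int m)"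
          using same[OF order_refl] that by (simp add: shift_by_apply)
      qed
      have RR: "R (shift_by (- int i) (shift_by (int (Suc k)) x)) \<longleftrightarrow> R (shift_by (- int i) (shift_by (int (Suc k)) y))"
        if "i \<le> Suc k" for i
      proof -
        have "shift_by (- int i) (shift_by (int (Suc k)) z) = shift_by (int (Suc k - i)) z" for z :: "int \<Rightarrow> 'a"
          using that by (simp add: shift_by_shift_by of_nat_diff)
        then show ?thesis using words[of "Suc k - i"] by (simp add: R_def)
      qed
      have "noR k (shift_by (int (Suc k)) x) = noR k (shift_by (int (Suc k)) y)"
        unfolding noR_def by (rule ball_cong[OF refl]) (use RR in auto)
      moreover have "g (shift_by (int (Suc k)) x) = g (shift_by (int (Suc k)) y)"
        using words[of "Suc k"] x(1) y(1) by (intro g) auto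
      ultimately show ?thesis using RR[of "Suc k"] by (simp add: h_def \<delta>_def)
    qed
    have hdet': "h y = h x" if x: "x \<in> X" and y: "y \<in> X" "word x (Suc n) = word y (Suc n)" for x y
    proof -
      have "R x = R y" using y(2) by (simp add: R_def word_Suc)
      show ?thesis
      proof (cases "R x \<and> (noR k (shift_by (int (Suc k)) x) \<or> noR k (shift_by (int (Suc k)) y))")
        case True
        then show ?thesis using hdet[of x y] hdet[of y x] x y \<open>R x = R y\<close> by metis
      next
        case False
        then show ?thesis using \<open>R x = R y\<close> by (auto simp: h_def \<delta>_def shift_by_shift_by)
      qed
    qed
    define p where "p w = h (SOME x. x \<in> X \<and> word x (Suc n) = w)" for w
    have p: "p (word x (Suc n)) = h x" if "x \<in> X" for x
    proof -
      have "\<exists>z. z \<in> X \<and> word z (Suc n) = word x (Suc n)" using that by blast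
      from someI_ex[OF this] show ?thesis unfolding p_def using hdet'[OF that] by metis
    qed
    let ?ind = "\<lambda>w x. if word x (Suc n) = w then 1 else (0::int)"
    have il: "locally_const X (?ind w)" for w using lw[of "\<lambda>v. if v = w then 1 else 0" "Suc n"] .
    have "\<Lambda> (\<delta> k) = \<Lambda> h" unfolding h_def[abs_def] by (rule shift[OF \<delta>l, symmetric])
    \<comment> \<open>The translate h has a right special word at the origin on its support and
      depends on the first n + 1 letters only, so it is a combination of indicators of special
      edges.\<close>
    also have "\<dots> = \<Lambda> (\<lambda>x. \<Sum>w\<in>special_edges X n. p w * ?ind w x)"
    proof (rule cong)
      fix x assume x: "x \<in> X"
      have "(\<Sum>w\<in>special_edges X n. p w * ?ind w x) = (\<Sum>w\<in>special_edges X n. if word x (Suc n) = w then p w else 0)"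
        by (intro sum.cong) auto
      also have "\<dots> = (if word x (Suc n) \<in> special_edges X n then p (word x (Suc n)) else 0)"
        by (rule sum.delta'[OF card_special_edges(1)])
      also have "\<dots> = h x"
      proof (cases "R x")
        case True
        then have "word x (Suc n) \<in> special_edges X n" using x by (auto simp: special_edges_def R_def)
        then show ?thesis using p[OF x] by simp
      next
        case False
        have "word x (Suc n) \<notin> special_edges X n"
        proof
          assume "word x (Suc n) \<in> special_edges X n"
          then obtain z where "word x (Suc n) = word z (Suc n)" "word z n \<in> right_special X n" by (auto simp: special_edges_def)
          then show False using False by (simp add: R_def word_Suc)
        qed
        then show ?thesis using hR[OF False] by simp
      qed
      finally show "h x = (\<Sum>w\<in>special_edges X n. p w * ?ind w x)" by simp
    qed
    also have "\<dots> = (\<Sum>w\<in>special_edges X n. \<Lambda> (\<lambda>x. p w * ?ind w x))"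
      by (rule sum[OF card_special_edges(1)]) (rule locally_const_comp[OF il])
    also have "\<dots> = 0" using scale[OF il] zero by (intro sum.neutral ballI) simp
    finally show ?thesis .
  qed
  moreover have "\<Lambda> (\<gamma> k) = \<Lambda> (\<gamma> (Suc k)) + \<Lambda> (\<delta> k)" for k
  proof -
    have "noR (Suc k) x \<longleftrightarrow> noR k x \<and> \<not> R (shift_by (- int (Suc k)) x)" for x
    proof -
      have "{1..Suc k} = insert (Suc k) {1..k}" by auto
      then show ?thesis unfolding noR_def by auto
    qed
    then have "\<Lambda> (\<gamma> k) = \<Lambda> (\<lambda>x. \<gamma> (Suc k) x + \<delta> k x)"
      by (intro cong) (simp add: \<gamma>_def \<delta>_def)
    then show ?thesis using add[OF \<gamma>l \<delta>l] by simp
  qed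
  ultimately have step: "\<Lambda> (\<gamma> k) = \<Lambda> (\<gamma> (Suc k))" for k by simp
  have \<gamma>0: "\<Lambda> g = \<Lambda> (\<gamma> k)" for k
  proof (induction k)
    case 0
    show ?case by (rule cong) (simp add: \<gamma>_def noR_def)
  qed (use step in simp)
  obtain z where z: "z \<in> X" "word z n \<in> right_special X n"
    using right_special_nonempty[of n] unfolding right_special_def by blast
  obtain K where K: "\<And>x. x \<in> X \<Longrightarrow> \<exists>i. \<bar>i\<bar> \<le> int K \<and> agree n z (shift_by i x)"
    using recurrent[OF z(1)] by blast
  \<comment> \<open>A search of radius K around time -(K + 1) finds the special word of z at a time
    between -(2 K + 1) and -1.\<close>
  have "\<gamma> (2 * K + 1) x = 0" if x: "x \<in> X" for x
  proof -
    obtain i where i: "\<bar>i\<bar> \<le> int K" "agree n z (shift_by i (shift_by (- int (K + 1)) x))"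
      using K[of "shift_by (- int (K + 1)) x"] x by auto
    define j where "j = nat (int (K + 1) - i)"
    have j: "j \<in> {1..2 * K + 1}" "- int j = i + - int (K + 1)" using i(1) by (auto simp: j_def)
    have "agree n z (shift_by (- int j) x)" using i(2) unfolding shift_by_shift_by j(2) .
    then have "R (shift_by (- int j) x)" using z(2) word_agree unfolding R_def by metis
    then have "\<not> noR (2 * K + 1) x" using j(1) unfolding noR_def by blast
    then show ?thesis by (simp add: \<gamma>_def)
  qed
  then have "\<Lambda> (\<gamma> (2 * K + 1)) = \<Lambda> (\<lambda>_. 0 * 0)" by (intro cong) simp
  also have "\<dots> = 0" using scale[OF locally_const_const, of 0 0] by simp
  finally show ?thesis using \<gamma>0 by simp
qed

end

section \<open>A bound on the number of disjoint contents\<close>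

context low_complexity_subshift
begin

text \<open>With more contents than special edges at a level n, some nontrivial combination
  \<Lambda> kills all special edges and hence all functions of words of length n. Among these are,
  for large n, translates of indicators \<beta> \<phi> that nearly separate the contents; but the
  matrix of values of the contents on them is almost diagonal.\<close>

lemma card_disjoint_contents:
  assumes S: "S \<subseteq> contents" "finite S" "(\<lambda>_. 0) \<notin> S"
    and disj: "\<And>\<phi> \<psi>. \<phi> \<in> S \<Longrightarrow> \<psi> \<in> S \<Longrightarrow> \<phi> \<noteq> \<psi> \<Longrightarrow> content_disj \<phi> \<psi>"
  shows "card S \<le> C * CARD('a)"
proof (rule ccontr)
  assume "\<not> card S \<le> C * CARD('a)"
  then have big: "C * CARD('a) < card S" by simp
  then have ne: "S \<noteq> {}" by auto
  let ?one = "\<lambda>_ :: int \<Rightarrow> 'a. 1 :: int"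
  have SE: "\<phi> \<in> contents" if "\<phi> \<in> S" for \<phi> using S(1) that by blast
  have mass: "\<phi> ?one > 0" if "\<phi> \<in> S" for \<phi>
  proof -
    have "\<phi> \<noteq> (\<lambda>_. 0)" using S(3) that by blast
    then have "\<phi> ?one \<noteq> 0" using content_mass_zero[OF SE[OF that]] by blast
    then show ?thesis using content_one_nonneg[OF SE[OF that]] by simp
  qed
  define \<mu> where "\<mu> = Min ((\<lambda>\<phi>. \<phi> ?one) ` S)"
  have \<mu>: "\<mu> > 0" "\<And>\<phi>. \<phi> \<in> S \<Longrightarrow> \<mu> \<le> \<phi> ?one"
    using S(2) ne mass by (auto simp: \<mu>_def)
  define d where "d = real (card S)"
  have d: "d > 0" using S(2) ne by (simp add: d_def card_gt_0_iff)
  \<comment> \<open>Gives d * e = \<mu> / 4. With coefficients of size at most M / \<mu>, both the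
    defect on the diagonal and the sum of the other terms then stay within M / 4.\<close>
  define e where "e = \<mu> / (4 * d)"
  have e: "e > 0" using \<mu>(1) d by (simp add: e_def)
  have "\<exists>a. locally_const X a \<and> (\<forall>x\<in>X. a x \<in> {0, 1}) \<and> \<psi> a < e \<and> \<phi> (\<lambda>x. 1 - a x) < e"
    if "\<phi> \<in> S" "\<psi> \<in> S" "\<phi> \<noteq> \<psi>" for \<phi> \<psi>
    using disj[of \<psi> \<phi>] that e unfolding content_disj_def by blast
  then obtain a where a: "\<And>\<phi> \<psi>. \<phi> \<in> S \<Longrightarrow> \<psi> \<in> S \<Longrightarrow> \<phi> \<noteq> \<psi> \<Longrightarrow> locally_const X (a \<phi> \<psi>) \<and>
      (\<forall>x\<in>X. a \<phi> \<psi> x \<in> {0, 1}) \<and> \<psi> (a \<phi> \<psi>) < e \<and> \<phi> (\<lambda>x. 1 - a \<phi> \<psi> x) < e"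
    by metis
  \<comment> \<open>The indicator of the intersection of the sets that separate \<phi> from each
    other content: almost full for \<phi>, almost null for the rest.\<close>
  define \<beta> where "\<beta> \<phi> x = (\<Prod>\<psi>\<in>S - {\<phi>}. a \<phi> \<psi> x)" for \<phi> x
  have \<beta>l: "locally_const X (\<beta> \<phi>)" if "\<phi> \<in> S" for \<phi>
    unfolding \<beta>_def[abs_def] using that a S(2) by (intro locally_const_prod) auto
  have \<beta>01: "\<beta> \<phi> x \<in> {0, 1}" if "\<phi> \<in> S" "x \<in> X" for \<phi> x
  proof (cases "\<forall>\<psi>\<in>S - {\<phi>}. a \<phi> \<psi> x = 1")
    case False
    then obtain \<psi> where \<psi>: "\<psi> \<in> S - {\<phi>}" "a \<phi> \<psi> x \<noteq> 1" by blast
    then have "a \<phi> \<psi> x = 0" using a[of \<phi> \<psi>] that by blast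
    then have "\<beta> \<phi> x = 0" unfolding \<beta>_def using \<psi>(1) S(2) by (intro prod_zero) auto
    then show ?thesis by simp
  qed (simp add: \<beta>_def)
  have \<beta>_other: "\<psi> (\<beta> \<phi>) \<le> e" if "\<phi> \<in> S" "\<psi> \<in> S" "\<phi> \<noteq> \<psi>" for \<phi> \<psi>
  proof -
    have "\<psi> (\<beta> \<phi>) \<le> \<psi> (a \<phi> \<psi>)"
    proof (rule content_mono[OF SE[OF that(2)] \<beta>l[OF that(1)]])
      show "locally_const X (a \<phi> \<psi>)" using a that by blast
      fix x assume x: "x \<in> X"
      then have a01: "a \<phi> \<psi> x \<in> {0, 1}" using a that by blast
      show "\<beta> \<phi> x \<le> a \<phi> \<psi> x"
      proof (cases "a \<phi> \<psi> x = 0")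
        case True
        then have "\<beta> \<phi> x = 0" unfolding \<beta>_def using that S(2) by (intro prod_zero) auto
        then show ?thesis using True by simp
      qed (use a01 \<beta>01[OF that(1) x] in auto)
    qed
    then show ?thesis using a[OF that] by simp
  qed
  have \<beta>_self: "\<phi> ?one - d * e \<le> \<phi> (\<beta> \<phi>)" if \<phi>: "\<phi> \<in> S" for \<phi>
  proof -
    have al: "locally_const X (\<lambda>x. 1 - a \<phi> \<psi> x)" if "\<psi> \<in> S - {\<phi>}" for \<psi>
      using a[of \<phi> \<psi>] that \<phi> by (intro locally_const_comp[where F = "\<lambda>v. 1 - v"]) blast
    have bl: "locally_const X (\<lambda>x. 1 - \<beta> \<phi> x)" by (rule locally_const_comp[OF \<beta>l[OF \<phi>]])
    have "\<phi> (\<lambda>x. 1 - \<beta> \<phi> x) \<le> \<phi> (\<lambda>x. \<Sum>\<psi>\<in>S - {\<phi>}. 1 - a \<phi> \<psi> x)"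
    proof (rule content_mono[OF SE[OF \<phi>] bl])
      show "locally_const X (\<lambda>x. \<Sum>\<psi>\<in>S - {\<phi>}. 1 - a \<phi> \<psi> x)" using S(2) al by (intro locally_const_sum) auto
      fix x assume x: "x \<in> X"
      have nn: "0 \<le> 1 - a \<phi> \<psi> x" if "\<psi> \<in> S - {\<phi>}" for \<psi> using a[of \<phi> \<psi>] that \<phi> x by force
      show "1 - \<beta> \<phi> x \<le> (\<Sum>\<psi>\<in>S - {\<phi>}. 1 - a \<phi> \<psi> x)"
      proof (cases "\<forall>\<psi>\<in>S - {\<phi>}. a \<phi> \<psi> x = 1")
        case True
        then show ?thesis by (simp add: \<beta>_def)
      next
        case False
        then obtain \<psi> where \<psi>: "\<psi> \<in> S - {\<phi>}" "a \<phi> \<psi> x \<noteq> 1" by blast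
        then have "a \<phi> \<psi> x = 0" using a[of \<phi> \<psi>] \<phi> x by blast
        then have "1 \<le> (\<Sum>\<psi>\<in>S - {\<phi>}. 1 - a \<phi> \<psi> x)"
          using member_le_sum[of \<psi> "S - {\<phi>}" "\<lambda>\<psi>. 1 - a \<phi> \<psi> x"] \<psi>(1) nn S(2) by simp
        then show ?thesis using \<beta>01[OF \<phi> x] by auto
      qed
    qed
    also have "\<dots> = (\<Sum>\<psi>\<in>S - {\<phi>}. \<phi> (\<lambda>x. 1 - a \<phi> \<psi> x))"
      using S(2) al by (intro content_sum[OF SE[OF \<phi>]]) auto
    also have "\<dots> \<le> (\<Sum>\<psi>\<in>S - {\<phi>}. e)"
      using a \<phi> by (intro sum_mono less_imp_le) blast
    also have "\<dots> \<le> d * e"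
      using e S(2) by (simp add: d_def card_Diff_subset_Int mult_right_mono card_mono)
    finally show ?thesis
      using content_diff[OF SE[OF \<phi>] locally_const_const \<beta>l[OF \<phi>], of 1] by simp
  qed
  have "\<exists>r. \<forall>x\<in>X. \<forall>y\<in>X. agree r x y \<longrightarrow> \<beta> \<phi> x = \<beta> \<phi> y" if "\<phi> \<in> S" for \<phi>
    using locally_const_uniform[OF \<beta>l[OF that]] by metis
  then obtain r where r: "\<And>\<phi> x y. \<phi> \<in> S \<Longrightarrow> x \<in> X \<Longrightarrow> y \<in> X \<Longrightarrow> agree (r \<phi>) x y \<Longrightarrow> \<beta> \<phi> x = \<beta> \<phi> y"
    by metis
  define R where "R = Max (r ` S)"
  have R: "\<beta> \<phi> x = \<beta> \<phi> y" if "\<phi> \<in> S" "x \<in> X" "y \<in> X" "agree R x y" for \<phi> x y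
    using r[OF that(1-3)] agree_mono[OF that(4), of "r \<phi>"] S(2) that(1) by (simp add: R_def)
  \<comment> \<open>A window of radius R has 2 R + 1 letters and fits into a word of length n after
    translation by R.\<close>
  obtain n where n: "n \<ge> 2 * R + 1" "card (right_special X n) \<le> C" using few_right_special by blast
  let ?ind = "\<lambda>w x. if word x (Suc n) = w then 1 else (0::int)"
  have "card (special_edges X n) \<le> card (right_special X n) * CARD('a)" by (rule card_special_edges)
  also have "\<dots> \<le> C * CARD('a)" using n(2) by (intro mult_right_mono) auto
  finally have "card (special_edges X n) < card S" using big by simp
  from nontrivial_solution[OF card_special_edges(1) S(2) this, of "\<lambda>\<phi> w. \<phi> (?ind w)"]
  obtain c where c: "\<exists>\<phi>\<in>S. c \<phi> \<noteq> 0" "\<And>w. w \<in> special_edges X n \<Longrightarrow> (\<Sum>\<phi>\<in>S. c \<phi> * \<phi> (?ind w)) = 0" by blast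
  define \<Lambda> where "\<Lambda> g = (\<Sum>\<phi>\<in>S. c \<phi> * \<phi> g)" for g
  have \<Lambda>\<beta>: "\<Lambda> (\<beta> \<psi>) = 0" if \<psi>: "\<psi> \<in> S" for \<psi>
  proof -
    have "\<Lambda> (\<lambda>x. \<beta> \<psi> (shift_by (int R) x)) = 0"
    proof (rule determined_by_special_edges[of \<Lambda> n])
      show "\<Lambda> (\<lambda>x. g x + h x) = \<Lambda> g + \<Lambda> h" if "locally_const X g" "locally_const X h" for g h
        unfolding \<Lambda>_def sum.distrib[symmetric]
        by (intro sum.cong) (simp_all add: content_add[OF SE that] distrib_left)
      show "\<Lambda> (\<lambda>x. \<Sum>i\<in>I. g i x) = (\<Sum>i\<in>I. \<Lambda> (g i))"
        if I: "finite I" "\<And>i. i \<in> I \<Longrightarrow> locally_const X (g i)" for I :: "'a list set" and g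
      proof -
        have "\<Lambda> (\<lambda>x. \<Sum>i\<in>I. g i x) = (\<Sum>\<phi>\<in>S. \<Sum>i\<in>I. c \<phi> * \<phi> (g i))"
          unfolding \<Lambda>_def
        proof (intro sum.cong refl)
          fix \<phi> assume "\<phi> \<in> S"
          from content_sum[OF SE[OF this] I] show "c \<phi> * \<phi> (\<lambda>x. \<Sum>i\<in>I. g i x) = (\<Sum>i\<in>I. c \<phi> * \<phi> (g i))"
            by (simp only: sum_distrib_left)
        qed
        also have "\<dots> = (\<Sum>i\<in>I. \<Lambda> (g i))" unfolding \<Lambda>_def by (rule sum.swap)
        finally show ?thesis .
      qed
      show "\<Lambda> (\<lambda>x. k * g x) = real_of_int k * \<Lambda> g" if "locally_const X g" for k g
        unfolding \<Lambda>_def sum_distrib_left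
        by (intro sum.cong) (simp_all add: content_scale[OF SE that])
      show "\<Lambda> (\<lambda>x. g (shift_by k x)) = \<Lambda> g" if "locally_const X g" for k g
        unfolding \<Lambda>_def by (intro sum.cong) (simp_all add: content_shift[OF SE that])
      show "\<Lambda> g = \<Lambda> h" if "\<And>x. x \<in> X \<Longrightarrow> g x = h x" for g h
        unfolding \<Lambda>_def using content_cong[OF SE that] by (intro sum.cong arg_cong2[where f = "(*)"] refl)
      show "\<Lambda> (\<lambda>x. if word x (Suc n) = w then 1 else 0) = 0" if "w \<in> special_edges X n" for w
        unfolding \<Lambda>_def by (rule c(2)[OF that])
      fix x y assume xy: "x \<in> X" "y \<in> X" "word x n = word y n"
      have "agree R (shift_by (int R) x) (shift_by (int R) y)"
        unfolding agree_def
      proof (intro allI impI)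
        fix i assume i: "\<bar>i\<bar> \<le> int R"
        then have "nat (i + int R) < n" using n(1) by linarith
        then have "x (int (nat (i + int R))) = y (int (nat (i + int R)))" using xy(3) unfolding word_eq_iff by blast
        moreover have "0 \<le> i + int R" using i by linarith
        ultimately show "shift_by (int R) x i = shift_by (int R) y i" by (simp add: shift_by_apply)
      qed
      then show "\<beta> \<psi> (shift_by (int R) x) = \<beta> \<psi> (shift_by (int R) y)" using R[OF \<psi>] xy by simp
    qed
    moreover have "\<Lambda> (\<lambda>x. \<beta> \<psi> (shift_by (int R) x)) = \<Lambda> (\<beta> \<psi>)"
      unfolding \<Lambda>_def by (intro sum.cong) (simp_all add: content_shift[OF SE \<beta>l[OF \<psi>]])
    ultimately show ?thesis by simp
  qed
  \<comment> \<open>The contents are not normalised, so the coefficients are weighted by mass. For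
    the maximiser \<psi> the diagonal term is at least 3 M / 4 in size, while the others sum to at
    most M / 4.\<close>
  define M where "M = Max ((\<lambda>\<phi>. \<bar>c \<phi>\<bar> * \<phi> ?one) ` S)"
  have M_ge: "\<bar>c \<phi>\<bar> * \<phi> ?one \<le> M" if "\<phi> \<in> S" for \<phi> using S(2) that by (simp add: M_def)
  have "M \<in> (\<lambda>\<phi>. \<bar>c \<phi>\<bar> * \<phi> ?one) ` S" unfolding M_def using S(2) ne by (intro Max_in) auto
  then obtain \<psi> where \<psi>: "\<psi> \<in> S" "M = \<bar>c \<psi>\<bar> * \<psi> ?one" by blast
  have M: "M > 0"
  proof -
    obtain \<phi> where "\<phi> \<in> S" "c \<phi> \<noteq> 0" using c(1) by blast
    then have "0 < \<bar>c \<phi>\<bar> * \<phi> ?one" using mass by simp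
    then show ?thesis using M_ge[OF \<open>\<phi> \<in> S\<close>] by simp
  qed
  have c_le: "\<bar>c \<phi>\<bar> \<le> M / \<mu>" if "\<phi> \<in> S" for \<phi>
  proof -
    have "\<bar>c \<phi>\<bar> * \<mu> \<le> \<bar>c \<phi>\<bar> * \<phi> ?one" using \<mu>(2)[OF that] by (intro mult_left_mono) auto
    also have "\<dots> \<le> M" by (rule M_ge[OF that])
    finally show ?thesis using \<mu>(1) by (simp add: field_simps)
  qed
  have \<beta>nn: "0 \<le> \<phi> (\<beta> \<psi>)" if "\<phi> \<in> S" for \<phi>
    using content_nonneg[OF SE[OF that] \<beta>l[OF \<psi>(1)]] \<beta>01[OF \<psi>(1)] by force
  have "c \<psi> * \<psi> (\<beta> \<psi>) = - (\<Sum>\<phi>\<in>S - {\<psi>}. c \<phi> * \<phi> (\<beta> \<psi>))"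
    using \<Lambda>\<beta>[OF \<psi>(1)] sum.remove[OF S(2) \<psi>(1), of "\<lambda>\<phi>. c \<phi> * \<phi> (\<beta> \<psi>)"] by (simp add: \<Lambda>_def)
  moreover have "\<bar>c \<psi>\<bar> * \<psi> (\<beta> \<psi>) = \<bar>c \<psi> * \<psi> (\<beta> \<psi>)\<bar>" using \<beta>nn[OF \<psi>(1)] by (simp add: abs_mult)
  ultimately have "\<bar>c \<psi>\<bar> * \<psi> (\<beta> \<psi>) = \<bar>\<Sum>\<phi>\<in>S - {\<psi>}. c \<phi> * \<phi> (\<beta> \<psi>)\<bar>" by simp
  also have "\<dots> \<le> (\<Sum>\<phi>\<in>S - {\<psi>}. \<bar>c \<phi> * \<phi> (\<beta> \<psi>)\<bar>)" by (rule sum_abs)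
  also have "\<dots> \<le> (\<Sum>\<phi>\<in>S - {\<psi>}. M / \<mu> * e)"
  proof (rule sum_mono)
    fix \<phi> assume "\<phi> \<in> S - {\<psi>}"
    then show "\<bar>c \<phi> * \<phi> (\<beta> \<psi>)\<bar> \<le> M / \<mu> * e"
      using c_le[of \<phi>] \<beta>nn[of \<phi>] \<beta>_other[OF \<psi>(1), of \<phi>] M \<mu>(1) unfolding abs_mult by (intro mult_mono) auto
  qed
  also have "\<dots> \<le> d * (M / \<mu> * e)"
  proof -
    have "real (card (S - {\<psi>})) \<le> d" using S(2) by (simp add: d_def card_mono)
    then have "real (card (S - {\<psi>})) * (M / \<mu> * e) \<le> d * (M / \<mu> * e)" using M \<mu>(1) e by (intro mult_right_mono) auto
    then show ?thesis by simp
  qed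
  also have "\<dots> = M / 4" using \<mu>(1) d by (simp add: e_def)
  finally have upper: "\<bar>c \<psi>\<bar> * \<psi> (\<beta> \<psi>) \<le> M / 4" .
  have "\<bar>c \<psi>\<bar> * (\<psi> ?one - d * e) \<le> \<bar>c \<psi>\<bar> * \<psi> (\<beta> \<psi>)" using \<beta>_self[OF \<psi>(1)] by (intro mult_left_mono) auto
  then have "M - \<bar>c \<psi>\<bar> * (d * e) \<le> M / 4" using upper \<psi>(2) by (simp add: right_diff_distrib)
  moreover have "\<bar>c \<psi>\<bar> * (d * e) \<le> M / \<mu> * (d * e)" using c_le[OF \<psi>(1)] d e by (intro mult_right_mono) auto
  moreover have "M / \<mu> * (d * e) = M / 4" using \<mu>(1) d by (simp add: e_def)
  ultimately show False using M by simp
qed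

sublocale contents: lattice_cone contents "\<lambda>_. 1" content_disj "C * CARD('a)"
proof
  show "(\<lambda>g. c * \<phi> g) \<in> contents" if "\<phi> \<in> contents" "0 \<le> c" for \<phi> c
    by (rule content_scale_mem[OF that])
  show "(\<lambda>g. \<phi> g + \<psi> g) \<in> contents" if "\<phi> \<in> contents" "\<psi> \<in> contents" for \<phi> \<psi>
    by (rule content_add_mem[OF that])
  show "0 \<le> \<phi> (\<lambda>_. 1)" if "\<phi> \<in> contents" for \<phi>
    by (rule content_one_nonneg[OF that])
  show "\<phi> = (\<lambda>_. 0)" if "\<phi> \<in> contents" "\<phi> (\<lambda>_. 1) = 0" for \<phi>
    by (rule content_mass_zero[OF that])
  show "\<exists>m\<in>contents. (\<lambda>g. \<phi> g - m g) \<in> contents \<and> (\<lambda>g. \<psi> g - m g) \<in> contents \<and>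
      content_disj (\<lambda>g. \<phi> g - m g) (\<lambda>g. \<psi> g - m g)" if "\<phi> \<in> contents" "\<psi> \<in> contents" for \<phi> \<psi>
    by (rule content_split[OF that])
  show "content_disj \<psi> \<phi>" if "content_disj \<phi> \<psi>" for \<phi> \<psi>
    by (rule content_disj_sym[OF that])
  show "content_disj \<phi>' \<psi>" if "content_disj \<phi> \<psi>" "\<phi>' \<in> contents" "(\<lambda>g. \<phi> g - \<phi>' g) \<in> contents" for \<phi> \<phi>' \<psi>
    by (rule content_disj_mono[OF that(1,3)])
  show "content_disj (\<lambda>g. c * \<phi> g) \<psi>" if "content_disj \<phi> \<psi>" "0 \<le> c" for \<phi> \<psi> c
    by (rule content_disj_scale[OF that])
  show "\<phi> = (\<lambda>_. 0)" if "\<phi> \<in> contents" "content_disj \<phi> \<phi>" for \<phi>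
    by (rule content_disj_self[OF that])
  show "card S \<le> C * CARD('a)" if "S \<subseteq> contents" "finite S" "(\<lambda>_. 0) \<notin> S"
    "\<And>\<phi> \<psi>. \<phi> \<in> S \<Longrightarrow> \<psi> \<in> S \<Longrightarrow> \<phi> \<noteq> \<psi> \<Longrightarrow> content_disj \<phi> \<psi>" for S
    by (rule card_disjoint_contents[OF that])
qed

end

section \<open>Quotients of groups acting on finite sets\<close>

text \<open>The subgroup is the image of the pointwise stabiliser K of S, which is abelian modulo N
  by \<open>comm\<close>. Its index is finite because the coset of f is determined by the self-map
  of S that f induces.\<close>

lemma virtually_abelian_Mod:
  assumes G: "group G" and N: "N \<lhd> G" and S: "finite S"
    and act_closed: "\<And>f s. f \<in> carrier G \<Longrightarrow> s \<in> S \<Longrightarrow> act f s \<in> S"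
    and act_mult: "\<And>f g s. f \<in> carrier G \<Longrightarrow> g \<in> carrier G \<Longrightarrow> s \<in> S \<Longrightarrow> act (f \<otimes>\<^bsub>G\<^esub> g) s = act f (act g s)"
    and act_one: "\<And>s. s \<in> S \<Longrightarrow> act \<one>\<^bsub>G\<^esub> s = s"
    and comm: "\<And>f g. f \<in> carrier G \<Longrightarrow> g \<in> carrier G \<Longrightarrow> (\<And>s. s \<in> S \<Longrightarrow> act f s = s) \<Longrightarrow>
      (\<And>s. s \<in> S \<Longrightarrow> act g s = s) \<Longrightarrow> f \<otimes>\<^bsub>G\<^esub> g \<otimes>\<^bsub>G\<^esub> inv\<^bsub>G\<^esub> (g \<otimes>\<^bsub>G\<^esub> f) \<in> N"
  shows "virtually_abelian (G Mod N)"
proof -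
  interpret G: group G by (rule G)
  interpret N: normal N G by (rule N)
  define Q where "Q = G Mod N"
  define \<pi> where "\<pi> f = N #>\<^bsub>G\<^esub> f" for f
  interpret Q: group Q unfolding Q_def by (rule N.factorgroup_is_group)
  have hom: "\<pi> \<in> hom G Q" unfolding \<pi>_def[abs_def] Q_def by (rule N.r_coset_hom_Mod)
  interpret \<pi>: group_hom G Q \<pi> by unfold_locales (rule hom)
  define K where "K = {f \<in> carrier G. \<forall>s\<in>S. act f s = s}"
  have inv_act: "act f (act (inv\<^bsub>G\<^esub> f) s) = s" "act (inv\<^bsub>G\<^esub> f) (act f s) = s" if "f \<in> carrier G" "s \<in> S" for f s
    using act_mult[of f "inv\<^bsub>G\<^esub> f" s] act_mult[of "inv\<^bsub>G\<^esub> f" f s] act_one that by auto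
  have K: "subgroup K G"
  proof (rule G.subgroupI)
    show "K \<subseteq> carrier G" by (auto simp: K_def)
    have "\<one>\<^bsub>G\<^esub> \<in> K" using act_one by (simp add: K_def)
    then show "K \<noteq> {}" by blast
    show "inv\<^bsub>G\<^esub> f \<in> K" if "f \<in> K" for f
    proof -
      have "act (inv\<^bsub>G\<^esub> f) s = s" if s: "s \<in> S" for s
        using inv_act(2)[of f s] s \<open>f \<in> K\<close> by (simp add: K_def)
      then show ?thesis using that by (simp add: K_def)
    qed
    show "f \<otimes>\<^bsub>G\<^esub> g \<in> K" if "f \<in> K" "g \<in> K" for f g
      using that act_mult by (simp add: K_def)
  qed
  define H where "H = \<pi> ` K"
  have H: "subgroup H Q" unfolding H_def by (rule \<pi>.subgroup_img_is_subgroup[OF K])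
  have "comm_group (Q\<lparr>carrier := H\<rparr>)"
  proof (rule group.group_comm_groupI)
    show "group (Q\<lparr>carrier := H\<rparr>)" by (rule Q.subgroup_imp_group[OF H])
    fix a b assume "a \<in> carrier (Q\<lparr>carrier := H\<rparr>)" "b \<in> carrier (Q\<lparr>carrier := H\<rparr>)"
    then obtain f g where fg: "f \<in> K" "g \<in> K" "a = \<pi> f" "b = \<pi> g" by (auto simp: H_def)
    then have c: "f \<in> carrier G" "g \<in> carrier G" by (auto simp: K_def)
    let ?h = "f \<otimes>\<^bsub>G\<^esub> g \<otimes>\<^bsub>G\<^esub> inv\<^bsub>G\<^esub> (g \<otimes>\<^bsub>G\<^esub> f)"
    have h: "?h \<in> N" using fg(1,2) c by (intro comm) (auto simp: K_def)
    have "?h \<otimes>\<^bsub>G\<^esub> (g \<otimes>\<^bsub>G\<^esub> f) = f \<otimes>\<^bsub>G\<^esub> g" using c by (simp add: G.m_assoc)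
    then have "f \<otimes>\<^bsub>G\<^esub> g \<in> N #>\<^bsub>G\<^esub> (g \<otimes>\<^bsub>G\<^esub> f)" using G.rcosI[OF h N.subset, of "g \<otimes>\<^bsub>G\<^esub> f"] c by simp
    then have "\<pi> (g \<otimes>\<^bsub>G\<^esub> f) = \<pi> (f \<otimes>\<^bsub>G\<^esub> g)"
      unfolding \<pi>_def using c by (intro G.repr_independence N.subgroup_axioms) auto
    then show "a \<otimes>\<^bsub>Q\<lparr>carrier := H\<rparr>\<^esub> b = b \<otimes>\<^bsub>Q\<lparr>carrier := H\<rparr>\<^esub> a"
      using c fg(3,4) by simp
  qed
  moreover have "finite (rcosets\<^bsub>Q\<^esub> H)"
  proof -
    \<comment> \<open>Restriction makes the induced map an element of the finite set of extensional
      self-maps of S, which bounds the number of cosets.\<close>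
    define \<theta> where "\<theta> f = restrict (act f) S" for f
    define F where "F f = H #>\<^bsub>Q\<^esub> \<pi> f" for f
    have F: "F f = F g" if fg: "f \<in> carrier G" "g \<in> carrier G" "\<theta> f = \<theta> g" for f g
    proof -
      have "f \<otimes>\<^bsub>G\<^esub> inv\<^bsub>G\<^esub> g \<in> K"
      proof -
        have "act f (act (inv\<^bsub>G\<^esub> g) s) = act g (act (inv\<^bsub>G\<^esub> g) s)" if "s \<in> S" for s
          using fun_cong[OF fg(3), of "act (inv\<^bsub>G\<^esub> g) s"] act_closed[of "inv\<^bsub>G\<^esub> g" s] fg(2) that by (simp add: \<theta>_def)
        then show ?thesis using fg inv_act(1) act_mult by (simp add: K_def)
      qed
      then have "\<pi> (f \<otimes>\<^bsub>G\<^esub> inv\<^bsub>G\<^esub> g) \<in> H" by (simp add: H_def)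
      moreover have "\<pi> (f \<otimes>\<^bsub>G\<^esub> inv\<^bsub>G\<^esub> g) \<otimes>\<^bsub>Q\<^esub> \<pi> g = \<pi> f"
      proof -
        have "f \<otimes>\<^bsub>G\<^esub> inv\<^bsub>G\<^esub> g \<otimes>\<^bsub>G\<^esub> g = f" using fg by (simp add: G.m_assoc)
        then show ?thesis using \<pi>.hom_mult[of "f \<otimes>\<^bsub>G\<^esub> inv\<^bsub>G\<^esub> g" g] fg by simp
      qed
      ultimately have "\<pi> f \<in> H #>\<^bsub>Q\<^esub> \<pi> g"
        using Q.rcosI[of "\<pi> (f \<otimes>\<^bsub>G\<^esub> inv\<^bsub>G\<^esub> g)" H "\<pi> g"] subgroup.subset[OF H] fg by simp
      then have "H #>\<^bsub>Q\<^esub> \<pi> g = H #>\<^bsub>Q\<^esub> \<pi> f" using Q.repr_independence[of "\<pi> f" H "\<pi> g"] fg H by simp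
      then show ?thesis by (simp add: F_def)
    qed
    have "rcosets\<^bsub>Q\<^esub> H \<subseteq> (\<lambda>p. F (SOME f. f \<in> carrier G \<and> \<theta> f = p)) ` (S \<rightarrow>\<^sub>E S)"
    proof
      fix r assume "r \<in> rcosets\<^bsub>Q\<^esub> H"
      then obtain q where q: "q \<in> carrier Q" "r = H #>\<^bsub>Q\<^esub> q" by (auto simp: RCOSETS_def)
      then obtain f where f: "f \<in> carrier G" "q = \<pi> f" by (auto simp: Q_def FactGroup_def RCOSETS_def \<pi>_def)
      define f' where "f' = (SOME f'. f' \<in> carrier G \<and> \<theta> f' = \<theta> f)"
      have "f' \<in> carrier G \<and> \<theta> f' = \<theta> f" unfolding f'_def by (rule someI[of _ f]) (use f in simp)
      then have "r = F f'" using F[of f f'] f q by (simp add: F_def)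
      moreover have "\<theta> f \<in> S \<rightarrow>\<^sub>E S" using act_closed f(1) by (auto simp: \<theta>_def)
      ultimately show "r \<in> (\<lambda>p. F (SOME f. f \<in> carrier G \<and> \<theta> f = p)) ` (S \<rightarrow>\<^sub>E S)" unfolding f'_def by blast
    qed
    moreover have "finite (S \<rightarrow>\<^sub>E S)" using S by (intro finite_PiE) auto
    ultimately show ?thesis by (meson finite_imageI finite_subset)
  qed
  ultimately show ?thesis
    unfolding virtually_abelian_def using Q.is_group H by (auto simp: Q_def)
qed

section \<open>Invariant measures and infinitesimals\<close>

context minimal_infinite_subshift
begin

text \<open>Locally constant functions are bounded and measurable, hence integrable; invariance of
  \<mu> on Borel sets says that \<mu> is its own image under the shift, and integrals are
  transported.\<close>

lemma measure_content:
  assumes \<mu>: "invariant_borel_prob X \<mu>"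
  shows "(\<lambda>g. if locally_const X g then \<integral>x. real_of_int (g x) \<partial>\<mu> else 0) \<in> contents"
proof -
  interpret prob_space \<mu> using \<mu> by (simp add: invariant_borel_prob_def)
  have sp: "space \<mu> = X" and sets: "sets \<mu> = sigma_sets X {U. openin (shift_space X) U}"
    and inv: "\<And>B. B \<in> sets \<mu> \<Longrightarrow> emeasure \<mu> (shift -` B \<inter> X) = emeasure \<mu> B"
    using \<mu> by (auto simp: invariant_borel_prob_def)
  have opn: "U \<in> sets \<mu>" if "openin (shift_space X) U" for U
    using that unfolding sets by (intro sigma_sets.Basic) simp
  have meas: "(\<lambda>x. real_of_int (g x)) \<in> borel_measurable \<mu>" if g: "locally_const X g" for g
  proof -
    have "g \<in> measurable \<mu> (count_space UNIV)"
    proof (rule measurableI)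
      fix A
      have "openin (shift_space X) {x \<in> topspace (shift_space X). g x \<in> A}"
        using g unfolding continuous_map_discrete_iff[symmetric] continuous_map_def by simp
      moreover have "{x \<in> topspace (shift_space X). g x \<in> A} = g -` A \<inter> space \<mu>" using sp by auto
      ultimately show "g -` A \<inter> space \<mu> \<in> sets \<mu>" using opn by simp
    qed simp
    then show ?thesis by (rule measurable_compose) simp
  qed
  have int: "integrable \<mu> (\<lambda>x. real_of_int (g x))" if g: "locally_const X g" for g
  proof -
    obtain M where M: "\<And>x. x \<in> X \<Longrightarrow> \<bar>g x\<bar> \<le> int M" using locally_const_bounded[OF g] by blast
    show ?thesis
    proof (rule integrable_const_bound[where B = "real M"])
      show "AE x in \<mu>. norm (real_of_int (g x)) \<le> real M"
      proof (rule AE_I2)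
        fix x assume "x \<in> space \<mu>"
        then have "real_of_int \<bar>g x\<bar> \<le> real_of_int (int M)" using M sp by (simp only: of_int_le_iff)
        then show "norm (real_of_int (g x)) \<le> real M" by simp
      qed
    qed (rule meas[OF g])
  qed
  have shift_meas: "shift \<in> measurable \<mu> \<mu>"
  proof (rule measurable_sigma_sets[OF sets])
    show "{U. openin (shift_space X) U} \<subseteq> Pow X" by (auto simp: openin_shift_space_iff)
    show "shift \<in> space \<mu> \<rightarrow> X" using sp by auto
    fix U assume U: "U \<in> {U. openin (shift_space X) U}"
    have "openin (shift_space X) (shift -` U \<inter> X)"
      unfolding openin_shift_space_iff
    proof (intro conjI ballI)
      fix x assume "x \<in> shift -` U \<inter> X"
      then obtain n where n: "\<forall>y\<in>X. agree n (shift x) y \<longrightarrow> y \<in> U" using U unfolding openin_shift_space_iff by blast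
      have "y \<in> shift -` U \<inter> X" if "y \<in> X" "agree (n + nat \<bar>1\<bar>) x y" for y
        using n agree_shift[OF that(2)] that(1) by auto
      then show "\<exists>n. \<forall>y\<in>X. agree n x y \<longrightarrow> y \<in> shift -` U \<inter> X" by blast
    qed blast
    then show "shift -` U \<inter> space \<mu> \<in> sets \<mu>" using opn sp by simp
  qed
  have distr: "distr \<mu> \<mu> shift = \<mu>"
    by (rule measure_eqI) (use inv sp shift_meas in \<open>simp_all add: emeasure_distr\<close>)
  show ?thesis
    unfolding contents_def
  proof (intro CollectI conjI allI impI; simp only: if_True if_False)
    fix g h :: "(int \<Rightarrow> 'a) \<Rightarrow> int" assume g: "locally_const X g" and h: "locally_const X h"
    then show "(if locally_const X (\<lambda>x. g x + h x) then \<integral>x. real_of_int (g x + h x) \<partial>\<mu> else 0) =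
        (\<integral>x. real_of_int (g x) \<partial>\<mu>) + (\<integral>x. real_of_int (h x) \<partial>\<mu>)"
      using locally_const_comp2[OF g h, of "(+)"] int by simp
  next
    fix g :: "(int \<Rightarrow> 'a) \<Rightarrow> int" assume "locally_const X g" "\<forall>x\<in>X. 0 \<le> g x"
    then show "0 \<le> (\<integral>x. real_of_int (g x) \<partial>\<mu>)" using sp by (intro integral_nonneg_AE AE_I2) auto
  next
    fix g :: "(int \<Rightarrow> 'a) \<Rightarrow> int" assume g: "locally_const X g"
    have "(\<integral>x. real_of_int (g (shift x)) \<partial>\<mu>) = (\<integral>x. real_of_int (g x) \<partial>distr \<mu> \<mu> shift)"
      by (rule integral_distr[OF shift_meas meas[OF g], symmetric])
    then show "(if locally_const X (\<lambda>x. g (shift x)) then \<integral>x. real_of_int (g (shift x)) \<partial>\<mu> else 0) =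
        (\<integral>x. real_of_int (g x) \<partial>\<mu>)"
      using locally_const_shift[OF g, of 1] distr by simp
  qed
qed

text \<open>Integration against an invariant measure is a content, so g is infinitesimal and its
  class is the trivial coset. Since 0 is a coboundary, g lies in its own coset, which is the group
  of coboundaries.\<close>

lemma coboundary_of_vanishing_contents:
  assumes inf: "infinitesimals X = {\<one>\<^bsub>coinvariants X\<^esub>}"
    and g: "locally_const X g" and 0: "\<And>\<phi>. \<phi> \<in> contents \<Longrightarrow> \<phi> g = 0"
  obtains h where "locally_const X h" "\<And>x. x \<in> X \<Longrightarrow> g x = h x - h (shift_by (- 1) x)"
proof -
  let ?C = "cont_int_group X" and ?B = "coboundaries X"
  define \<gamma> where "\<gamma> = restrict g X"
  have ca: "u \<in> carrier ?C \<longleftrightarrow> u \<in> extensional X \<and> locally_const X u" for u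
    by (simp add: cont_int_group_def continuous_map_discrete_iff)
  have gl: "locally_const X \<gamma>" using g locally_const_cong[of X \<gamma> g] by (simp add: \<gamma>_def)
  then have \<gamma>: "\<gamma> \<in> carrier ?C" by (simp add: ca \<gamma>_def)
  have "(\<integral>x. real_of_int (\<gamma> x) \<partial>\<mu>) = 0" if \<mu>: "invariant_borel_prob X \<mu>" for \<mu>
  proof -
    have "(\<integral>x. real_of_int (\<gamma> x) \<partial>\<mu>) = (\<integral>x. real_of_int (g x) \<partial>\<mu>)"
      using \<mu> by (intro Bochner_Integration.integral_cong) (auto simp: invariant_borel_prob_def \<gamma>_def)
    also have "\<dots> = 0" using 0[OF measure_content[OF \<mu>]] g by simp
    finally show ?thesis .
  qed
  then have "?B #>\<^bsub>?C\<^esub> \<gamma> \<in> infinitesimals X" using \<gamma> unfolding infinitesimals_def by blast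
  then have coset: "?B #>\<^bsub>?C\<^esub> \<gamma> = ?B" using inf by (simp add: coinvariants_def FactGroup_def)
  have zero: "(\<lambda>x\<in>X. 0) \<in> carrier ?C"
    using locally_const_cong[of X "\<lambda>x\<in>X. 0 :: int" "\<lambda>_. 0"] by (simp add: ca)
  have "(\<lambda>x\<in>X. 0 :: int) = (\<lambda>x\<in>X. (\<lambda>x\<in>X. 0) x - (\<lambda>x\<in>X. 0) (shift_by (- 1) x))" by (auto simp: fun_eq_iff)
  then have "(\<lambda>x\<in>X. 0) \<in> ?B" unfolding coboundaries_def by (rule image_eqI[OF _ zero])
  moreover have "(\<lambda>x\<in>X. 0) \<otimes>\<^bsub>?C\<^esub> \<gamma> = \<gamma>" by (auto simp: cont_int_group_def \<gamma>_def fun_eq_iff)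
  ultimately have "\<gamma> \<in> ?B #>\<^bsub>?C\<^esub> \<gamma>" unfolding r_coset_def by force
  then have "\<gamma> \<in> ?B" using coset by simp
  then obtain h where h: "h \<in> carrier ?C" "\<gamma> = (\<lambda>x\<in>X. h x - h (shift_by (- 1) x))"
    by (auto simp: coboundaries_def)
  show ?thesis
  proof (rule that[of h])
    show "locally_const X h" using h(1) ca by blast
    fix x assume "x \<in> X"
    then show "g x = h x - h (shift_by (- 1) x)" using fun_cong[OF h(2), of x] by (simp add: \<gamma>_def)
  qed
qed

section \<open>Homeomorphisms acting trivially\<close>

text \<open>The power of the shift can be traded for time: (T^k x, \<tau> x t) and (x, \<tau> x t +
  k) represent the same point. So f is a time change.\<close>

lemma homeo_plus_0_if_lift_over_shift:
  assumes f: "f \<in> homeo_plus X" and \<tau>: "jointly_continuous \<tau>"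
    and mono: "\<And>x. x \<in> X \<Longrightarrow> strict_mono (\<tau> x)" and surj: "\<And>x. x \<in> X \<Longrightarrow> range (\<tau> x) = UNIV"
    and eq: "\<And>x t. x \<in> X \<Longrightarrow> \<tau> (shift x) (t - 1) = \<tau> x t - 1"
    and fc: "\<And>x t. x \<in> X \<Longrightarrow> f (cls x t) = cls (shift_by k x) (\<tau> x t)"
  shows "f \<in> homeo_plus_0 X"
proof -
  define \<sigma> where "\<sigma> x t = \<tau> x t + real_of_int k" for x t
  have tc: "time_change \<sigma>"
    unfolding time_change_def
  proof (intro conjI ballI allI)
    show "jointly_continuous \<sigma>" using \<tau> unfolding jointly_continuous_def \<sigma>_def by simp
    fix x assume x: "x \<in> X"
    show "strict_mono (\<sigma> x)" using mono[OF x] by (simp add: strict_mono_def \<sigma>_def)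
    have "r \<in> range (\<sigma> x)" for r
    proof -
      obtain t where "\<tau> x t = r - real_of_int k" using surj[OF x] by (metis surj_def)
      then show ?thesis by (intro range_eqI[of _ _ t]) (simp add: \<sigma>_def)
    qed
    then show "range (\<sigma> x) = UNIV" by blast
    show "\<sigma> (shift x) (t - 1) = \<sigma> x t - 1" for t using eq[OF x] by (simp add: \<sigma>_def)
  qed
  have "f = time_change_map \<sigma>"
  proof
    fix c
    show "f c = time_change_map \<sigma> c"
    proof (cases "c \<in> suspension X")
      case True
      then obtain x t where x: "x \<in> X" "c = cls x t" by (rule suspensionE)
      then show ?thesis using fc time_change_map_cls[OF tc] by (simp add: cls_shift \<sigma>_def)
    next
      case False
      then show ?thesis using f by (simp add: time_change_map_def homeo_plus_iff extensional_def)
    qed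
  qed
  then show ?thesis using time_change_map_isotopic[OF tc] by simp
qed

lemma homeo_plus_0_if_trivial_action:
  assumes inf: "infinitesimals X = {\<one>\<^bsub>coinvariants X\<^esub>}" and f: "f \<in> homeo_plus X"
    and triv: "\<And>\<phi>. \<phi> \<in> contents \<Longrightarrow> content_act f \<phi> = \<phi>"
    and t: "t \<in> special_tails" "f ` t = t"
  shows "f \<in> homeo_plus_0 X"
proof -
  obtain y \<tau> where l: "is_lift f y \<tau>" using lift_exists[OF f] by blast
  define c where "c x = lift_cocycle \<tau> x 1" for x
  have cl: "locally_const X c" unfolding c_def by (rule lift_cocycle_locally_const[OF l])
  have "\<phi> (\<lambda>x. c x - 1) = 0" if \<phi>: "\<phi> \<in> contents" for \<phi>
  proof -
    \<comment> \<open>A Birkhoff sum of the constant 1 counts steps, so that fixing all contents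
      says that c and 1 have equal integrals.\<close>
    have "pullback y \<tau> (\<lambda>_. 1) = c" by (simp add: fun_eq_iff pullback_def birkhoff_const_1 c_def)
    then have "\<phi> c = \<phi> (\<lambda>_. 1)" using content_act[OF l \<phi>, of "\<lambda>_. 1"] triv[OF \<phi>] by simp
    then show ?thesis using content_diff[OF \<phi> cl locally_const_const, of 1] by simp
  qed
  then obtain h where h: "locally_const X h" "\<And>x. x \<in> X \<Longrightarrow> c x - 1 = h x - h (shift_by (- 1) x)"
    using coboundary_of_vanishing_contents[OF inf locally_const_comp[OF cl, of "\<lambda>v. v - 1"]] by blast
  \<comment> \<open>The sign and the shift are those for which passing from y to T^b y replaces the
    cocycle c by the constant 1, which is \<open>cb\<close>.\<close>
  define b where "b x = - h (shift_by (- 1) x)" for x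
  have bl: "locally_const X b" unfolding b_def by (rule locally_const_comp[OF locally_const_shift[OF h(1)]])
  have cb: "c x + b (shift x) = 1 + b x" if "x \<in> X" for x
    using h(2)[OF that] by (simp add: b_def shift_by_shift_by)
  define z where "z x = shift_by (b x) (y x)" for x
  define \<sigma> where "\<sigma> x t = \<tau> x t - real_of_int (b x)" for x t
  have zX: "z x \<in> X" if "x \<in> X" for x using lift_mem[OF l that] by (simp add: z_def)
  have z1: "z (shift x) = shift (z x)" if x: "x \<in> X" for x
    using lift_cocycle(1)[OF l x, of 1] cb[OF x] by (simp add: z_def shift_by_shift_by c_def add.commute)
  have \<sigma>1: "\<sigma> (shift x) (t - 1) = \<sigma> x t - 1" if x: "x \<in> X" for x t
  proof -
    have "\<tau> (shift x) (t - 1) = \<tau> x t - real_of_int (c x)" using lift_cocycle(2)[OF l x, of 1 t] by (simp add: c_def)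
    moreover have "real_of_int (c x) + real_of_int (b (shift x)) = 1 + real_of_int (b x)"
      using cb[OF x] by (metis of_int_1 of_int_add)
    ultimately show ?thesis by (simp add: \<sigma>_def)
  qed
  have fz: "f (cls x t) = cls (z x) (\<sigma> x t)" if "x \<in> X" for x t
    using lift_cls[OF l that] lift_mem[OF l that] by (simp add: z_def \<sigma>_def cls_shift)
  have \<sigma>c: "jointly_continuous \<sigma>"
    unfolding jointly_continuous_def
  proof (intro ballI allI impI)
    fix x t and e :: real assume x: "x \<in> X" and e: "e > 0"
    obtain n d where d: "d > 0" "\<forall>u\<in>X. \<forall>s. agree n x u \<and> \<bar>s - t\<bar> < d \<longrightarrow> \<bar>\<tau> u s - \<tau> x t\<bar> < e"
      using jointly_continuousD[OF lift_jcont[OF l] x e] by blast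
    obtain m where m: "\<forall>u\<in>X. agree m x u \<longrightarrow> b u = b x" using bl x unfolding locally_const_def by blast
    have "\<bar>\<sigma> u s - \<sigma> x t\<bar> < e" if u: "u \<in> X" "agree (max n m) x u" "\<bar>s - t\<bar> < d" for u s
    proof -
      have "agree n x u" "agree m x u" using agree_mono[OF u(2)] by auto
      then have "b u = b x" "\<bar>\<tau> u s - \<tau> x t\<bar> < e" using m d(2) u by blast+
      then show ?thesis by (simp add: \<sigma>_def)
    qed
    then show "\<exists>n. \<exists>d>0. \<forall>u\<in>X. \<forall>s. agree n x u \<and> \<bar>s - t\<bar> < d \<longrightarrow> \<bar>\<sigma> u s - \<sigma> x t\<bar> < e" using d(1) by blast
  qed
  have zj: "z (shift_by j x) = shift_by j (z x)" if x: "x \<in> X" for j x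
  proof (induction j rule: int_induct[where k = 0])
    case (step1 i)
    then show ?case using z1[of "shift_by i x"] x by (simp add: shift_by_shift_by add.commute)
  next
    case (step2 i)
    have "shift (z (shift_by (i - 1) x)) = shift_by i (z x)"
      using z1[of "shift_by (i - 1) x"] x step2 by (simp add: shift_by_shift_by)
    then have "shift_by (- 1) (shift (z (shift_by (i - 1) x))) = shift_by (- 1) (shift_by i (z x))" by simp
    then show ?case by (simp add: shift_by_shift_by)
  qed simp
  obtain x where x: "x \<in> X" "t = tail_class x" using t(1) by (auto simp: special_tails_def branching_def)
  have "tail_class (y x) = tail_class x" using image_tail_class[OF f l x(1)] t(2) x(2) by simp
  then have "left_tail x (y x)" using tail_class_eq_iff[OF x(1) lift_mem[OF l x(1)]] by simp
  \<comment> \<open>z x lies in the orbit of y x, which belongs to the fixed asymptotic class of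
    x.\<close>
  then have "left_tail (z x) x"
    unfolding z_def using left_tail_shift left_tail_sym left_tail_trans by blast
  then obtain k m where k: "\<And>i. i \<le> m \<Longrightarrow> z x i = x (i + k)" unfolding left_tail_def by blast
  \<comment> \<open>As z also commutes with the shift, this makes it a sliding block code with a
    window of some radius R.\<close>
  have "locally_const X (\<lambda>u. z u 0)"
    unfolding locally_const_def
  proof
    fix u assume u: "u \<in> X"
    obtain n1 where n1: "\<forall>v\<in>X. agree n1 u v \<longrightarrow> b v = b u" using bl u unfolding locally_const_def by blast
    obtain n2 where n2: "\<forall>v\<in>X. agree n2 u v \<longrightarrow> agree (nat \<bar>b u\<bar>) (y u) (y v)" using lift_cont[OF l u] by blast
    have "z v 0 = z u 0" if v: "v \<in> X" "agree (max n1 n2) u v" for v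
    proof -
      have "agree n1 u v" "agree n2 u v" using agree_mono[OF v(2)] by auto
      then have "b v = b u" "agree (nat \<bar>b u\<bar>) (y u) (y v)" using n1 n2 v(1) by blast+
      then show ?thesis using agreeD[of "nat \<bar>b u\<bar>" "y u" "y v" "b u"] by (simp add: z_def shift_by_apply)
    qed
    then show "\<exists>n. \<forall>v\<in>X. agree n u v \<longrightarrow> z v 0 = z u 0" by blast
  qed
  then obtain R where R: "\<And>u v. u \<in> X \<Longrightarrow> v \<in> X \<Longrightarrow> agree R u v \<Longrightarrow> z u 0 = z v 0"
    using locally_const_uniform by blast
  \<comment> \<open>Every word of the subshift occurs far to the left in x, where z acts as a power of the shift.\<close>
  have z0: "z u 0 = u k" if u: "u \<in> X" for u
  proof -
    obtain j where j: "j \<le> m" "agree (R + nat \<bar>k\<bar>) u (shift_by j x)" using recurrent_left[OF u x(1)] by blast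
    have "agree R u (shift_by j x)" using agree_mono[OF j(2)] by simp
    then have "z u 0 = z (shift_by j x) 0" using x(1) by (intro R u) simp_all
    also have "\<dots> = x (j + k)" using k[OF j(1)] by (simp add: zj[OF x(1)] shift_by_apply)
    also have "\<dots> = u k" using agreeD[OF j(2), of k] by (simp add: shift_by_apply add.commute)
    finally show ?thesis .
  qed
  have zk: "z u = shift_by k u" if u: "u \<in> X" for u
  proof
    fix i
    have "z u i = z (shift_by i u) 0" by (simp add: zj[OF u] shift_by_apply)
    also have "\<dots> = shift_by k u i" using z0[of "shift_by i u"] u by (simp add: shift_by_apply add.commute)
    finally show "z u i = shift_by k u i" .
  qed
  show ?thesis
  proof (rule homeo_plus_0_if_lift_over_shift[OF f \<sigma>c _ _ \<sigma>1])
    fix u assume u: "u \<in> X"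
    show "strict_mono (\<sigma> u)" using lift_mono[OF l u] by (simp add: strict_mono_def \<sigma>_def)
    have "r \<in> range (\<sigma> u)" for r
    proof -
      obtain t where "\<tau> u t = r + real_of_int (b u)" using lift_surj[OF l u] by (metis surj_def)
      then show ?thesis by (intro range_eqI[of _ _ t]) (simp add: \<sigma>_def)
    qed
    then show "range (\<sigma> u) = UNIV" by blast
    show "f (cls u t) = cls (shift_by k u) (\<sigma> u t)" for t using fz[OF u] zk[OF u] by simp
  qed
qed

lemma tail_class_subset: "tail_class x \<subseteq> suspension X"
  by (auto simp: tail_class_def)

lemma special_tails_subset: "t \<in> special_tails \<Longrightarrow> t \<subseteq> suspension X"
  using tail_class_subset by (auto simp: special_tails_def)

lemma image_compose_eq: "t \<subseteq> suspension X \<Longrightarrow> compose (suspension X) f g ` t = f ` (g ` t)"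
  by (auto simp: compose_def image_image subset_iff intro!: image_eqI)

lemma content_act_scale: "content_act f (\<lambda>g. c * \<phi> g) = (\<lambda>g. c * content_act f \<phi> g)"
  by (auto simp: content_act_def Let_def fun_eq_iff)

lemma content_act_diff: "content_act f (\<lambda>g. \<phi> g - \<psi> g) = (\<lambda>g. content_act f \<phi> g - content_act f \<psi> g)"
  by (auto simp: content_act_def Let_def fun_eq_iff)

lemma content_act_sum: "content_act f (\<lambda>g. \<Sum>i\<in>I. c i * \<phi> i g) = (\<lambda>g. \<Sum>i\<in>I. c i * content_act f (\<phi> i) g)"
  by (auto simp: content_act_def Let_def fun_eq_iff)

end

section \<open>The action on atoms and the conclusion\<close>

context low_complexity_subshift
begin

abbreviation mass :: "(((int \<Rightarrow> 'a) \<Rightarrow> int) \<Rightarrow> real) \<Rightarrow> real" where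
  "mass \<phi> \<equiv> \<phi> (\<lambda>_. 1)"

text \<open>The induced permutation of extreme rays: the image of an atom under f is rescaled to
  mass 1. The factor lost here is the mass of \<open>content_act f a\<close>.\<close>

definition atom_act :: "(((int \<Rightarrow> 'a) \<times> real) set \<Rightarrow> ((int \<Rightarrow> 'a) \<times> real) set) \<Rightarrow>
    (((int \<Rightarrow> 'a) \<Rightarrow> int) \<Rightarrow> real) \<Rightarrow> ((int \<Rightarrow> 'a) \<Rightarrow> int) \<Rightarrow> real" where
  "atom_act f a = (\<lambda>g. 1 / mass (content_act f a) * content_act f a g)"

text \<open>A content of mass 0 is zero, and the inverse of f would carry it back to a, which is not
  zero.\<close>

lemma mass_content_act_pos:
  assumes f: "f \<in> homeo_plus X" and a: "contents.atom a"
  shows "mass (content_act f a) > 0"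
proof -
  interpret G: group "homeo_plus_group X" by (rule group_homeo_plus_group)
  note aE = contents.atomD[OF a]
  have fa: "content_act f a \<in> contents" by (rule content_act_mem[OF f aE(1)])
  have "content_act f a \<noteq> (\<lambda>_. 0)"
  proof
    assume 0: "content_act f a = (\<lambda>_. 0)"
    define k where "k = inv\<^bsub>homeo_plus_group X\<^esub> f"
    have k: "k \<in> homeo_plus X" "compose (suspension X) k f = (\<lambda>c\<in>suspension X. c)"
      using G.inv_closed[of f] G.l_inv[of f] f mult_homeo_plus_group[of k f] one_homeo_plus_group by (auto simp: k_def)
    have "a = content_act k (content_act f a)"
      using content_act_compose[OF k(1) f aE(1)] content_act_id[OF aE(1)] k(2) by simp
    also have "\<dots> = (\<lambda>_. 0)" unfolding 0 by (simp add: content_act_def fun_eq_iff)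
    finally show False using aE(3) by simp
  qed
  then have "mass (content_act f a) \<noteq> 0" using content_mass_zero[OF fa] by blast
  then show ?thesis using content_one_nonneg[OF fa] by simp
qed

text \<open>f acts on the cone of contents by a linear bijection with inverse given by k. A content
  below the image of a is therefore the image of one below a, up to the factor m.\<close>

lemma atom_atom_act:
  assumes f: "f \<in> homeo_plus X" and a: "contents.atom a"
  shows "contents.atom (atom_act f a)"
proof -
  interpret G: group "homeo_plus_group X" by (rule group_homeo_plus_group)
  note aE = contents.atomD[OF a]
  define k where "k = inv\<^bsub>homeo_plus_group X\<^esub> f"
  have k: "k \<in> homeo_plus X" "compose (suspension X) k f = (\<lambda>c\<in>suspension X. c)"
    "compose (suspension X) f k = (\<lambda>c\<in>suspension X. c)"
    using G.inv_closed[of f] G.l_inv[of f] G.r_inv[of f] f mult_homeo_plus_group[of k f]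
      mult_homeo_plus_group[of f k] one_homeo_plus_group by (auto simp: k_def)
  have kf: "content_act k (content_act f \<phi>) = \<phi>" "content_act f (content_act k \<phi>) = \<phi>" if "\<phi> \<in> contents" for \<phi>
    using content_act_compose[OF k(1) f that] content_act_compose[OF f k(1) that] content_act_id[OF that] k by auto
  define m where "m = mass (content_act f a)"
  have m: "m > 0" unfolding m_def by (rule mass_content_act_pos[OF f a])
  have act: "atom_act f a = (\<lambda>g. 1 / m * content_act f a g)" by (simp add: atom_act_def m_def)
  show ?thesis
    unfolding contents.atom_def
  proof (intro conjI ballI impI)
    show "atom_act f a \<in> contents"
      unfolding act using m by (intro content_scale_mem content_act_mem[OF f aE(1)]) simp
    show "mass (atom_act f a) = 1" using m by (simp add: act m_def)
    fix \<psi> assume \<psi>: "\<psi> \<in> contents" "(\<lambda>g. atom_act f a g - \<psi> g) \<in> contents"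
    have "content_act k (\<lambda>g. atom_act f a g - \<psi> g) = (\<lambda>g. 1 / m * a g - content_act k \<psi> g)"
      unfolding content_act_diff act content_act_scale kf(1)[OF aE(1)] ..
    then have "(\<lambda>g. 1 / m * a g - content_act k \<psi> g) \<in> contents" using content_act_mem[OF k(1) \<psi>(2)] by simp
    from content_scale_mem[OF this, of m] have "(\<lambda>g. a g - m * content_act k \<psi> g) \<in> contents"
      using m by (simp add: right_diff_distrib)
    moreover have "(\<lambda>g. m * content_act k \<psi> g) \<in> contents"
      using m by (intro content_scale_mem content_act_mem[OF k(1) \<psi>(1)]) simp
    ultimately obtain c where c: "(\<lambda>g. m * content_act k \<psi> g) = (\<lambda>g. c * a g)"
      using aE(4)[of "\<lambda>g. m * content_act k \<psi> g"] by blast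
    have "content_act f (\<lambda>g. m * content_act k \<psi> g) = (\<lambda>g. m * \<psi> g)"
      unfolding content_act_scale kf(2)[OF \<psi>(1)] ..
    then have "(\<lambda>g. m * \<psi> g) = (\<lambda>g. c * content_act f a g)" unfolding c content_act_scale by simp
    then have "m * \<psi> g = c * content_act f a g" for g by meson
    then have "\<psi> g = c * atom_act f a g" for g using m by (simp add: act field_simps)
    then show "\<exists>c. \<psi> = (\<lambda>g. c * atom_act f a g)" by blast
  qed
qed

lemma atom_act_compose:
  assumes f: "f \<in> homeo_plus X" and g: "g \<in> homeo_plus X" and a: "contents.atom a"
  shows "atom_act (compose (suspension X) f g) a = atom_act f (atom_act g a)"
proof -
  have "mass (content_act g a) > 0" by (rule mass_content_act_pos[OF g a])
  then show ?thesis
    unfolding atom_act_def content_act_scale content_act_compose[OF f g contents.atomD(1)[OF a]]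
    by (simp add: fun_eq_iff)
qed

lemma atom_act_id:
  assumes a: "contents.atom a"
  shows "atom_act (\<lambda>c\<in>suspension X. c) a = a"
  using contents.atomD(1,2)[OF a] content_act_id by (simp add: atom_act_def)

lemma content_act_fixed_atom:
  assumes f: "f \<in> homeo_plus X" and a: "contents.atom a" and fixed: "atom_act f a = a"
  shows "content_act f a = (\<lambda>g. mass (content_act f a) * a g)"
proof
  fix g
  show "content_act f a g = mass (content_act f a) * a g"
    using mass_content_act_pos[OF f a] fun_cong[OF fixed, of g] by (simp add: atom_act_def field_simps)
qed

theorem virtually_abelian_mapping_class_group:
  assumes inf: "infinitesimals X = {\<one>\<^bsub>coinvariants X\<^esub>}"
  shows "virtually_abelian (mapping_class_group X)"
proof -
  let ?G = "homeo_plus_group X"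
  interpret G: group ?G by (rule group_homeo_plus_group)
  \<comment> \<open>Atoms and special tails are combined into one finite set; fixing S pointwise
    means fixing every ray and every asymptotic class.\<close>
  define S where "S = Inl ` {a. contents.atom a} \<union> Inr ` special_tails"
  define act where "act f = case_sum (\<lambda>a. Inl (atom_act f a)) (\<lambda>t. Inr (f ` t))" for f
  note mult = mult_homeo_plus_group
  show ?thesis
    unfolding mapping_class_group_def
  proof (rule virtually_abelian_Mod[OF group_homeo_plus_group normal_homeo_plus_0, of S act])
    show "finite S" unfolding S_def using contents.finite_atoms finite_special_tails by simp
    show "act f s \<in> S" if "f \<in> carrier ?G" "s \<in> S" for f s
      using that atom_atom_act image_special_tails by (auto simp: S_def act_def)
    show "act (f \<otimes>\<^bsub>?G\<^esub> g) s = act f (act g s)" if "f \<in> carrier ?G" "g \<in> carrier ?G" "s \<in> S" for f g s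
    proof (cases s)
      case (Inl a)
      then show ?thesis using that atom_act_compose by (auto simp: S_def act_def mult)
    next
      case (Inr t)
      then have "t \<subseteq> suspension X" using that(3) special_tails_subset by (auto simp: S_def)
      then show ?thesis using that(1,2) Inr by (simp add: act_def mult image_compose_eq)
    qed
    show "act \<one>\<^bsub>?G\<^esub> s = s" if "s \<in> S" for s
      using that atom_act_id special_tails_subset
      by (auto simp: S_def act_def one_homeo_plus_group image_iff subset_iff)
    fix f g assume "f \<in> carrier ?G" "g \<in> carrier ?G" and
      fixS: "\<And>s. s \<in> S \<Longrightarrow> act f s = s" "\<And>s. s \<in> S \<Longrightarrow> act g s = s"
    then have f: "f \<in> homeo_plus X" and g: "g \<in> homeo_plus X" by auto
    have fa: "atom_act f a = a" "atom_act g a = a" if "contents.atom a" for a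
      using fixS[of "Inl a"] that by (auto simp: S_def act_def)
    have ft: "f ` t = t" "g ` t = t" if "t \<in> special_tails" for t
      using fixS[of "Inr t"] that by (auto simp: S_def act_def)
    define p where "p = compose (suspension X) f g"
    define q where "q = compose (suspension X) g f"
    define k where "k = inv\<^bsub>?G\<^esub> (g \<otimes>\<^bsub>?G\<^esub> f)"
    have q: "q = g \<otimes>\<^bsub>?G\<^esub> f" "q \<in> homeo_plus X" using f g homeo_plus_compose by (auto simp: q_def mult)
    have p: "p = f \<otimes>\<^bsub>?G\<^esub> g" "p \<in> homeo_plus X" using f g homeo_plus_compose by (auto simp: p_def mult)
    have k: "k \<in> homeo_plus X" "compose (suspension X) k q = (\<lambda>c\<in>suspension X. c)"
      using G.inv_closed[of q] G.l_inv[of q] q mult[of k q] one_homeo_plus_group by (auto simp: k_def)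
    define h where "h = compose (suspension X) p k"
    have h: "h = f \<otimes>\<^bsub>?G\<^esub> g \<otimes>\<^bsub>?G\<^esub> inv\<^bsub>?G\<^esub> (g \<otimes>\<^bsub>?G\<^esub> f)" "h \<in> homeo_plus X"
      using p k homeo_plus_compose by (auto simp: h_def mult k_def[symmetric])
    \<comment> \<open>On the ray of a the maps f and g act as multiplication by u and v. The
      composites in either order multiply by u * v, so h, one of them times the inverse of the
      other, acts trivially.\<close>
    have "content_act h a = a" if a: "contents.atom a" for a
    proof -
      note aE = contents.atomD(1)[OF a]
      define u where "u = mass (content_act f a)"
      define v where "v = mass (content_act g a)"
      have uv: "u > 0" "v > 0" using mass_content_act_pos f g a by (auto simp: u_def v_def)
      have fu: "content_act f a = (\<lambda>w. u * a w)" and gv: "content_act g a = (\<lambda>w. v * a w)"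
        unfolding u_def v_def using content_act_fixed_atom f g a fa by blast+
      have pa: "content_act p a = (\<lambda>w. u * v * a w)"
        unfolding p_def content_act_compose[OF f g aE] gv content_act_scale fu by (simp add: mult.left_commute mult.assoc)
      have qa: "content_act q a = (\<lambda>w. u * v * a w)"
        unfolding q_def content_act_compose[OF g f aE] fu content_act_scale gv by (simp add: mult.assoc)
      have "a = content_act k (content_act q a)"
        using content_act_compose[OF k(1) q(2) aE] k(2) content_act_id[OF aE] by simp
      also have "\<dots> = (\<lambda>w. u * v * content_act k a w)" unfolding qa content_act_scale ..
      finally have "a w = u * v * content_act k a w" for w by (rule fun_cong)
      then have "content_act k a w = 1 / (u * v) * a w" for w using uv by (simp add: field_simps)
      then have ka: "content_act k a = (\<lambda>w. 1 / (u * v) * a w)" by blast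
      show ?thesis
        unfolding h_def content_act_compose[OF p(2) k(1) aE] ka content_act_scale pa using uv by (simp add: fun_eq_iff)
    qed
    then have triv: "content_act h \<phi> = \<phi>" if \<phi>: "\<phi> \<in> contents" for \<phi>
    proof -
      obtain c where c: "\<phi> = (\<lambda>w. \<Sum>a | contents.atom a. c a * a w)"
        using contents.atomic_decomposition[OF \<phi>] by blast
      show ?thesis
        unfolding c content_act_sum using \<open>\<And>a. contents.atom a \<Longrightarrow> content_act h a = a\<close> by simp
    qed
    obtain t where t: "t \<in> special_tails" using special_tails_nonempty by blast
    note ts = special_tails_subset[OF t]
    have "k ` t = k ` (q ` t)" unfolding q_def image_compose_eq[OF ts] using ft[OF t] by simp
    also have "\<dots> = (\<lambda>c\<in>suspension X. c) ` t" using image_compose_eq[OF ts, of k q] k(2) by simp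
    also have "\<dots> = t" using ts by (auto simp: image_iff subset_iff)
    finally have "h ` t = t"
      unfolding h_def p_def image_compose_eq[OF ts] using ft[OF t] by (simp add: image_compose_eq[OF ts])
    then show "f \<otimes>\<^bsub>?G\<^esub> g \<otimes>\<^bsub>?G\<^esub> inv\<^bsub>?G\<^esub> (g \<otimes>\<^bsub>?G\<^esub> f) \<in> homeo_plus_0 X"
      using homeo_plus_0_if_trivial_action[OF inf h(2) triv t] h(1) by simp
  qed
qed

end

lemma infinite_if_cantor_space:
  assumes "cantor_space (shift_space X)"
  shows "infinite X"
proof
  assume X: "finite X"
  let ?P = "product_topology (\<lambda>_::nat. discrete_topology (UNIV :: bool set)) UNIV"
  obtain f where "homeomorphic_map (shift_space X) ?P f"
    using assms unfolding cantor_space_def homeomorphic_space by blast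
  then have "f ` X = topspace ?P" using homeomorphic_imp_surjective_map by fastforce
  then have "finite (topspace ?P)" using X by (metis finite_imageI)
  moreover have "topspace ?P = (UNIV :: (nat \<Rightarrow> bool) set)" by auto
  ultimately have "finite (UNIV :: (nat \<Rightarrow> bool) set)" by simp
  then have "finite (UNIV :: nat set)" by (rule finite_fun_UNIVD1) simp
  then show False by simp
qed

theorem theorem1p3:
  fixes X :: "(int \<Rightarrow> 'a::finite) set"
  assumes "minimal_subshift X"
    and "cantor_space (shift_space X)"
    and "infinitesimals X = {\<one>\<^bsub>coinvariants X\<^esub>}"
    and "liminf (\<lambda>n. ereal (real (complexity X n) / real n)) < \<infinity>"
  shows "virtually_abelian (mapping_class_group X)"
proof -
  interpret minimal_infinite_subshift X
    using assms(1) infinite_if_cantor_space[OF assms(2)] by unfold_locales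
  obtain C where C: "\<And>N. \<exists>n\<ge>N. card (right_special X n) \<le> C"
    using frequently_few_right_special[OF assms(4)] by blast
  interpret low_complexity_subshift X C
    by unfold_locales (rule C)
  show ?thesis by (rule virtually_abelian_mapping_class_group[OF assms(3)])
qed

end
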